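(* Let $\Omega\subseteq\mathbb{R}^n$ be a domain and let $X(\Omega)$ be a Banach function space on $\Omega$ such that: (i) $X(\Omega)$ has the Fatou property; (ii) the norm of $X(\Omega)$ is absolutely continuous; (iii) $X(\Omega)$ satisfies the Muckenhoupt condition on $\Omega$; (iv) $X(\Omega)$ has property $\mathcal{G}(\Omega)$. Then $H^1_X(\Omega)=W^1_X(\Omega)$.
   Context: A domain $\Omega\subseteq\mathbb{R}^n$ is an open connected set (not necessarily bounded). $L^0(\Omega)$ denotes the Lebesgue measurable functions on $\Omega$ (identified if equal a.e.). Cubes have sides parallel to the coordinate axes. Banach function space: a vector subspace $X(\Omega)\subseteq L^0(\Omega)$ equipped with a norm $\|\cdot\|_{X(\Omega)}$, complete in this norm, and satisfying: (ideal property) if $f\in X(\Omega)$, $g\in L^0(\Omega)$ and $|g|\le|f|$, then $g\in X(\Omega)$ and $\|g\|_{X(\Omega)}\le\|f\|_{X(\Omega)}$; (saturation property) for every measurable $E\subseteq\Omega$ of positive measure there is a measurable $F\subseteq E$ of positive measure with $\chi_F\in X(\Omega)$. Associate space: $X'(\Omega)$ is the set of $g\in L^0(\Omega)$ with $fg\in L^1(\Omega)$ for all $f\in X(\Omega)$, with $\|g\|_{X'(\Omega)}=\sup\{\int_\Omega|fg|\,dx: f\in X(\Omega),\ \|f\|_{X(\Omega)}=1\}$. Fatou property: if $0\le f_1\le f_2\le\cdots$ are in $X(\Omega)$, $\sup_k\|f_k\|_{X(\Omega)}<\infty$ and $f_k\uparrow f$ pointwise, then $f\in X(\Omega)$ and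 $\|f\|_{X(\Omega)}=\lim_k\|f_k\|_{X(\Omega)}$. Absolutely continuous norm: for every $f\in X(\Omega)$ and every sequence of measurable sets $E_1\supset E_2\supset\cdots$ in $\Omega$ with $\bigcap_k E_k=\emptyset$, $\lim_{k}\|f\chi_{E_k}\|_{X(\Omega)}=0$. Muckenhoupt condition: for every cube $Q\subset\Omega$, $\chi_Q\in X(\Omega)$ and $\chi_Q\in X'(\Omega)$, and $\sup_{Q}|Q|^{-1}\|\chi_Q\|_{X(\Omega)}\|\chi_Q\|_{X'(\Omega)}<\infty$, the supremum being over all cubes $Q\subset\Omega$. Property $\mathcal{G}(\Omega)$: there is a constant $G$ such that for all $f\in X(\Omega)$, $g\in X'(\Omega)$ and all collections $\mathcal{Q}$ of pairwise disjoint cubes $Q\subseteq\Omega$, $\sum_{Q\in\mathcal{Q}}\|\chi_Qf\|_{X(\Omega)}\|\chi_Qg\|_{X'(\Omega)}\le G\|f\|_{X(\Omega)}\|g\|_{X'(\Omega)}$. Sobolev spaces: $W^{1,1}_{loc}(\Omega)$ is the set of $f\in L^1_{loc}(\Omega)$ whose distributional partial derivatives $\partial_jf$, $j=1,\dots,n$, exist and lie in $L^1_{loc}(\Omega)$; $\nabla f=(\partial_1f,\dots,\partial_nf)$. $W^1_X(\Omega)$ is the set of $f\in W^{1,1}_{loc}(\Omega)$ (identified with the pairs $(f,\nabla f)$) with $f$ and all $\partial_j f$ in $X(\Omega)$, i.e. $\|f\|_{W^1_X(\Omega)}=\|f\|_{X(\Omega)}+\|\nabla f\|_{X(\Omega)}<\infty$,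 where $\|\nabla f\|_{X(\Omega)}=\|\,|\nabla f|\,\|_{X(\Omega)}$. $\mathrm{Lip}(\Omega)$ is the set of locally Lipschitz functions on $\Omega$. $H^1_X(\Omega)$ is the formal closure of $\mathrm{Lip}(\Omega)\cap W^1_X(\Omega)$ in the $W^1_X(\Omega)$ norm: the equivalence classes of Cauchy sequences $(f_k,\nabla f_k)$ with $f_k\in\mathrm{Lip}(\Omega)\cap W^1_X(\Omega)$ (two sequences being equivalent if their difference tends to $0$ in norm), each class being identified with the pair $(f,\mathbf{g})\in X(\Omega)\oplus X(\Omega)^n$ to which the sequence converges. The equality $H^1_X(\Omega)=W^1_X(\Omega)$ is understood through the identification $f\leftrightarrow(f,\nabla f)$. *)

theory Defs
  imports "HOL-Analysis.Analysis"
begin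

text \<open>
  Elements of $L^0(\Omega)$ are represented by functions on the whole of $\mathbb{R}^n$ whose
  values outside $\Omega$ are irrelevant.  There is no quotient by almost everywhere equality:
  every function space below is closed under changing a function on a null subset of $\Omega$
  or outside $\Omega$, and the norms do not see such changes, so that equality of these spaces is
  equality of the corresponding sets of classes.  The exceptions are the locally Lipschitz functions
  and the test functions, which are genuine functions rather than classes.
\<close>

definition domain_in_space :: "(real^'n::finite) set \<Rightarrow> bool" where
  "domain_in_space \<Omega> \<longleftrightarrow> open \<Omega> \<and> connected \<Omega>"

definition L0 :: "(real^'n::finite) set \<Rightarrow> ((real^'n) \<Rightarrow> real) set" where
  "L0 \<Omega> = borel_measurable (lebesgue_on \<Omega>)"


section \<open>Banach function spaces\<close>

text \<open>The space is a pair: the set \<open>X\<close> and the norm \<open>N\<close>, of which only the values on \<open>X\<close> matter.\<close>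

locale banach_function_space =
  fixes \<Omega> :: "(real^'n::finite) set"
    and X :: "((real^'n) \<Rightarrow> real) set"
    and N :: "((real^'n) \<Rightarrow> real) \<Rightarrow> real"
  assumes subset_L0: "X \<subseteq> L0 \<Omega>"
    and zero_mem: "(\<lambda>x. 0) \<in> X"
    and add_mem: "\<lbrakk>f \<in> X; g \<in> X\<rbrakk> \<Longrightarrow> (\<lambda>x. f x + g x) \<in> X"
    and scale_mem: "f \<in> X \<Longrightarrow> (\<lambda>x. c * f x) \<in> X"
    and norm_nonneg: "f \<in> X \<Longrightarrow> 0 \<le> N f"
    and norm_eq_0_iff: "f \<in> X \<Longrightarrow> N f = 0 \<longleftrightarrow> (AE x in lebesgue_on \<Omega>. f x = 0)"
    and norm_scale: "f \<in> X \<Longrightarrow> N (\<lambda>x. c * f x) = \<bar>c\<bar> * N f"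
    and norm_triangle: "\<lbrakk>f \<in> X; g \<in> X\<rbrakk> \<Longrightarrow> N (\<lambda>x. f x + g x) \<le> N f + N g"
    and complete: "\<lbrakk>\<And>k. u k \<in> X;
        \<forall>e>0. \<exists>K. \<forall>k\<ge>K. \<forall>l\<ge>K. N (\<lambda>x. u k x - u l x) < e\<rbrakk>
        \<Longrightarrow> \<exists>f\<in>X. (\<lambda>k. N (\<lambda>x. u k x - f x)) \<longlonglongrightarrow> 0"
    and ideal_property: "\<lbrakk>f \<in> X; g \<in> L0 \<Omega>; AE x in lebesgue_on \<Omega>. \<bar>g x\<bar> \<le> \<bar>f x\<bar>\<rbrakk>
        \<Longrightarrow> g \<in> X \<and> N g \<le> N f"
    and saturation: "\<lbrakk>E \<in> sets (lebesgue_on \<Omega>); emeasure lebesgue E > 0\<rbrakk>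
        \<Longrightarrow> \<exists>F\<in>sets (lebesgue_on \<Omega>). F \<subseteq> E \<and> emeasure lebesgue F > 0 \<and> indicat_real F \<in> X"

definition associate_space ::
    "(real^'n::finite) set \<Rightarrow> ((real^'n) \<Rightarrow> real) set \<Rightarrow> ((real^'n) \<Rightarrow> real) set" where
  "associate_space \<Omega> X = {g \<in> L0 \<Omega>. \<forall>f\<in>X. integrable (lebesgue_on \<Omega>) (\<lambda>x. f x * g x)}"

text \<open>
  The associate norm, its supremum being taken in $[0,\infty]$, which avoids the unspecified real
  supremum of an empty or unbounded set.
\<close>

definition associate_norm ::
    "(real^'n::finite) set \<Rightarrow> ((real^'n) \<Rightarrow> real) set \<Rightarrow> (((real^'n) \<Rightarrow> real) \<Rightarrow> real)
      \<Rightarrow> ((real^'n) \<Rightarrow> real) \<Rightarrow> ennreal" where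
  "associate_norm \<Omega> X N g =
     (SUP f\<in>{f \<in> X. N f = 1}. \<integral>\<^sup>+x. ennreal \<bar>f x * g x\<bar> \<partial>lebesgue_on \<Omega>)"

definition fatou_property ::
    "(real^'n::finite) set \<Rightarrow> ((real^'n) \<Rightarrow> real) set \<Rightarrow> (((real^'n) \<Rightarrow> real) \<Rightarrow> real) \<Rightarrow> bool" where
  "fatou_property \<Omega> X N \<longleftrightarrow>
     (\<forall>u f. (\<forall>k. u k \<in> X)
        \<and> (AE x in lebesgue_on \<Omega>. (\<forall>k. 0 \<le> u k x \<and> u k x \<le> u (Suc k) x) \<and> (\<lambda>k. u k x) \<longlonglongrightarrow> f x)
        \<and> bdd_above (range (\<lambda>k. N (u k)))
      \<longrightarrow> f \<in> X \<and> (\<lambda>k. N (u k)) \<longlonglongrightarrow> N f)"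

definition absolutely_continuous_norm ::
    "(real^'n::finite) set \<Rightarrow> ((real^'n) \<Rightarrow> real) set \<Rightarrow> (((real^'n) \<Rightarrow> real) \<Rightarrow> real) \<Rightarrow> bool" where
  "absolutely_continuous_norm \<Omega> X N \<longleftrightarrow>
     (\<forall>f\<in>X. \<forall>E. (\<forall>k::nat. E k \<in> sets (lebesgue_on \<Omega>)) \<and> decseq E \<and> (\<Inter>k. E k) = {}
        \<longrightarrow> (\<lambda>k. N (\<lambda>x. f x * indicat_real (E k) x)) \<longlonglongrightarrow> 0)"

text \<open>
  Cubes are closed and non-degenerate.  Replacing the cubes in the two conditions below by open or
  half-open ones gives formally stronger conditions, since the interior of a cube in \<open>\<Omega>\<close>
  lies in \<open>\<Omega>\<close>, differs from the cube by a null set, and interiors of disjoint cubes are disjoint;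
  in the presence of the Fatou property all these variants are equivalent.
\<close>

definition cubes_in :: "(real^'n::finite) set \<Rightarrow> (real^'n) set set" where
  "cubes_in \<Omega> = {Q. Q \<subseteq> \<Omega> \<and> (\<exists>a l. 0 < l \<and> Q = cbox a (a + vec l))}"

definition muckenhoupt_condition ::
    "(real^'n::finite) set \<Rightarrow> ((real^'n) \<Rightarrow> real) set \<Rightarrow> (((real^'n) \<Rightarrow> real) \<Rightarrow> real) \<Rightarrow> bool" where
  "muckenhoupt_condition \<Omega> X N \<longleftrightarrow>
     (\<forall>Q\<in>cubes_in \<Omega>. indicat_real Q \<in> X \<and> indicat_real Q \<in> associate_space \<Omega> X)
     \<and> (SUP Q\<in>cubes_in \<Omega>. ennreal (N (indicat_real Q))
            * associate_norm \<Omega> X N (indicat_real Q) / emeasure lebesgue Q) < \<infinity>"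

definition property_G ::
    "(real^'n::finite) set \<Rightarrow> ((real^'n) \<Rightarrow> real) set \<Rightarrow> (((real^'n) \<Rightarrow> real) \<Rightarrow> real) \<Rightarrow> bool" where
  "property_G \<Omega> X N \<longleftrightarrow>
     (\<exists>G::real. 0 \<le> G \<and>
        (\<forall>f\<in>X. \<forall>g\<in>associate_space \<Omega> X. \<forall>\<Q>. \<Q> \<subseteq> cubes_in \<Omega> \<and> disjoint \<Q> \<longrightarrow>
          (\<Sum>\<^sub>\<infinity>Q\<in>\<Q>. ennreal (N (\<lambda>x. indicat_real Q x * f x))
                  * associate_norm \<Omega> X N (\<lambda>x. indicat_real Q x * g x))
            \<le> ennreal G * ennreal (N f) * associate_norm \<Omega> X N g))"


section \<open>Weak derivatives\<close>

definition partial_deriv :: "'n::finite \<Rightarrow> ((real^'n) \<Rightarrow> real) \<Rightarrow> (real^'n) \<Rightarrow> real" where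
  "partial_deriv j \<phi> x = frechet_derivative \<phi> (at x) (axis j 1)"

fun C_k :: "nat \<Rightarrow> ((real^'n::finite) \<Rightarrow> real) \<Rightarrow> bool" where
  "C_k 0 \<phi> \<longleftrightarrow> continuous_on UNIV \<phi>"
| "C_k (Suc k) \<phi> \<longleftrightarrow> (\<forall>x. \<phi> differentiable (at x)) \<and> (\<forall>j. C_k k (partial_deriv j \<phi>))"

definition test_functions :: "(real^'n::finite) set \<Rightarrow> ((real^'n) \<Rightarrow> real) set" where
  "test_functions \<Omega> =
     {\<phi>. (\<forall>k. C_k k \<phi>) \<and> compact (closure {x. \<phi> x \<noteq> 0}) \<and> closure {x. \<phi> x \<noteq> 0} \<subseteq> \<Omega>}"

definition L1_loc :: "(real^'n::finite) set \<Rightarrow> ((real^'n) \<Rightarrow> real) set" where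
  "L1_loc \<Omega> = {f \<in> L0 \<Omega>. \<forall>K. compact K \<and> K \<subseteq> \<Omega> \<longrightarrow> set_integrable lebesgue K f}"

definition weak_partial_deriv ::
    "(real^'n::finite) set \<Rightarrow> 'n \<Rightarrow> ((real^'n) \<Rightarrow> real) \<Rightarrow> ((real^'n) \<Rightarrow> real) \<Rightarrow> bool" where
  "weak_partial_deriv \<Omega> j f h \<longleftrightarrow>
     (\<forall>\<phi>\<in>test_functions \<Omega>.
        (LINT x:\<Omega>|lebesgue. f x * partial_deriv j \<phi> x) = - (LINT x:\<Omega>|lebesgue. h x * \<phi> x))"


section \<open>Sobolev spaces\<close>

text \<open>
  All Sobolev spaces are sets of pairs \<open>(f, g)\<close> where \<open>g\<close> is (a representative of) the weak
  gradient of \<open>f\<close>, respectively a limit of gradients.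
\<close>

definition W11_loc :: "(real^'n::finite) set \<Rightarrow> (((real^'n) \<Rightarrow> real) \<times> ((real^'n) \<Rightarrow> real^'n)) set" where
  "W11_loc \<Omega> = {(f, g). f \<in> L1_loc \<Omega> \<and>
     (\<forall>j. (\<lambda>x. g x $ j) \<in> L1_loc \<Omega> \<and> weak_partial_deriv \<Omega> j f (\<lambda>x. g x $ j))}"

definition W1_X ::
    "(real^'n::finite) set \<Rightarrow> ((real^'n) \<Rightarrow> real) set
      \<Rightarrow> (((real^'n) \<Rightarrow> real) \<times> ((real^'n) \<Rightarrow> real^'n)) set" where
  "W1_X \<Omega> X = {(f, g). (f, g) \<in> W11_loc \<Omega> \<and> f \<in> X \<and> (\<forall>j. (\<lambda>x. g x $ j) \<in> X)}"

definition W1_norm ::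
    "(((real^'n::finite) \<Rightarrow> real) \<Rightarrow> real) \<Rightarrow> ((real^'n) \<Rightarrow> real) \<Rightarrow> ((real^'n) \<Rightarrow> real^'n) \<Rightarrow> real" where
  "W1_norm N f g = N f + N (\<lambda>x. norm (g x))"

definition Lip :: "(real^'n::finite) set \<Rightarrow> ((real^'n) \<Rightarrow> real) set" where
  "Lip \<Omega> = {f. \<forall>x\<in>\<Omega>. \<exists>r>0. \<exists>C. C-lipschitz_on (ball x r \<inter> \<Omega>) f}"

text \<open>
  An equivalence class of Cauchy sequences corresponds to the pair it converges to in
  $X(\Omega) \oplus X(\Omega)^n$, so the formal closure is the set of these limit pairs.  The second
  component of such a pair is not required to be a weak gradient of the first one.
\<close>

definition H1_X ::
    "(real^'n::finite) set \<Rightarrow> ((real^'n) \<Rightarrow> real) set \<Rightarrow> (((real^'n) \<Rightarrow> real) \<Rightarrow> real)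
      \<Rightarrow> (((real^'n) \<Rightarrow> real) \<times> ((real^'n) \<Rightarrow> real^'n)) set" where
  "H1_X \<Omega> X N = {(f, g). f \<in> X \<and> (\<forall>j. (\<lambda>x. g x $ j) \<in> X) \<and>
     (\<exists>u v. (\<forall>k. u k \<in> Lip \<Omega> \<and> (u k, v k) \<in> W1_X \<Omega> X)
        \<and> (\<forall>e>0. \<exists>K. \<forall>k\<ge>K. \<forall>l\<ge>K. W1_norm N (\<lambda>x. u k x - u l x) (\<lambda>x. v k x - v l x) < e)
        \<and> (\<lambda>k::nat. W1_norm N (\<lambda>x. u k x - f x) (\<lambda>x. v k x - g x)) \<longlonglongrightarrow> 0)}"

end

theory Submission
  imports Defs
begin

text \<open>
  The inclusion $H^1_X \subseteq W^1_X$ holds because the Muckenhoupt condition embeds $X$ into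
  $L^1_{loc}$, so that weak derivatives pass to limits.  The other inclusion is a Meyers--Serrin
  argument: $f$ is cut into pieces by a smooth partition of unity, each piece is mollified with its own
  small radius, and the pieces are summed up.  It needs that mollification at scale $s$ is bounded
  on $X$ uniformly in $s$.  As the norm is absolutely continuous, $X$ is
  normed by its associate space (Lorentz--Luxemburg), so it suffices to bound the pairing of
  $\varphi_s * h$ with $g \in X'$.  On a grid cube of side $s$ the mollification is at most a multiple of the
  mean of $|h|$ over the concentric cube $Q$ of side $3s$, so the pairing is at most a sum of terms
  $|Q|^{-1} \int_Q |h| \int_Q |g|$ over finitely many families of disjoint cubes; Hoelder's inequality and
  the Muckenhoupt condition bound each term by a multiple of
  $\|\chi_Q h\|_X \|\chi_Q g\|_{X'}$, and property $\mathcal{G}$ bounds their sum.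
\<close>

section \<open>Continuously differentiable functions\<close>

text \<open>Boundedness of the maximal operator on X is not among the hypotheses, so mollifications
  cannot be controlled through it. What is available is one scale at a time: at scale s only cubes
  of side 3s occur, the kernel bound A / s^n cancels their measure (3s)^n, and the constant does not
  depend on s. The hypotheses on cubes concern cubes inside \<Omega>; hence mollification is applied
  to functions with compact support in \<Omega>, at scales small against the distance to the
  boundary, and this forces the partition of unity. Absolute continuity of the norm acts through a
  dominated convergence theorem in X. It closes balls of X under dominated almost everywhere limits,
  which the duality argument needs, and it approximates elements of X with compact support by
  continuous functions, which turns uniform boundedness of mollification into convergence. Duality
  is applied to bounded functions with compact support, which lie in X and in L2 alike. The Fatou
  property enters where infinitely many mollification errors are summed. All kernels are even, so
  that the derivative of a mollified piece is the mollification of its weak derivative.\<close>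

lemma partial_deriv_eq:
  assumes "(f has_derivative f') (at x)"
  shows "partial_deriv j f x = f' (axis j 1)"
  using assms frechet_derivative_at unfolding partial_deriv_def by metis

lemma C_k_SucI:
  assumes "\<And>x. (f has_derivative f' x) (at x)" "\<And>j. C_k k (\<lambda>x. f' x (axis j 1))"
  shows "C_k (Suc k) f"
proof -
  have "partial_deriv j f = (\<lambda>x. f' x (axis j 1))" for j
    using partial_deriv_eq[OF assms(1)] by auto
  then show ?thesis using assms by (auto simp: differentiable_def)
qed

lemma C_k_has_derivative:
  assumes "C_k (Suc k) f"
  shows "(f has_derivative (\<lambda>t. \<Sum>j\<in>UNIV. t $ j * partial_deriv j f x)) (at x)"
proof -
  have d: "(f has_derivative frechet_derivative f (at x)) (at x)"
    using assms frechet_derivative_works by auto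
  then interpret bounded_linear "frechet_derivative f (at x)"
    by (rule has_derivative_bounded_linear)
  have "frechet_derivative f (at x) t = (\<Sum>j\<in>UNIV. t $ j * partial_deriv j f x)" for t
  proof -
    have "t = (\<Sum>j\<in>UNIV. t $ j *\<^sub>R axis j 1)"
      by (metis (no_types, lifting) basis_expansion scalar_mult_eq_scaleR sum.cong)
    then have "frechet_derivative f (at x) t = frechet_derivative f (at x) (\<Sum>j\<in>UNIV. t $ j *\<^sub>R axis j 1)"
      by simp
    also have "\<dots> = (\<Sum>j\<in>UNIV. t $ j * partial_deriv j f x)"
      by (simp add: sum scaleR partial_deriv_def)
    finally show ?thesis .
  qed
  then show ?thesis using d by (metis (no_types, lifting) ext)
qed

lemma C_k_imp_continuous: "C_k k f \<Longrightarrow> continuous_on UNIV f"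
  by (cases k) (auto simp: continuous_on_eq_continuous_at intro: differentiable_imp_continuous_within)

lemma C_k_Suc_imp: "C_k (Suc k) f \<Longrightarrow> C_k k f"
proof (induction k arbitrary: f)
  case 0
  then show ?case using C_k_imp_continuous by (metis C_k.simps(1))
next
  case (Suc k)
  then show ?case by (metis C_k.simps(2))
qed

lemma C_k_const: "C_k k (\<lambda>x. c)"
proof (induction k arbitrary: c)
  case (Suc k)
  show ?case by (rule C_k_SucI[where f'="\<lambda>x h. 0"]) (auto intro: Suc)
qed simp

lemma C_k_add: "C_k k f \<Longrightarrow> C_k k g \<Longrightarrow> C_k k (\<lambda>x. f x + g x)"
proof (induction k arbitrary: f g)
  case 0
  then show ?case by (auto intro: continuous_intros)
next
  case (Suc k)
  have "C_k k (\<lambda>x. (\<Sum>i\<in>UNIV. (axis j 1 :: real^'a) $ i * partial_deriv i f x) + (\<Sum>i\<in>UNIV. (axis j 1 :: real^'a) $ i * partial_deriv i g x))" for j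
    using Suc by (simp add: axis_def if_distrib[where f="\<lambda>c. c * _"] cong: if_cong)
  then show ?case
    by (rule C_k_SucI[rotated]) (intro has_derivative_add C_k_has_derivative[of k] Suc.prems)
qed

lemma C_k_mult: "C_k k f \<Longrightarrow> C_k k g \<Longrightarrow> C_k k (\<lambda>x. f x * g x)"
proof (induction k arbitrary: f g)
  case 0
  then show ?case by (auto intro: continuous_intros)
next
  case (Suc k)
  have fg: "C_k k f" "C_k k g" using C_k_Suc_imp Suc.prems by blast+
  have "C_k k (\<lambda>x. f x * (\<Sum>i\<in>UNIV. (axis j 1 :: real^'a) $ i * partial_deriv i g x) + (\<Sum>i\<in>UNIV. (axis j 1 :: real^'a) $ i * partial_deriv i f x) * g x)" for j
    using Suc fg by (auto simp add: axis_def if_distrib[where f="\<lambda>c. c * _"] cong: if_cong intro!: C_k_add)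
  then show ?case
    by (rule C_k_SucI[rotated]) (intro has_derivative_mult C_k_has_derivative[of k] Suc.prems)
qed

lemma C_k_prod: "(\<And>i. i \<in> I \<Longrightarrow> C_k k (f i)) \<Longrightarrow> C_k k (\<lambda>x. \<Prod>i\<in>I. f i x)"
  by (induction I rule: infinite_finite_induct) (auto intro: C_k_const C_k_mult)

lemma C_k_diff: "C_k k f \<Longrightarrow> C_k k g \<Longrightarrow> C_k k (\<lambda>x. f x - g x)"
  using C_k_add[of k f "\<lambda>x. (-1) * g x"] C_k_mult[OF C_k_const[of k "-1"], of g] by simp

lemma C_k_translate: "C_k k f \<Longrightarrow> C_k k (\<lambda>x. f (x - a))"
  and partial_deriv_translate:
    "C_k (Suc k) f \<Longrightarrow> partial_deriv j (\<lambda>x. f (x - a)) x = partial_deriv j f (x - a)"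
proof -
  have *: "((\<lambda>x. f (x - a)) has_derivative (\<lambda>t. \<Sum>j\<in>UNIV. t $ j * partial_deriv j f (x - a))) (at x)"
    if "C_k (Suc k) f" for k x f
  proof -
    have "((\<lambda>x. x - a) has_derivative (\<lambda>t. t)) (at x)" by (auto intro!: derivative_eq_intros)
    then show ?thesis
      using has_derivative_compose[OF _ C_k_has_derivative[OF that]] by fastforce
  qed
  have sgl: "(\<Sum>i\<in>UNIV. axis j 1 $ i * c i) = c j" for c :: "'a \<Rightarrow> real" and j
    by (simp add: axis_def if_distrib[where f="\<lambda>c. c * _"] cong: if_cong)
  show "C_k k f \<Longrightarrow> C_k k (\<lambda>x. f (x - a))"
  proof (induction k arbitrary: f)
    case 0
    then show ?case
      by (auto intro!: continuous_intros continuous_on_compose2[of UNIV f])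
  next
    case (Suc k)
    show ?case
      by (rule C_k_SucI[OF *[OF Suc.prems]]) (use Suc in \<open>auto simp: sgl\<close>)
  qed
  show "C_k (Suc k) f \<Longrightarrow> partial_deriv j (\<lambda>x. f (x - a)) x = partial_deriv j f (x - a)"
    using partial_deriv_eq[OF *] by (simp add: sgl)
qed

text \<open>The classical smooth function exp(-1/t), extended by 0, with a polynomial in 1/t in
  front. The factor makes the family closed under differentiation, so smoothness becomes an
  induction on the order.\<close>

definition flat :: "real poly \<Rightarrow> real \<Rightarrow> real" where
  "flat p t = (if t > 0 then poly p (1 / t) * exp (- (1 / t)) else 0)"

lemma poly_times_exp_tendsto_0: "((\<lambda>y. poly p y * exp (- y)) \<longlongrightarrow> 0) (at_top :: real filter)"
proof -
  have "((\<lambda>y. \<Sum>i\<le>degree p. coeff p i * (y ^ i / exp y)) \<longlongrightarrow> (\<Sum>i\<le>degree p. coeff p i * 0)) (at_top :: real filter)"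
    by (intro tendsto_intros tendsto_power_div_exp_0)
  then show ?thesis
    by (simp add: poly_altdef sum_distrib_right exp_minus divide_inverse mult.assoc)
qed

lemma flat_tendsto_0: "(flat p \<longlongrightarrow> 0) (at 0)"
proof -
  have "((\<lambda>t. poly p (inverse t) * exp (- inverse t)) \<longlongrightarrow> 0) (at_right (0::real))"
    using filterlim_compose[OF poly_times_exp_tendsto_0 filterlim_inverse_at_top_right] by simp
  moreover have "eventually (\<lambda>t. poly p (inverse t) * exp (- inverse t) = flat p t) (at_right (0::real))"
    unfolding eventually_at_right_field by (rule exI[of _ 1]) (auto simp: flat_def inverse_eq_divide)
  ultimately have r: "(flat p \<longlongrightarrow> 0) (at_right 0)" using Lim_transform_eventually by fast
  have "eventually (\<lambda>t. 0 = flat p t) (at_left (0::real))"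
    unfolding eventually_at_left_field by (rule exI[of _ "-1"]) (auto simp: flat_def)
  then have "(flat p \<longlongrightarrow> 0) (at_left 0)"
    using Lim_transform_eventually[OF tendsto_const] by fast
  with r show ?thesis using filterlim_split_at by blast
qed

text \<open>With s = 1/t > 0 the operator d/dt is -s^2 d/ds, which turns p(s) exp(-s) into (p - p')
  s^2 exp(-s); the factor \<open>[:0,0,1:]\<close> is this s^2.\<close>

lemma flat_deriv: "(flat p has_real_derivative flat ((p - pderiv p) * [:0,0,1:]) t) (at t)"
proof -
  consider "t > 0" | "t < 0" | "t = 0" by linarith
  then show ?thesis
  proof cases
    case 1
    have *: "((\<lambda>t. poly p (1 / t) * exp (- (1 / t))) has_real_derivative
       flat ((p - pderiv p) * [:0,0,1:]) t) (at t)"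
      using 1 by (auto intro!: derivative_eq_intros poly_DERIV[THEN DERIV_chain2] simp: flat_def)
         (simp add: field_simps power2_eq_square)
    show ?thesis
      by (rule DERIV_cong_ev[THEN iffD1, OF refl _ refl *])
        (rule eventually_nhds_in_open[of "{0<..}", THEN eventually_mono], use 1 in \<open>auto simp: flat_def\<close>)
  next
    case 2
    have "((\<lambda>t. 0) has_real_derivative flat ((p - pderiv p) * [:0,0,1:]) t) (at t)"
      using 2 by (auto simp: flat_def)
    then show ?thesis
      by (rule DERIV_cong_ev[THEN iffD1, OF refl _ refl, rotated])
        (rule eventually_nhds_in_open[of "{..<0}", THEN eventually_mono], use 2 in \<open>auto simp: flat_def\<close>)
  next
    case 3
    \<comment> \<open>Dividing by h multiplies the polynomial by its argument 1/h, so the difference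
      quotient at 0 is itself a flat function and tends to 0.\<close>
    have "flat (p * [:0,1:]) = (\<lambda>h. (flat p (0 + h) - flat p 0) / h)"
      by (rule ext) (auto simp: flat_def)
    moreover have "flat ((p - pderiv p) * [:0,0,1:]) 0 = 0" by (simp add: flat_def)
    ultimately show ?thesis
      unfolding DERIV_def 3 using flat_tendsto_0[of "p * [:0,1:]"] by simp
  qed
qed

lemma C_k_flat: "C_k k (\<lambda>x. flat p (a + b * x $ i))"
proof (induction k arbitrary: p)
  case 0
  have "continuous_on UNIV (flat p)"
    using DERIV_continuous[OF flat_deriv] by (simp add: continuous_on_eq_continuous_at)
  then show ?case by (auto intro!: continuous_intros continuous_on_compose2[of UNIV "flat p"])
next
  case (Suc k)
  have "((\<lambda>x. flat p (a + b * x $ i)) has_derivative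
      (\<lambda>t. flat ((p - pderiv p) * [:0,0,1:]) (a + b * x $ i) * (b * t $ i))) (at x)" for x
    by (rule has_derivative_compose[OF _ flat_deriv[unfolded has_field_derivative_def], THEN has_derivative_eq_rhs])
       (auto intro!: derivative_eq_intros bounded_linear.has_derivative[OF bounded_linear_vec_nth])
  then show ?case
    by (rule C_k_SucI) (intro C_k_mult Suc C_k_const)
qed

section \<open>Test functions and their uniform estimates\<close>

lemma test_functions_UNIV_iff:
  "\<phi> \<in> test_functions UNIV \<longleftrightarrow> (\<forall>k. C_k k \<phi>) \<and> bounded {x. \<phi> x \<noteq> 0}"
  by (auto simp: test_functions_def compact_closure)

lemma test_functions_imp_UNIV: "\<phi> \<in> test_functions \<Omega> \<Longrightarrow> \<phi> \<in> test_functions UNIV"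
  by (auto simp: test_functions_def)

lemma test_functionsI:
  assumes "\<And>k. C_k k \<phi>" "compact K" "K \<subseteq> \<Omega>" "\<And>x. x \<notin> K \<Longrightarrow> \<phi> x = 0"
  shows "\<phi> \<in> test_functions \<Omega>"
proof -
  have "closure {x. \<phi> x \<noteq> 0} \<subseteq> K"
    using assms(4) by (intro closure_minimal compact_imp_closed assms(2)) auto
  then show ?thesis
    unfolding test_functions_def using assms compact_imp_bounded[OF assms(2)]
    by (auto simp: compact_eq_bounded_closed intro: bounded_subset)
qed

lemma test_functions_C_k: "\<phi> \<in> test_functions \<Omega> \<Longrightarrow> C_k k \<phi>"
  by (auto simp: test_functions_def)

lemma test_functions_continuous: "\<phi> \<in> test_functions \<Omega> \<Longrightarrow> continuous_on UNIV \<phi>"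
  using test_functions_C_k C_k_imp_continuous by blast

lemma test_functions_has_derivative:
  "\<phi> \<in> test_functions \<Omega> \<Longrightarrow>
    (\<phi> has_derivative (\<lambda>t. \<Sum>j\<in>UNIV. t $ j * partial_deriv j \<phi> x)) (at x)"
  using C_k_has_derivative test_functions_C_k by blast

lemma partial_deriv_outside_support:
  assumes "x \<notin> closure {x. f x \<noteq> 0}"
  shows "partial_deriv j f x = 0"
proof -
  have "(f has_derivative (\<lambda>t. 0)) (at x)"
  proof (rule has_derivative_transform_within_open[OF has_derivative_const])
    show "0 = f y" if "y \<in> - closure {x. f x \<noteq> 0}" for y
      using that closure_subset[of "{x. f x \<noteq> 0}"] by auto
  qed (use assms in auto)
  then show ?thesis using partial_deriv_eq by fastforce
qed

lemma test_functions_partial_deriv: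
  assumes "\<phi> \<in> test_functions \<Omega>" shows "partial_deriv j \<phi> \<in> test_functions \<Omega>"
proof (rule test_functionsI)
  show "C_k k (partial_deriv j \<phi>)" for k
    using test_functions_C_k[OF assms, of "Suc k"] by simp
  show "compact (closure {x. \<phi> x \<noteq> 0})" "closure {x. \<phi> x \<noteq> 0} \<subseteq> \<Omega>"
    using assms by (auto simp: test_functions_def)
qed (rule partial_deriv_outside_support)

lemma sum_axis_mult: "(\<Sum>i\<in>UNIV. axis j 1 $ i * c i) = (c j :: real)"
  by (simp add: axis_def if_distrib[where f="\<lambda>c. c * _"] cong: if_cong)

lemma partial_deriv_mult:
  assumes "C_k (Suc k) f" "C_k (Suc k) g"
  shows "partial_deriv j (\<lambda>x. f x * g x) x = f x * partial_deriv j g x + partial_deriv j f x * g x"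
  using partial_deriv_eq[OF has_derivative_mult[OF C_k_has_derivative[OF assms(1)] C_k_has_derivative[OF assms(2)]]]
  by (simp add: sum_axis_mult)

lemma partial_deriv_sum:
  assumes "\<And>i. i \<in> I \<Longrightarrow> C_k (Suc k) (f i)"
  shows "partial_deriv j (\<lambda>x. \<Sum>i\<in>I. f i x) x = (\<Sum>i\<in>I. partial_deriv j (f i) x)"
  using partial_deriv_eq[OF has_derivative_sum[OF C_k_has_derivative[OF assms]]]
  by (simp add: sum_axis_mult)

lemma partial_deriv_even:
  assumes "C_k (Suc k) f" "\<And>x. f (- x) = f x"
  shows "partial_deriv j f (- x) = - partial_deriv j f x"
proof -
  have "((\<lambda>x. f (- x)) has_derivative (\<lambda>t. \<Sum>j\<in>UNIV. (- t) $ j * partial_deriv j f (- x))) (at x)"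
    by (rule has_derivative_compose[OF _ C_k_has_derivative[OF assms(1)]]) (auto intro!: derivative_eq_intros)
  from partial_deriv_eq[OF this, of j] show ?thesis
    unfolding assms(2) by (simp add: sum_axis_mult sum_negf)
qed

lemma test_functions_bounded:
  assumes "\<phi> \<in> test_functions \<Omega>" shows "\<exists>B>0. \<forall>x. \<bar>\<phi> x\<bar> \<le> B"
proof -
  let ?K = "closure {x. \<phi> x \<noteq> 0}"
  have "compact (\<phi> ` ?K)"
    using assms continuous_on_subset[OF test_functions_continuous[OF assms]]
    by (intro compact_continuous_image) (auto simp: test_functions_def)
  then obtain B where B: "0 < B" "\<And>x. x \<in> ?K \<Longrightarrow> \<bar>\<phi> x\<bar> \<le> B"
    using compact_imp_bounded bounded_pos by (metis imageI real_norm_def)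
  have "\<bar>\<phi> x\<bar> \<le> B" for x
    using B closure_subset[of "{x. \<phi> x \<noteq> 0}"] by (cases "\<phi> x = 0") (auto intro: less_imp_le)
  with B(1) show ?thesis by blast
qed

lemma test_functions_support_cball:
  assumes "\<phi> \<in> test_functions \<Omega>" shows "\<exists>R>0. \<forall>x. R < norm x \<longrightarrow> \<phi> x = 0"
proof -
  have "bounded {x. \<phi> x \<noteq> 0}"
    using test_functions_imp_UNIV[OF assms] by (auto simp: test_functions_UNIV_iff)
  then obtain R where "R > 0" "\<And>x. \<phi> x \<noteq> 0 \<Longrightarrow> norm x \<le> R"
    unfolding bounded_pos by blast
  then show ?thesis by (meson not_le)
qed

text \<open>At distance less than 1, either both points lie in the ball of radius R + 1, where
  Heine-Cantor applies, or f vanishes at both.\<close>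

lemma compact_support_uniformly_continuous:
  fixes f :: "real^'n::finite \<Rightarrow> real"
  assumes c: "continuous_on UNIV f" and z: "\<And>x. R < norm x \<Longrightarrow> f x = 0" and "0 < e"
  shows "\<exists>d>0. \<forall>x y. dist x y < d \<longrightarrow> \<bar>f x - f y\<bar> < e"
proof -
  have "uniformly_continuous_on (cball 0 (R+1)) f"
    by (intro compact_uniformly_continuous continuous_on_subset[OF c]) auto
  then obtain d where d: "d > 0"
    "\<And>x y. \<lbrakk>x \<in> cball 0 (R+1); y \<in> cball 0 (R+1); dist x y < d\<rbrakk> \<Longrightarrow> dist (f x) (f y) < e"
    using \<open>0 < e\<close> unfolding uniformly_continuous_on_def by metis
  have "\<bar>f x - f y\<bar> < e" if "dist x y < min d 1" for x y
  proof (cases "norm x \<le> R \<or> norm y \<le> R")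
    case True
    have "norm x \<le> norm y + dist x y" "norm y \<le> norm x + dist x y"
      unfolding dist_norm by norm+
    then show ?thesis using True that d(2)[of x y] by (auto simp: dist_real_def)
  qed (use z \<open>0 < e\<close> in auto)
  then show ?thesis using d(1) by (intro exI[of _ "min d 1"]) auto
qed

text \<open>The partial derivatives are uniformly continuous, so the mean value inequality gives a
  remainder that is small relative to |y - x| uniformly in x. This uniformity is what lets
  difference quotients pass under integrals below.\<close>

lemma test_functions_uniformly_differentiable:
  fixes \<phi> :: "real^'n::finite \<Rightarrow> real"
  assumes \<phi>: "\<phi> \<in> test_functions \<Omega>" and "0 < e"
  shows "\<exists>d>0. \<forall>x y. norm (y - x) < d \<longrightarrow>
       \<bar>\<phi> y - \<phi> x - (\<Sum>j\<in>UNIV. (y - x) $ j * partial_deriv j \<phi> x)\<bar> \<le> e * norm (y - x)"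
proof -
  \<comment> \<open>Each of the \<open>CARD('n)\<close> components contributes at most e' to the
    operator norm.\<close>
  define e' where "e' = e / CARD('n)"
  have e': "e' > 0" using \<open>0 < e\<close> by (simp add: e'_def)
  have "\<exists>d>0. \<forall>x y. dist x y < d \<longrightarrow> \<bar>partial_deriv j \<phi> x - partial_deriv j \<phi> y\<bar> < e'" for j
  proof -
    have t: "partial_deriv j \<phi> \<in> test_functions \<Omega>" by (rule test_functions_partial_deriv[OF \<phi>])
    obtain R where R: "0 < R" "\<And>x. R < norm x \<Longrightarrow> partial_deriv j \<phi> x = 0"
      using test_functions_support_cball[OF t] by blast
    show ?thesis
      by (rule compact_support_uniformly_continuous[OF test_functions_continuous[OF t] R(2) e'])
  qed
  then obtain D where D: "\<And>j. D j > 0"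
    "\<And>j x y. dist x y < D j \<Longrightarrow> \<bar>partial_deriv j \<phi> x - partial_deriv j \<phi> y\<bar> < e'"
    by metis
  define d where "d = Min (range D)"
  have d: "d > 0" "\<And>j. d \<le> D j" using D(1) by (auto simp: d_def)
  show ?thesis
  proof (intro exI[of _ d] conjI allI impI d(1))
    fix x y :: "real^'n" assume xy: "norm (y - x) < d"
    have "norm (\<phi> y - \<phi> x - (\<Sum>j\<in>UNIV. (y - x) $ j * partial_deriv j \<phi> x)) \<le> norm (y - x) * e"
    proof (rule differentiable_bound_linearization[where S="ball x d" and ?x0.0=x and f="\<phi>"
          and f'="\<lambda>z t. \<Sum>j\<in>UNIV. t $ j * partial_deriv j \<phi> z" and a=x and b=y])
      fix t :: real assume "t \<in> {0..1}"
      then have "norm (t *\<^sub>R (y - x)) \<le> norm (y - x)" by (auto simp: mult_left_le_one_le)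
      then show "x + t *\<^sub>R (y - x) \<in> ball x d" using xy by (auto simp: dist_norm)
    next
      fix z assume "z \<in> ball x d"
      show "(\<phi> has_derivative (\<lambda>t. \<Sum>j\<in>UNIV. t $ j * partial_deriv j \<phi> z)) (at z within ball x d)"
        using test_functions_has_derivative[OF \<phi>] has_derivative_at_withinI by blast
      have dz: "\<bar>partial_deriv j \<phi> z - partial_deriv j \<phi> x\<bar> \<le> e'" for j
        using D(2)[of z x j] d(2)[of j] \<open>z \<in> ball x d\<close> by (auto simp: dist_commute less_imp_le)
      show "onorm ((\<lambda>v. \<Sum>j\<in>UNIV. v $ j * partial_deriv j \<phi> z) - (\<lambda>v. \<Sum>j\<in>UNIV. v $ j * partial_deriv j \<phi> x)) \<le> e"
        unfolding fun_diff_def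
      proof (rule onorm_bound)
        fix v :: "real^'n"
        have "norm ((\<Sum>j\<in>UNIV. v $ j * partial_deriv j \<phi> z) - (\<Sum>j\<in>UNIV. v $ j * partial_deriv j \<phi> x))
          = \<bar>\<Sum>j\<in>UNIV. v $ j * (partial_deriv j \<phi> z - partial_deriv j \<phi> x)\<bar>"
          by (simp add: sum_subtractf right_diff_distrib)
        also have "\<dots> \<le> (\<Sum>j\<in>(UNIV :: 'n set). norm v * e')"
          by (intro order_trans[OF sum_abs] sum_mono)
             (unfold abs_mult, rule mult_mono[OF component_le_norm_cart dz], auto)
        also have "\<dots> = e * norm v" by (simp add: e'_def)
        finally show "norm ((\<Sum>j\<in>UNIV. v $ j * partial_deriv j \<phi> z) - (\<Sum>j\<in>UNIV. v $ j * partial_deriv j \<phi> x)) \<le> e * norm v" .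
      qed (use \<open>0 < e\<close> in auto)
    qed (use d in auto)
    then show "\<bar>\<phi> y - \<phi> x - (\<Sum>j\<in>UNIV. (y - x) $ j * partial_deriv j \<phi> x)\<bar> \<le> e * norm (y - x)"
      by (simp add: mult.commute)
  qed
qed

lemma test_functions_lipschitz:
  fixes \<phi> :: "real^'n::finite \<Rightarrow> real"
  assumes \<phi>: "\<phi> \<in> test_functions \<Omega>"
  obtains C where "C-lipschitz_on UNIV \<phi>"
proof -
  have "\<exists>B\<ge>0. \<forall>x. \<bar>partial_deriv j \<phi> x\<bar> \<le> B" for j
    using test_functions_bounded[OF test_functions_partial_deriv[OF \<phi>], of j] less_imp_le by blast
  then obtain B where B: "\<And>j. B j \<ge> 0" "\<And>j x. \<bar>partial_deriv j \<phi> x\<bar> \<le> B j" by metis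
  have "norm (\<phi> y - \<phi> x) \<le> (\<Sum>j\<in>UNIV. B j) * norm (y - x)" for x y
  proof (rule differentiable_bound[where S=UNIV and f'="\<lambda>z t. \<Sum>j\<in>UNIV. t $ j * partial_deriv j \<phi> z"])
    show "onorm (\<lambda>t. \<Sum>j\<in>UNIV. t $ j * partial_deriv j \<phi> z) \<le> (\<Sum>j\<in>UNIV. B j)" for z
    proof (rule onorm_bound)
      fix v :: "real^'n"
      show "norm (\<Sum>j\<in>UNIV. v $ j * partial_deriv j \<phi> z) \<le> (\<Sum>j\<in>UNIV. B j) * norm v"
      proof -
        have "\<bar>v $ j * partial_deriv j \<phi> z\<bar> \<le> B j * norm v" for j
          using mult_mono[OF component_le_norm_cart[of v j] B(2)[of j z]]
          by (simp add: abs_mult mult.commute)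
        then show ?thesis
          unfolding sum_distrib_right real_norm_def
          by (intro order_trans[OF sum_abs] sum_mono)
      qed
    qed (use B in \<open>auto intro: sum_nonneg\<close>)
  qed (use test_functions_has_derivative[OF \<phi>] in auto)
  then have "(\<Sum>j\<in>UNIV. B j)-lipschitz_on UNIV \<phi>"
    using B by (auto intro!: lipschitz_onI sum_nonneg simp: dist_norm)
  then show ?thesis using that by blast
qed

section \<open>Integrals of test functions and integration by parts\<close>

lemma continuous_imp_lebesgue_measurable:
  fixes f :: "'a::euclidean_space \<Rightarrow> real"
  shows "continuous_on UNIV f \<Longrightarrow> f \<in> borel_measurable lebesgue"
  by (intro measurable_completion) (simp add: borel_measurable_continuous_onI)

lemma integrable_bounded_support:
  fixes f :: "'a::euclidean_space \<Rightarrow> real"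
  assumes "f \<in> borel_measurable lebesgue" "\<And>x. \<bar>f x\<bar> \<le> B" "\<And>x. R < norm x \<Longrightarrow> f x = 0"
  shows "integrable lebesgue f"
proof (rule Bochner_Integration.integrable_bound)
  show "integrable lebesgue (\<lambda>x. B * indicat_real (cball (0::'a) R) x)"
    using emeasure_lborel_cball_finite[of "0::'a" R] by (auto intro!: integrable_real_indicator)
  have "B \<ge> 0" using assms(2) abs_ge_zero order_trans by blast
  then show "AE x in lebesgue. norm (f x) \<le> norm (B * indicat_real (cball (0::'a) R) x)"
    using assms(2,3) by (intro AE_I2) (auto simp: indicator_def dest: leI)
qed (rule assms)

lemma integrable_test_function:
  assumes "\<phi> \<in> test_functions \<Omega>" shows "integrable lebesgue \<phi>"
proof -
  obtain B R where "\<And>x. \<bar>\<phi> x\<bar> \<le> B" "\<And>x. R < norm x \<Longrightarrow> \<phi> x = 0"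
    using test_functions_bounded[OF assms] test_functions_support_cball[OF assms] by blast
  then show ?thesis
    by (intro integrable_bounded_support continuous_imp_lebesgue_measurable test_functions_continuous[OF assms])
qed

text \<open>c = 1 gives translations and c = -1 the reflections y -> t - y met in convolutions.
  Continuity makes f Borel, so that the change of variables can be done in
  \<open>lborel\<close>.\<close>

lemma lebesgue_integral_affine:
  fixes f :: "real^'n::finite \<Rightarrow> real"
  assumes "continuous_on UNIV f" "\<bar>c\<bar> = 1"
  shows "(LINT x|lebesgue. f (t + c *\<^sub>R x)) = (LINT x|lebesgue. f x)"
proof -
  have m: "f \<in> borel_measurable borel" using assms(1) borel_measurable_continuous_onI by blast
  have m2: "(\<lambda>x. t + c *\<^sub>R x) \<in> borel_measurable borel" by measurable
  have "(LINT x|lebesgue. f x) = (\<integral>x. f x \<partial>lborel)" using m by (simp add: integral_completion)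
  also have "\<dots> = (\<integral>x. f x \<partial>distr lborel borel (\<lambda>x. t + c *\<^sub>R x))"
    using lborel_affine[of c t] assms(2)
    by (intro arg_cong[where f="\<lambda>M. integral\<^sup>L M f"]) (auto simp: density_1)
  also have "\<dots> = (\<integral>x. f (t + c *\<^sub>R x) \<partial>lborel)"
    using m m2 by (subst integral_distr) auto
  also have "\<dots> = (LINT x|lebesgue. f (t + c *\<^sub>R x))"
    using measurable_compose[OF m2 m] by (simp add: integral_completion)
  finally show ?thesis by simp
qed

text \<open>By translation invariance the increment of \<phi> along t e_j has integral 0. Divided by
  t it is uniformly close to the partial derivative, on a fixed ball of measure V that contains all
  supports involved; the error e is then sent to 0.\<close>

lemma integral_partial_deriv_eq_0:
  fixes \<phi> :: "real^'n::finite \<Rightarrow> real"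
  assumes \<phi>: "\<phi> \<in> test_functions \<Omega>"
  shows "(LINT x|lebesgue. partial_deriv j \<phi> x) = 0"
proof -
  obtain R where R: "0 < R" "\<And>x. R < norm x \<Longrightarrow> \<phi> x = 0" "\<And>x. R < norm x \<Longrightarrow> partial_deriv j \<phi> x = 0"
  proof -
    obtain R1 where R1: "0 < R1" "\<And>x. R1 < norm x \<Longrightarrow> \<phi> x = 0" using test_functions_support_cball[OF \<phi>] by blast
    obtain R2 where R2: "0 < R2" "\<And>x. R2 < norm x \<Longrightarrow> partial_deriv j \<phi> x = 0"
      using test_functions_support_cball[OF test_functions_partial_deriv[OF \<phi>]] by blast
    show ?thesis using R1 R2 by (intro that[of "max R1 R2"]) auto
  qed
  define V where "V = measure lebesgue (cball (0::real^'n) (R+1))"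
  have int: "integrable lebesgue \<phi>" "integrable lebesgue (partial_deriv j \<phi>)"
    using integrable_test_function[OF \<phi>]
      integrable_test_function[OF test_functions_partial_deriv[OF \<phi>]] by auto
  have V: "integrable lebesgue (indicat_real (cball (0::real^'n) (R+1)))"
    using emeasure_lborel_cball_finite[of "0::real^'n" "R+1"] by (auto intro!: integrable_real_indicator)
  have "\<bar>LINT x|lebesgue. partial_deriv j \<phi> x\<bar> \<le> e * V" if "e > 0" for e
  proof -
    obtain d where d: "0 < d"
      "\<And>x y. norm (y - x) < d \<Longrightarrow>
       \<bar>\<phi> y - \<phi> x - (\<Sum>j\<in>UNIV. (y - x) $ j * partial_deriv j \<phi> x)\<bar> \<le> e * norm (y - x)"
      using test_functions_uniformly_differentiable[OF \<phi> \<open>e > 0\<close>] by blast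
    \<comment> \<open>t < d makes the linearization apply; t \<le> 1 keeps the shifted support in
      the ball of radius R + 1.\<close>
    define t where "t = min (d/2) 1"
    have t: "0 < t" "t < d" "t \<le> 1" using d(1) by (auto simp: t_def)
    define v where "v = t *\<^sub>R (axis j 1 :: real^'n)"
    have nv: "norm v = t" using t by (simp add: v_def)
    have sv: "(\<Sum>i\<in>UNIV. v $ i * c i) = t * c j" for c
      using sum_axis_mult[of j c] by (simp add: v_def mult.assoc flip: sum_distrib_left)
    have int2: "integrable lebesgue (\<lambda>x. \<phi> (v + x))"
    proof -
      have tf: "(\<lambda>x. \<phi> (x - (-v))) \<in> test_functions UNIV"
      proof (rule test_functionsI)
        fix x :: "real^'n" assume "x \<notin> cball 0 (R + norm v)"
        moreover have "norm x \<le> norm (x - - v) + norm v" by norm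
        ultimately show "\<phi> (x - - v) = 0" using R(2) by auto
      qed (rule C_k_translate test_functions_C_k[OF \<phi>] compact_cball subset_UNIV)+
      show ?thesis using integrable_test_function[OF tf] by (simp add: add.commute)
    qed
    have b: "\<bar>\<phi> (v + x) - \<phi> x - t * partial_deriv j \<phi> x\<bar> \<le> e * t * indicat_real (cball 0 (R+1)) x" for x
    proof (cases "norm x \<le> R + 1")
      case True
      then show ?thesis using d(2)[of "v + x" x] nv t sv[of "\<lambda>j. partial_deriv j \<phi> x"] by (simp add: indicator_def)
    next
      case False
      moreover have "norm x \<le> norm (v + x) + norm v" by norm
      ultimately show ?thesis using R(2)[of x] R(2)[of "v + x"] R(3)[of x] nv t by (simp add: indicator_def)
    qed
    have "t * \<bar>LINT x|lebesgue. partial_deriv j \<phi> x\<bar> = \<bar>LINT x|lebesgue. t * partial_deriv j \<phi> x\<bar>"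
      using t by (simp add: abs_mult)
    also have "\<dots> = \<bar>LINT x|lebesgue. \<phi> (v + x) - \<phi> x - t * partial_deriv j \<phi> x\<bar>"
      using lebesgue_integral_affine[OF test_functions_continuous[OF \<phi>], of 1 v] int int2 by simp
    also have "\<dots> \<le> (LINT x|lebesgue. e * t * indicat_real (cball (0::real^'n) (R+1)) x)"
      unfolding real_norm_def[symmetric] using int int2 V b
      by (intro Bochner_Integration.integral_norm_bound_integral) auto
    also have "\<dots> = t * (e * V)" by (simp add: V_def)
    finally show ?thesis using t by simp
  qed
  then have "\<bar>LINT x|lebesgue. partial_deriv j \<phi> x\<bar> \<le> 0"
  proof -
    assume a: "\<And>e. e > 0 \<Longrightarrow> \<bar>LINT x|lebesgue. partial_deriv j \<phi> x\<bar> \<le> e * V"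
    have "\<bar>LINT x|lebesgue. partial_deriv j \<phi> x\<bar> \<le> 0 + e" if "e > 0" for e
    proof -
      have "V \<ge> 0" by (simp add: V_def)
      then have "e / (V + 1) * V \<le> e" using that by (simp add: field_simps)
      with a[of "e / (V + 1)"] that \<open>V \<ge> 0\<close> show ?thesis by simp
    qed
    then show ?thesis using field_le_epsilon by blast
  qed
  then show ?thesis by simp
qed

lemma integral_by_parts_test_function:
  fixes f :: "real^'n::finite \<Rightarrow> real"
  assumes f: "\<And>k. C_k k f" and \<phi>: "\<phi> \<in> test_functions UNIV"
  shows "(LINT x|lebesgue. f x * partial_deriv j \<phi> x) = - (LINT x|lebesgue. partial_deriv j f x * \<phi> x)"
proof -
  have tf: "(\<lambda>x. g x * \<psi> x) \<in> test_functions UNIV" if "\<psi> \<in> test_functions UNIV" "\<And>k. C_k k g" for g \<psi> :: "real^'n \<Rightarrow> real"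
    using that unfolding test_functions_UNIV_iff by (auto intro: C_k_mult bounded_subset)
  have i: "integrable lebesgue (\<lambda>x. f x * partial_deriv j \<phi> x)" "integrable lebesgue (\<lambda>x. partial_deriv j f x * \<phi> x)"
    using f[of "Suc _"] by (intro integrable_test_function[OF tf] \<phi> test_functions_partial_deriv f; simp)+
  have "(LINT x|lebesgue. f x * partial_deriv j \<phi> x + partial_deriv j f x * \<phi> x) = 0"
    using integral_partial_deriv_eq_0[OF tf[OF \<phi> f], of j]
    by (simp add: partial_deriv_mult[OF f test_functions_C_k[OF \<phi>]])
  then show ?thesis using i by simp
qed

section \<open>Mollifiers and convolution\<close>

text \<open>Kernels of different scales need not be dilates of one function: the common bound
  \<open>A / s ^ CARD('n)\<close> is what relates them. Evenness serves to pass weak derivatives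
  through the convolution.\<close>

definition mollifier :: "real \<Rightarrow> real \<Rightarrow> (real^'n::finite \<Rightarrow> real) \<Rightarrow> bool" where
  "mollifier A s \<phi> \<longleftrightarrow> \<phi> \<in> test_functions UNIV \<and> (\<forall>x. 0 \<le> \<phi> x \<and> \<phi> x \<le> A / s ^ CARD('n))
     \<and> (\<forall>x. s \<le> norm x \<longrightarrow> \<phi> x = 0) \<and> (\<forall>x. \<phi> (- x) = \<phi> x) \<and> (LINT x|lebesgue. \<phi> x) = 1"

lemma measure_cube: "0 \<le> l \<Longrightarrow> measure lebesgue (cbox a (a + vec l :: real^'n::finite)) = l ^ CARD('n)"
  using content_cbox_cart[of a "a + vec l"] by (simp add: interval_ne_empty_cart)

lemma emeasure_cube: "0 \<le> l \<Longrightarrow> emeasure lebesgue (cbox a (a + vec l :: real^'n::finite)) = ennreal (l ^ CARD('n))"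
  using measure_cube[of l a] emeasure_lborel_cbox_finite[of a "a + vec l"]
  by (simp add: emeasure_eq_ennreal_measure)

lemma integrable_indicator_compact:
  fixes K :: "'a::euclidean_space set"
  assumes "compact K" shows "integrable lebesgue (indicat_real K)"
  using lmeasurable_compact[OF assms]
  by (intro integrable_real_indicator) (auto simp: fmeasurable_def)

lemma flat_1_bounds: "0 \<le> flat 1 t" "flat 1 t \<le> 1"
  by (auto simp: flat_def)

lemma flat_1_ge: "1/2 \<le> t \<Longrightarrow> exp (-2) \<le> flat 1 t"
  by (auto simp: flat_def field_simps)

text \<open>The kernel is a normalized product of one-dimensional bumps. Its integral is bounded
  below by its values on a smaller cube; this bounds the normalizing factor and yields an A that
  depends on the dimension only.\<close>

lemma mollifier_exists:
  obtains A where "0 < A" "\<And>s. 0 < s \<Longrightarrow> \<exists>\<phi> :: real^'n::finite \<Rightarrow> real. mollifier A s \<phi>"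
proof
  define n where "n = CARD('n)"
  have n: "n > 0" by (simp add: n_def)
  define m where "m = exp (-2::real) ^ (2 * n)"
  have m: "m > 0" by (simp add: m_def)
  define A where "A = real n ^ n / m"
  show "A > 0" using n m by (simp add: A_def)
  fix s :: real assume s: "0 < s"
  \<comment> \<open>With this slope the product vanishes unless |x_i| < s / n for every i, and the
    l1 bound on the norm then puts the support into the ball of radius s.\<close>
  define b where "b = real n / s"
  have b: "b > 0" using n s by (simp add: b_def)
  define \<beta> :: "real^'n \<Rightarrow> real" where
    "\<beta> x = (\<Prod>i\<in>UNIV. flat 1 (1 + b * x $ i) * flat 1 (1 + (- b) * x $ i))" for x
  have Ck: "C_k k \<beta>" for k
    unfolding \<beta>_def[abs_def] by (intro C_k_prod C_k_mult C_k_flat)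
  have bd: "0 \<le> \<beta> x" "\<beta> x \<le> 1" for x
    unfolding \<beta>_def
    by (auto intro!: prod_nonneg prod_le_1 mult_nonneg_nonneg mult_le_one flat_1_bounds)
  have z: "\<beta> x = 0" if "s \<le> norm x" for x
  proof -
    have "\<exists>i. \<bar>x $ i\<bar> \<ge> s / n"
    proof (rule ccontr)
      assume "\<not> ?thesis"
      then have "(\<Sum>i\<in>(UNIV::'n set). \<bar>x $ i\<bar>) < (\<Sum>i\<in>(UNIV::'n set). s / n)"
        by (intro sum_strict_mono) (auto simp: not_le)
      also have "\<dots> = s" using n by (simp add: n_def)
      finally show False using norm_le_l1_cart[of x] that by simp
    qed
    then obtain i where i: "\<bar>x $ i\<bar> \<ge> s / n" by blast
    have "b * \<bar>x $ i\<bar> \<ge> 1" using mult_left_mono[OF i, of b] b s n by (simp add: b_def)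
    then have "1 + b * x $ i \<le> 0 \<or> 1 + (- b) * x $ i \<le> 0" by (cases "x $ i \<ge> 0") auto
    then have "flat 1 (1 + b * x $ i) * flat 1 (1 + (- b) * x $ i) = 0" by (auto simp: flat_def)
    then show ?thesis unfolding \<beta>_def by (intro prod_zero) auto
  qed
  have tf: "\<beta> \<in> test_functions UNIV"
    using Ck z by (intro test_functionsI[of _ "cball 0 s"]) auto
  \<comment> \<open>The concentric cube with half the side of the support: here |b x_i| \<le> 1/2,
    so each of the 2n factors is at least exp(-2) and their product at least m.\<close>
  define Q where "Q = cbox (vec (- s / (2*n))) (vec (- s / (2*n)) + vec (s / n) :: real^'n)"
  have lb: "m * indicat_real Q x \<le> \<beta> x" for x
  proof (cases "x \<in> Q")
    case True
    have "exp (-2) * exp (-2) \<le> flat 1 (1 + b * x $ i) * flat 1 (1 + (- b) * x $ i)" for i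
    proof -
      have "- (s / (2*n)) \<le> x $ i" "x $ i \<le> s / (2 * n)"
        using True n by (auto simp: Q_def mem_box_cart field_simps)
      then have "b * (- (s / (2*n))) \<le> b * x $ i" "b * x $ i \<le> b * (s / (2*n))"
        using b by (simp_all only: mult_le_cancel_left_pos)
      moreover have "b * (s / (2*n)) = 1/2" using n s by (simp add: b_def)
      ultimately have "- (1/2) \<le> b * x $ i" "b * x $ i \<le> 1/2" by (simp_all only: mult_minus_right)
      then have "1/2 \<le> 1 + b * x $ i" "1/2 \<le> 1 + (- b) * x $ i" by simp_all
      then show ?thesis by (intro mult_mono flat_1_ge flat_1_bounds) auto
    qed
    then have "(\<Prod>i\<in>(UNIV::'n set). exp (-2) * exp (-2)) \<le> \<beta> x"
      unfolding \<beta>_def by (intro prod_mono) auto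
    then show ?thesis using True by (simp add: m_def n_def power_mult power2_eq_square)
  qed (use bd in auto)
  define c where "c = (LINT x|lebesgue. \<beta> x)"
  have mQ: "measure lebesgue Q = (s / n) ^ n"
    unfolding Q_def using measure_cube[of "s / n"] s by (simp add: n_def)
  have iQ: "integrable lebesgue (indicat_real Q)"
    unfolding Q_def by (intro integrable_indicator_compact compact_cbox)
  have "m * (s / n) ^ n = (LINT x|lebesgue. m * indicat_real Q x)"
    using mQ by (simp add: Q_def)
  also have "\<dots> \<le> c"
    unfolding c_def by (intro Bochner_Integration.integral_mono integrable_mult_right iQ integrable_test_function[OF tf] lb)
  finally have cA: "m * (s / n) ^ n \<le> c" .
  have "0 < m * (s / n) ^ n" using m s n by simp
  with cA have c: "0 < c" by linarith
  define \<phi> where "\<phi> x = (1 / c) * \<beta> x" for x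
  have "1 / c \<le> 1 / (m * (s / n) ^ n)" using cA c \<open>0 < m * (s / n) ^ n\<close> by (simp add: frac_le)
  also have "\<dots> = A / s ^ n" using n s m by (simp add: A_def power_divide field_simps)
  finally have cb: "1 / c \<le> A / s ^ n" .
  have "\<phi> x \<le> A / s ^ n" for x
    using mult_mono[OF cb bd(2)[of x]] bd[of x] c \<open>A > 0\<close> s by (simp add: \<phi>_def)
  moreover have "\<phi> (- x) = \<phi> x" for x by (simp add: \<phi>_def \<beta>_def mult.commute)
  moreover have "(LINT x|lebesgue. \<phi> x) = 1"
    unfolding \<phi>_def using c by (simp flip: c_def)
  moreover have "\<phi> \<in> test_functions UNIV"
  proof (rule test_functionsI[OF _ compact_cball[of 0 s] subset_UNIV])
    show "C_k k \<phi>" for k unfolding \<phi>_def[abs_def] by (intro C_k_mult C_k_const Ck)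
  qed (use z in \<open>auto simp: \<phi>_def\<close>)
  ultimately have "mollifier A s \<phi>"
    using bd c z by (auto simp: mollifier_def \<phi>_def n_def)
  then show "\<exists>\<phi> :: real^'n \<Rightarrow> real. mollifier A s \<phi>" by blast
qed

definition convolution :: "(real^'n::finite \<Rightarrow> real) \<Rightarrow> (real^'n \<Rightarrow> real) \<Rightarrow> real^'n \<Rightarrow> real" where
  "convolution \<phi> h x = (LINT y|lebesgue. \<phi> (x - y) * h y)"

lemma measurable_reflect_translate:
  fixes \<phi> :: "real^'n::finite \<Rightarrow> real"
  assumes "\<phi> \<in> test_functions \<Omega>" shows "(\<lambda>y. \<phi> (x - y)) \<in> borel_measurable lebesgue"
  by (intro continuous_imp_lebesgue_measurable continuous_on_compose2[OF test_functions_continuous[OF assms]])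
     (auto intro!: continuous_intros)

lemma integrable_convolution:
  fixes h :: "real^'n::finite \<Rightarrow> real"
  assumes \<phi>: "\<phi> \<in> test_functions \<Omega>" and h: "integrable lebesgue h"
  shows "integrable lebesgue (\<lambda>y. \<phi> (x - y) * h y)"
proof -
  obtain B where B: "0 < B" "\<And>x. \<bar>\<phi> x\<bar> \<le> B" using test_functions_bounded[OF \<phi>] by blast
  show ?thesis
  proof (rule Bochner_Integration.integrable_bound[OF integrable_mult_right[OF h, of B]])
    show "(\<lambda>y. \<phi> (x - y) * h y) \<in> borel_measurable lebesgue"
      using measurable_reflect_translate[OF \<phi>] h by measurable
    show "AE y in lebesgue. norm (\<phi> (x - y) * h y) \<le> norm (B * h y)"
      using B by (auto simp: abs_mult intro!: mult_right_mono)
  qed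
qed

text \<open>The derivative falls on the smooth factor. Its remainder is small uniformly in the
  argument, so integrating it against h costs only the L1 norm I of h; I + 1 appears in the
  denominator because I may be 0.\<close>

lemma convolution_has_derivative:
  fixes h :: "real^'n::finite \<Rightarrow> real"
  assumes \<phi>: "\<phi> \<in> test_functions UNIV" and h: "integrable lebesgue h"
  shows "(convolution \<phi> h has_derivative (\<lambda>t. \<Sum>j\<in>UNIV. t $ j * convolution (partial_deriv j \<phi>) h x)) (at x)"
  unfolding has_derivative_at_alt
proof (intro conjI allI impI)
  show "bounded_linear (\<lambda>t. \<Sum>j\<in>UNIV. t $ j * convolution (partial_deriv j \<phi>) h x)"
    by (intro bounded_linear_sum bounded_linear_compose[OF bounded_linear_mult_left] bounded_linear_vec_nth)
  fix e :: real assume e: "0 < e"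
  define I where "I = (LINT y|lebesgue. \<bar>h y\<bar>)"
  have I: "I \<ge> 0" by (simp add: I_def)
  have "e / (I + 1) > 0" using e I by simp
  then obtain d where d: "0 < d"
    "\<And>x y. norm (y - x) < d \<Longrightarrow>
       \<bar>\<phi> y - \<phi> x - (\<Sum>j\<in>UNIV. (y - x) $ j * partial_deriv j \<phi> x)\<bar> \<le> e / (I + 1) * norm (y - x)"
    using test_functions_uniformly_differentiable[OF \<phi>] by blast
  have "norm (convolution \<phi> h y - convolution \<phi> h x - (\<Sum>j\<in>UNIV. (y - x) $ j * convolution (partial_deriv j \<phi>) h x))
      \<le> e * norm (y - x)" if y: "norm (y - x) < d" for y
  proof -
    note int = integrable_convolution[OF \<phi> h] integrable_convolution[OF test_functions_partial_deriv[OF \<phi>] h]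
    let ?D = "\<lambda>z. \<phi> (y - z) * h z - \<phi> (x - z) * h z - (\<Sum>j\<in>UNIV. (y - x) $ j * (partial_deriv j \<phi> (x - z) * h z))"
    have "convolution \<phi> h y - convolution \<phi> h x - (\<Sum>j\<in>UNIV. (y - x) $ j * convolution (partial_deriv j \<phi>) h x)
      = (LINT z|lebesgue. ?D z)"
      unfolding convolution_def using int
      by (subst Bochner_Integration.integral_diff) (auto simp: Bochner_Integration.integral_sum)
    also have "norm \<dots> \<le> (LINT z|lebesgue. (e / (I + 1) * norm (y - x)) * \<bar>h z\<bar>)"
    proof (rule Bochner_Integration.integral_norm_bound_integral)
      show "integrable lebesgue (\<lambda>z. ?D z)"
        using int by (intro Bochner_Integration.integrable_diff Bochner_Integration.integrable_sum integrable_mult_right) auto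
      show "integrable lebesgue (\<lambda>z. (e / (I + 1) * norm (y - x)) * \<bar>h z\<bar>)" using h by simp
      fix z
      have "norm (?D z)
        = \<bar>\<phi> (y - z) - \<phi> (x - z) - (\<Sum>j\<in>UNIV. ((y - z) - (x - z)) $ j * partial_deriv j \<phi> (x - z))\<bar> * \<bar>h z\<bar>"
        unfolding abs_mult[symmetric] real_norm_def by (simp add: algebra_simps sum_distrib_left sum_distrib_right)
      also have "\<dots> \<le> (e / (I + 1) * norm (y - x)) * \<bar>h z\<bar>"
        using d(2)[of "y - z" "x - z"] y by (intro mult_right_mono) auto
      finally show "norm (?D z)
        \<le> (e / (I + 1) * norm (y - x)) * \<bar>h z\<bar>" .
    qed
    also have "\<dots> = (e * norm (y - x)) * (I / (I + 1))" by (simp add: I_def)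
    also have "\<dots> \<le> e * norm (y - x)" using e I by (intro mult_left_le) auto
    finally show ?thesis .
  qed
  then show "\<exists>d>0. \<forall>y. norm (y - x) < d \<longrightarrow> norm (convolution \<phi> h y - convolution \<phi> h x -
      (\<Sum>j\<in>UNIV. (y - x) $ j * convolution (partial_deriv j \<phi>) h x)) \<le> e * norm (y - x)"
    using d(1) by blast
qed

lemma partial_deriv_convolution:
  assumes "\<phi> \<in> test_functions UNIV" "integrable lebesgue h"
  shows "partial_deriv j (convolution \<phi> h) x = convolution (partial_deriv j \<phi>) h x"
  using partial_deriv_eq[OF convolution_has_derivative[OF assms]] by (simp add: sum_axis_mult)

lemma C_k_convolution:
  assumes "\<phi> \<in> test_functions UNIV" and h: "integrable lebesgue h"
  shows "C_k k (convolution \<phi> h)"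
  using assms(1)
proof (induction k arbitrary: \<phi>)
  case 0
  then show ?case
    using has_derivative_continuous[OF convolution_has_derivative[OF _ h]]
    by (auto simp: continuous_on_eq_continuous_at)
next
  case (Suc k)
  have *: "(\<Sum>i\<in>UNIV. axis j 1 $ i * convolution (partial_deriv i \<phi>) h x) = convolution (partial_deriv j \<phi>) h x" for j x
    by (rule sum_axis_mult)
  show ?case
    by (rule C_k_SucI[OF convolution_has_derivative[OF Suc.prems h]])
       (simp only: *, rule Suc.IH[OF test_functions_partial_deriv[OF Suc.prems]])
qed

lemma convolution_eq_0:
  assumes "\<And>x. s \<le> norm x \<Longrightarrow> \<phi> x = 0" "\<And>y. dist x y < s \<Longrightarrow> h y = 0"
  shows "convolution \<phi> h x = 0"
proof -
  have "\<phi> (x - y) * h y = 0" for y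
    using assms(1)[of "x - y"] assms(2)[of y] by (cases "dist x y < s") (auto simp: dist_norm)
  then have "(\<lambda>y. \<phi> (x - y) * h y) = (\<lambda>y. 0)" by (rule ext)
  then show ?thesis by (simp add: convolution_def)
qed

lemma integral_mollifier_translate:
  fixes \<phi> :: "real^'n::finite \<Rightarrow> real"
  assumes "mollifier A s \<phi>"
  shows "(LINT y|lebesgue. \<phi> (x - y)) = 1" "integrable lebesgue (\<lambda>y. \<phi> (x - y))"
proof -
  have tf: "\<phi> \<in> test_functions UNIV" using assms by (simp add: mollifier_def)
  show *: "(LINT y|lebesgue. \<phi> (x - y)) = 1"
    using assms lebesgue_integral_affine[OF test_functions_continuous[OF tf], of "-1" x]
    by (simp add: mollifier_def)
  \<comment> \<open>A non-integrable function has integral 0 by convention, so the value 1 forces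
    integrability.\<close>
  show "integrable lebesgue (\<lambda>y. \<phi> (x - y))"
    using * not_integrable_integral_eq by fastforce
qed

lemma compact_Minkowski_ball:
  fixes K :: "'a::euclidean_space set"
  assumes "compact K" shows "compact {y. \<exists>x\<in>K. dist x y \<le> e}"
proof -
  have "{y. \<exists>x\<in>K. dist x y \<le> e} = {x + y | x y. x \<in> K \<and> y \<in> cball 0 e}"
    by (force simp: dist_norm norm_minus_commute intro: exI[of _ "_ - _"])
  then show ?thesis using compact_sums[OF assms compact_cball[of 0 e]] by simp
qed

text \<open>Mollify the indicator of the s-neighbourhood of K at scale s = e/3: from a point of K
  the kernel sees only the value 1, and the result vanishes outside the 2s-neighbourhood, which
  still lies in U.\<close>

lemma smooth_cutoff:
  fixes K :: "(real^'n::finite) set"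
  assumes "compact K" "open U" "K \<subseteq> U"
  obtains \<eta> where "\<eta> \<in> test_functions U" "\<And>x. 0 \<le> \<eta> x" "\<And>x. \<eta> x \<le> 1" "\<And>x. x \<in> K \<Longrightarrow> \<eta> x = 1"
proof -
  obtain e where e: "0 < e" "(\<Union>x\<in>K. ball x e) \<subseteq> U"
    by (rule compact_subset_open_imp_ball_epsilon_subset[OF assms])
  define s where "s = e / 3"
  have s: "s > 0" using e by (simp add: s_def)
  define K' where "K' = {y. \<exists>x\<in>K. dist x y \<le> s}"
  have K': "compact K'" unfolding K'_def using assms(1) by (rule compact_Minkowski_ball)
  have K'': "compact {y. \<exists>x\<in>K. dist x y \<le> 2 * s}" using assms(1) by (rule compact_Minkowski_ball)
  obtain A and \<phi> :: "real^'n \<Rightarrow> real" where m: "mollifier A s \<phi>" using mollifier_exists s by metis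
  then have tf: "\<phi> \<in> test_functions UNIV" by (simp add: mollifier_def)
  have h: "integrable lebesgue (indicat_real K')"
    using K' by (rule integrable_indicator_compact)
  note i = integrable_convolution[OF tf h] integral_mollifier_translate[OF m]
  show ?thesis
  proof (rule that[of "convolution \<phi> (indicat_real K')"])
    show "convolution \<phi> (indicat_real K') \<in> test_functions U"
    proof (rule test_functionsI[OF C_k_convolution[OF tf h] K''])
      show "{y. \<exists>x\<in>K. dist x y \<le> 2 * s} \<subseteq> U"
        using e by (force simp: s_def)
      fix x assume x: "x \<notin> {y. \<exists>x\<in>K. dist x y \<le> 2 * s}"
      show "convolution \<phi> (indicat_real K') x = 0"
      proof (rule convolution_eq_0[of s])
        fix y assume y: "dist x y < s"
        show "indicat_real K' y = 0"
        proof (rule ccontr)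
          assume "indicat_real K' y \<noteq> 0"
          then obtain z where "z \<in> K" "dist z y \<le> s" by (auto simp: K'_def indicator_def split: if_splits)
          moreover have "dist z x \<le> dist z y + dist x y" by (metis dist_commute dist_triangle)
          ultimately have "z \<in> K" "dist z x \<le> 2 * s" using y by linarith+
          then show False using x by blast
        qed
      qed (use m in \<open>auto simp: mollifier_def\<close>)
    qed
    fix x
    show "0 \<le> convolution \<phi> (indicat_real K') x"
      unfolding convolution_def using m by (intro integral_nonneg_AE) (auto simp: mollifier_def)
    have "convolution \<phi> (indicat_real K') x \<le> (LINT y|lebesgue. \<phi> (x - y))"
      unfolding convolution_def using m i
      by (intro Bochner_Integration.integral_mono) (auto simp: mollifier_def indicator_def)
    then show "convolution \<phi> (indicat_real K') x \<le> 1" using i by simp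
    assume "x \<in> K"
    have "convolution \<phi> (indicat_real K') x = (LINT y|lebesgue. \<phi> (x - y))"
      unfolding convolution_def
    proof (intro Bochner_Integration.integral_cong refl)
      fix y
      show "\<phi> (x - y) * indicat_real K' y = \<phi> (x - y)"
        using m \<open>x \<in> K\<close> by (cases "dist x y \<le> s") (auto simp: mollifier_def K'_def indicator_def dist_norm)
    qed
    then show "convolution \<phi> (indicat_real K') x = 1" using i by simp
  qed
qed

text \<open>As \<phi> is even, y -> \<phi>(y - x) is the convolution kernel itself, and its
  derivative in y is the negative of the derivative that falls on \<phi>(x - y). This makes it a
  test function in y, and the weak derivative formula moves the derivative to h.\<close>

lemma partial_deriv_convolution_weak:
  fixes h h' :: "real^'n::finite \<Rightarrow> real"
  assumes m: "mollifier A s \<phi>" and h: "integrable lebesgue h"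
    and weak: "\<And>\<tau>. \<tau> \<in> test_functions UNIV \<Longrightarrow>
       (LINT y|lebesgue. h y * partial_deriv j \<tau> y) = - (LINT y|lebesgue. h' y * \<tau> y)"
  shows "partial_deriv j (convolution \<phi> h) x = convolution \<phi> h' x"
proof -
  have tf: "\<phi> \<in> test_functions UNIV" and even: "\<And>x. \<phi> (- x) = \<phi> x"
    and z: "\<And>x. s \<le> norm x \<Longrightarrow> \<phi> x = 0" using m by (auto simp: mollifier_def)
  note Ck = test_functions_C_k[OF tf]
  have t: "(\<lambda>y. \<phi> (y - x)) \<in> test_functions UNIV"
  proof (rule test_functionsI)
    fix y :: "real^'n" assume "y \<notin> cball 0 (s + norm x)"
    moreover have "norm y \<le> norm (y - x) + norm x" by norm
    ultimately show "\<phi> (y - x) = 0" using z by auto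
  qed (rule C_k_translate Ck compact_cball subset_UNIV)+
  have "partial_deriv j \<phi> (x - y) = - partial_deriv j (\<lambda>y. \<phi> (y - x)) y" for y
    using partial_deriv_even[OF Ck even, of j "y - x"] partial_deriv_translate[OF Ck, of j x y] by simp
  then have "convolution (partial_deriv j \<phi>) h x = - (LINT y|lebesgue. h y * partial_deriv j (\<lambda>y. \<phi> (y - x)) y)"
    by (simp add: convolution_def mult.commute)
  also have "\<dots> = (LINT y|lebesgue. h' y * \<phi> (y - x))" using weak[OF t] by simp
  also have "\<dots> = convolution \<phi> h' x"
    unfolding convolution_def using even[of "x - _"] by (simp add: mult.commute)
  finally show ?thesis using partial_deriv_convolution[OF tf h] by simp
qed

section \<open>The function space\<close>

lemma ennreal_divide_mult_cancel: "b \<noteq> 0 \<Longrightarrow> b \<noteq> top \<Longrightarrow> a / b * b = (a::ennreal)"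
  by (metis ennreal_times_divide mult.commute mult_divide_eq_ennreal)

locale mollifiable_space = banach_function_space \<Omega> X N
  for \<Omega> :: "(real^'n::finite) set" and X :: "((real^'n) \<Rightarrow> real) set" and N :: "((real^'n) \<Rightarrow> real) \<Rightarrow> real" +
  assumes open_\<Omega>: "open \<Omega>"
    and fatou: "fatou_property \<Omega> X N"
    and ac_norm: "absolutely_continuous_norm \<Omega> X N"
    and muckenhoupt: "muckenhoupt_condition \<Omega> X N"
    and prop_G: "property_G \<Omega> X N"
begin

abbreviation "X' \<equiv> associate_space \<Omega> X"
abbreviation "N' \<equiv> associate_norm \<Omega> X N"

lemma sets_\<Omega> [simp, measurable]: "\<Omega> \<in> sets lebesgue"
  using open_\<Omega> lmeasurable_open borel_open by auto

lemma mem_X_measurable: "f \<in> X \<Longrightarrow> f \<in> borel_measurable (lebesgue_on \<Omega>)"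
  using subset_L0 by (auto simp: L0_def)

lemma measurable_restrict_\<Omega>: "f \<in> borel_measurable lebesgue \<Longrightarrow> f \<in> borel_measurable (lebesgue_on \<Omega>)"
  by (rule measurable_restrict_space1)

text \<open>Elements of X are arbitrary outside \<Omega>; cut to a subset of \<Omega> they become
  measurable on the whole space, as integrals over \<open>lebesgue\<close> require.\<close>

lemma measurable_extend:
  fixes f :: "(real^'n) \<Rightarrow> real"
  assumes "f \<in> borel_measurable (lebesgue_on \<Omega>)" "S \<in> sets lebesgue" "S \<subseteq> \<Omega>"
  shows "(\<lambda>x. indicat_real S x * f x) \<in> borel_measurable lebesgue"
proof -
  have "f \<in> borel_measurable (lebesgue_on S)" using assms measurable_restrict_mono by blast
  then show ?thesis using assms(2) by (simp add: borel_measurable_restrict_space_iff)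
qed

lemma measurable_extend_0:
  fixes f :: "(real^'n) \<Rightarrow> real"
  assumes "f \<in> borel_measurable (lebesgue_on \<Omega>)" "S \<in> sets lebesgue" "S \<subseteq> \<Omega>" "\<And>x. x \<notin> S \<Longrightarrow> f x = 0"
  shows "f \<in> borel_measurable lebesgue"
proof -
  have "(\<lambda>x. indicat_real S x * f x) = f" using assms(4) by (auto simp: indicator_def fun_eq_iff)
  then show ?thesis using measurable_extend[OF assms(1-3)] by simp
qed

lemma ideal:
  assumes "f \<in> X" "g \<in> borel_measurable (lebesgue_on \<Omega>)" "\<And>x. x \<in> \<Omega> \<Longrightarrow> \<bar>g x\<bar> \<le> \<bar>f x\<bar>"
  shows "g \<in> X" "N g \<le> N f"
proof -
  have "AE x in lebesgue_on \<Omega>. \<bar>g x\<bar> \<le> \<bar>f x\<bar>" using assms(3) by (intro AE_I2) auto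
  then show "g \<in> X" "N g \<le> N f" using ideal_property[OF assms(1)] assms(2) by (auto simp: L0_def)
qed

lemma norm_cong_AE:
  assumes "f \<in> X" "g \<in> borel_measurable (lebesgue_on \<Omega>)" "AE x in lebesgue_on \<Omega>. g x = f x"
  shows "g \<in> X" "N g = N f"
proof -
  have 1: "AE x in lebesgue_on \<Omega>. \<bar>g x\<bar> \<le> \<bar>f x\<bar>" using assms(3) by eventually_elim auto
  have g: "g \<in> X \<and> N g \<le> N f" using ideal_property[OF assms(1) _ 1] assms(2) by (auto simp: L0_def)
  have 2: "AE x in lebesgue_on \<Omega>. \<bar>f x\<bar> \<le> \<bar>g x\<bar>" using assms(3) by eventually_elim auto
  have "N f \<le> N g" using ideal_property[OF _ _ 2] mem_X_measurable[OF assms(1)] g by (auto simp: L0_def)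
  with g show "g \<in> X" "N g = N f" by auto
qed

lemma abs_mem: assumes "f \<in> X" shows "(\<lambda>x. \<bar>f x\<bar>) \<in> X" "N (\<lambda>x. \<bar>f x\<bar>) = N f"
proof -
  have m: "(\<lambda>x. \<bar>f x\<bar>) \<in> borel_measurable (lebesgue_on \<Omega>)" using mem_X_measurable[OF assms] by measurable
  show 1: "(\<lambda>x. \<bar>f x\<bar>) \<in> X" by (rule ideal(1)[OF assms m]) auto
  show "N (\<lambda>x. \<bar>f x\<bar>) = N f"
    by (rule antisym[OF ideal(2)[OF assms m] ideal(2)[OF 1 mem_X_measurable[OF assms]]]) auto
qed

lemma norm_zero [simp]: "N (\<lambda>x. 0) = 0"
  using norm_eq_0_iff[OF zero_mem] by simp

lemma uminus_mem: "f \<in> X \<Longrightarrow> (\<lambda>x. - f x) \<in> X" "f \<in> X \<Longrightarrow> N (\<lambda>x. - f x) = N f"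
  using scale_mem[of f "-1"] norm_scale[of f "-1"] by auto

lemma diff_mem: "f \<in> X \<Longrightarrow> g \<in> X \<Longrightarrow> (\<lambda>x. f x - g x) \<in> X"
  using add_mem[OF _ uminus_mem(1), of f g] by simp

lemma norm_diff_triangle: "f \<in> X \<Longrightarrow> g \<in> X \<Longrightarrow> N (\<lambda>x. f x - g x) \<le> N f + N g"
  using norm_triangle[OF _ uminus_mem(1), of f g] uminus_mem(2)[of g] by simp

lemma sum_mem: "(\<And>i. i \<in> I \<Longrightarrow> f i \<in> X) \<Longrightarrow> (\<lambda>x. \<Sum>i\<in>I. f i x) \<in> X"
  by (induction I rule: infinite_finite_induct) (auto intro: zero_mem add_mem)

lemma norm_sum: "(\<And>i. i \<in> I \<Longrightarrow> f i \<in> X) \<Longrightarrow> N (\<lambda>x. \<Sum>i\<in>I. f i x) \<le> (\<Sum>i\<in>I. N (f i))"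
proof (induction I rule: infinite_finite_induct)
  case (insert i I)
  then have "N (\<lambda>x. f i x + (\<Sum>i\<in>I. f i x)) \<le> N (f i) + N (\<lambda>x. \<Sum>i\<in>I. f i x)"
    by (intro norm_triangle sum_mem) auto
  then show ?case using insert by fastforce
qed auto

lemma mult_bounded_mem:
  assumes "f \<in> X" "b \<in> borel_measurable (lebesgue_on \<Omega>)" "\<And>x. x \<in> \<Omega> \<Longrightarrow> \<bar>b x\<bar> \<le> B"
  shows "(\<lambda>x. b x * f x) \<in> X"
proof (rule ideal(1)[OF scale_mem[OF assms(1), of B]])
  show "(\<lambda>x. b x * f x) \<in> borel_measurable (lebesgue_on \<Omega>)"
    using assms(2) mem_X_measurable[OF assms(1)] by measurable
  fix x assume "x \<in> \<Omega>"
  then show "\<bar>b x * f x\<bar> \<le> \<bar>B * f x\<bar>"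
    using assms(3)[of x] by (auto simp: abs_mult intro!: mult_right_mono)
qed

lemma test_function_mult_mem:
  assumes "\<psi> \<in> test_functions \<Omega>'" "f \<in> X" shows "(\<lambda>x. \<psi> x * f x) \<in> X"
proof -
  obtain B where "\<And>x. \<bar>\<psi> x\<bar> \<le> B" using test_functions_bounded[OF assms(1)] by blast
  then show ?thesis
    by (intro mult_bounded_mem[OF assms(2)] measurable_restrict_\<Omega> continuous_imp_lebesgue_measurable
        test_functions_continuous[OF assms(1)])
qed

text \<open>Normalizing f reduces this to the supremum that defines \<open>N'\<close>. If N f = 0,
  then f vanishes almost everywhere and both sides are 0, also for infinite \<open>N' g\<close>,
  because 0 times infinity is 0 in \<open>ennreal\<close>.\<close>

lemma Hoelder:
  assumes "f \<in> X" and g: "g \<in> borel_measurable (lebesgue_on \<Omega>)"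
  shows "(\<integral>\<^sup>+x. ennreal \<bar>f x * g x\<bar> \<partial>lebesgue_on \<Omega>) \<le> ennreal (N f) * N' g"
proof (cases "N f = 0")
  case True
  then have "AE x in lebesgue_on \<Omega>. f x = 0" using norm_eq_0_iff assms(1) by blast
  then have "(\<integral>\<^sup>+x. ennreal \<bar>f x * g x\<bar> \<partial>lebesgue_on \<Omega>) = (\<integral>\<^sup>+x. 0 \<partial>lebesgue_on \<Omega>)"
    by (intro nn_integral_cong_AE) (auto elim: eventually_mono)
  then show ?thesis by simp
next
  case False
  then have pos: "N f > 0" using norm_nonneg[OF assms(1)] by simp
  define f1 where "f1 x = (1 / N f) * f x" for x
  have "f1 \<in> X" "N f1 = 1"
    unfolding f1_def using scale_mem[OF assms(1), of "1 / N f"] norm_scale[OF assms(1), of "1 / N f"] pos by auto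
  then have "(\<integral>\<^sup>+x. ennreal \<bar>f1 x * g x\<bar> \<partial>lebesgue_on \<Omega>) \<le> N' g"
    unfolding associate_norm_def by (intro SUP_upper) auto
  then have "ennreal (N f) * (\<integral>\<^sup>+x. ennreal \<bar>f1 x * g x\<bar> \<partial>lebesgue_on \<Omega>) \<le> ennreal (N f) * N' g"
    by (rule mult_left_mono) simp
  moreover have "ennreal \<bar>f x * g x\<bar> = ennreal (N f) * ennreal \<bar>f1 x * g x\<bar>" for x
    using pos by (simp add: f1_def abs_mult flip: ennreal_mult)
  moreover have "(\<lambda>x. ennreal \<bar>f1 x * g x\<bar>) \<in> borel_measurable (lebesgue_on \<Omega>)"
    using mem_X_measurable[OF \<open>f1 \<in> X\<close>] g by measurable
  ultimately show ?thesis by (simp add: nn_integral_cmult)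
qed

text \<open>
  Absolute continuity of the norm is applied to the sets where $|w_j| > \delta |H|$ for some $j \ge k$.
  Since the threshold is relative to $H$, no strictly positive element of $X$ is needed.
\<close>

lemma dominated_convergence:
  assumes w: "\<And>k. w k \<in> borel_measurable (lebesgue_on \<Omega>)" and H: "H \<in> X"
    and le: "\<And>k. AE x in lebesgue_on \<Omega>. \<bar>w k x\<bar> \<le> \<bar>H x\<bar>"
    and lim: "AE x in lebesgue_on \<Omega>. (\<lambda>k. w k x) \<longlonglongrightarrow> 0"
  shows "(\<lambda>k. N (w k)) \<longlonglongrightarrow> 0"
proof -
  have wX: "w k \<in> X" for k using ideal_property[OF H _ le] w by (auto simp: L0_def)
  have Hm: "H \<in> borel_measurable (lebesgue_on \<Omega>)" using mem_X_measurable H .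
  have "AE x in lebesgue_on \<Omega>. (\<forall>k. \<bar>w k x\<bar> \<le> \<bar>H x\<bar>) \<and> (\<lambda>k. w k x) \<longlonglongrightarrow> 0"
    using le lim by (simp add: AE_all_countable AE_conj_iff)
  then obtain Z where Z: "Z \<in> null_sets (lebesgue_on \<Omega>)"
    "{x \<in> space (lebesgue_on \<Omega>). \<not> ((\<forall>k. \<bar>w k x\<bar> \<le> \<bar>H x\<bar>) \<and> (\<lambda>k. w k x) \<longlonglongrightarrow> 0)} \<subseteq> Z"
    unfolding eventually_ae_filter by blast
  show ?thesis
  proof (rule LIMSEQ_I)
    fix r :: real assume r: "0 < r"
    \<comment> \<open>Each part gets half of r: where |w| \<le> \<delta> |H| the norm is at most
      \<delta> N H, and the rest is left to absolute continuity. The + 1 covers N H = 0.\<close>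
    define \<delta> where "\<delta> = r / (2 * (N H + 1))"
    have \<delta>: "\<delta> > 0" "\<delta> * N H < r / 2"
      using r norm_nonneg[OF H] by (auto simp: \<delta>_def field_simps add_pos_nonneg)
    \<comment> \<open>The exceptional null set Z is removed because absolute continuity asks for an
      intersection that is empty, not merely null.\<close>
    define E where "E k = {x \<in> space (lebesgue_on \<Omega>). \<exists>j\<in>{k..}. \<delta> * \<bar>H x\<bar> < \<bar>w j x\<bar>} - Z" for k
    have E: "E k \<in> sets (lebesgue_on \<Omega>)" for k
    proof -
      have [measurable]: "Z \<in> sets (lebesgue_on \<Omega>)" using Z(1) by auto
      show ?thesis unfolding E_def using w Hm by measurable
    qed
    have "decseq E" by (force simp: decseq_def E_def)
    moreover have "(\<Inter>k. E k) = {}"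
    proof (rule ccontr)
      assume "(\<Inter>k. E k) \<noteq> {}"
      then obtain x where x: "\<And>k. x \<in> E k" by auto
      then have xZ: "x \<in> space (lebesgue_on \<Omega>)" "x \<notin> Z" by (auto simp: E_def)
      then have g: "\<And>k. \<bar>w k x\<bar> \<le> \<bar>H x\<bar>" "(\<lambda>k. w k x) \<longlonglongrightarrow> 0" using Z(2) by auto
      \<comment> \<open>At a zero of H domination forces every w_j to vanish, which the strict
        inequality in E excludes. So the threshold is positive and pointwise convergence contradicts
        membership in all E k.\<close>
      have "H x \<noteq> 0"
      proof
        assume "H x = 0"
        moreover obtain j where "\<delta> * \<bar>H x\<bar> < \<bar>w j x\<bar>" using x[of 0] by (auto simp: E_def)
        ultimately show False using g(1)[of j] by simp
      qed
      then have "\<delta> * \<bar>H x\<bar> > 0" using \<delta> by simp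
      then obtain k where "\<And>j. j \<ge> k \<Longrightarrow> norm (w j x - 0) < \<delta> * \<bar>H x\<bar>"
        using LIMSEQ_D[OF g(2)] by blast
      then show False using x[of k] by (force simp: E_def)
    qed
    ultimately have "(\<lambda>k. N (\<lambda>x. H x * indicat_real (E k) x)) \<longlonglongrightarrow> 0"
      using ac_norm H E unfolding absolutely_continuous_norm_def by blast
    then obtain K where K: "\<And>k. k \<ge> K \<Longrightarrow> norm (N (\<lambda>x. H x * indicat_real (E k) x) - 0) < r / 2"
      using LIMSEQ_D r half_gt_zero by blast
    have "norm (N (w k) - 0) < r" if "k \<ge> K" for k
    proof -
      have m: "(\<lambda>x. H x * indicat_real (E k) x) \<in> borel_measurable (lebesgue_on \<Omega>)"
        using Hm E[of k] by measurable
      have 1: "(\<lambda>x. \<bar>H x * indicat_real (E k) x\<bar>) \<in> X" "N (\<lambda>x. \<bar>H x * indicat_real (E k) x\<bar>) = N (\<lambda>x. H x * indicat_real (E k) x)"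
        using abs_mem[OF ideal(1)[OF H m]] by (auto simp: indicator_def)
      have 2: "(\<lambda>x. \<delta> * \<bar>H x\<bar>) \<in> X" "N (\<lambda>x. \<delta> * \<bar>H x\<bar>) = \<delta> * N H"
        using scale_mem[OF abs_mem(1)[OF H], of \<delta>] norm_scale[OF abs_mem(1)[OF H], of \<delta>] abs_mem(2)[OF H] \<delta> by auto
      have "AE x in lebesgue_on \<Omega>. x \<notin> Z" using Z(1) by (rule AE_not_in)
      then have "AE x in lebesgue_on \<Omega>. \<bar>w k x\<bar> \<le> \<bar>\<bar>H x * indicat_real (E k) x\<bar> + \<delta> * \<bar>H x\<bar>\<bar>"
        using AE_space
      proof eventually_elim
        case (elim x)
        then have "\<bar>w k x\<bar> \<le> \<bar>H x\<bar>" using Z(2) by auto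
        moreover have "x \<notin> E k \<Longrightarrow> \<bar>w k x\<bar> \<le> \<delta> * \<bar>H x\<bar>"
          using elim by (auto simp: E_def not_less)
        moreover have "0 \<le> \<delta> * \<bar>H x\<bar>" using \<delta> by simp
        ultimately show ?case by (auto simp: indicator_def)
      qed
      then have "N (w k) \<le> N (\<lambda>x. \<bar>H x * indicat_real (E k) x\<bar> + \<delta> * \<bar>H x\<bar>)"
        using ideal_property[OF add_mem[OF 1(1) 2(1)]] w by (auto simp: L0_def)
      also have "\<dots> \<le> N (\<lambda>x. H x * indicat_real (E k) x) + \<delta> * N H"
        using norm_triangle[OF 1(1) 2(1)] 1 2 by simp
      also have "\<dots> < r" using K[OF that] \<delta> by simp
      finally show ?thesis using norm_nonneg[OF wX] by simp
    qed
    then show "\<exists>K. \<forall>k\<ge>K. norm (N (w k) - 0) < r" by blast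
  qed
qed

section \<open>Cubes, compact sets and local integrability\<close>

lemma cube_mem:
  assumes "Q \<in> cubes_in \<Omega>"
  shows "indicat_real Q \<in> X" "indicat_real Q \<in> X'"
  using assms muckenhoupt by (auto simp: muckenhoupt_condition_def)

lemma cube_measure:
  assumes "Q \<in> cubes_in \<Omega>" shows "0 < emeasure lebesgue Q" "emeasure lebesgue Q < \<infinity>" "Q \<in> sets lebesgue" "Q \<subseteq> \<Omega>"
proof -
  obtain a l where Q: "0 < l" "Q = cbox a (a + vec l)" "Q \<subseteq> \<Omega>" using assms by (auto simp: cubes_in_def)
  then have "emeasure lebesgue Q = ennreal (l ^ CARD('n))" using emeasure_cube[of l a] by simp
  then show "0 < emeasure lebesgue Q" "emeasure lebesgue Q < \<infinity>" using Q(1) by auto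
  show "Q \<in> sets lebesgue" "Q \<subseteq> \<Omega>" using Q by auto
qed

lemma muckenhoupt_constant:
  obtains K where "0 \<le> K" "\<And>Q. Q \<in> cubes_in \<Omega> \<Longrightarrow>
    ennreal (N (indicat_real Q)) * N' (indicat_real Q) \<le> ennreal K * emeasure lebesgue Q"
proof -
  let ?S = "SUP Q\<in>cubes_in \<Omega>. ennreal (N (indicat_real Q)) * N' (indicat_real Q) / emeasure lebesgue Q"
  have "?S < \<infinity>" using muckenhoupt by (auto simp: muckenhoupt_condition_def)
  then obtain K where K: "0 \<le> K" "?S = ennreal K" by (cases ?S) auto
  have "ennreal (N (indicat_real Q)) * N' (indicat_real Q) \<le> ennreal K * emeasure lebesgue Q"
    if Q: "Q \<in> cubes_in \<Omega>" for Q
  proof -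
    have "ennreal (N (indicat_real Q)) * N' (indicat_real Q) / emeasure lebesgue Q \<le> ennreal K"
      unfolding K(2)[symmetric] using Q by (rule SUP_upper)
    from mult_right_mono[OF this, of "emeasure lebesgue Q"] show ?thesis
      using cube_measure[OF Q] ennreal_divide_mult_cancel[of "emeasure lebesgue Q"] by force
  qed
  with K(1) show ?thesis using that by blast
qed

text \<open>Q has positive measure, so its indicator has positive norm; a finite product with a
  positive factor leaves the other factor finite.\<close>

lemma cube_associate_norm_finite:
  assumes Q: "Q \<in> cubes_in \<Omega>" shows "N' (indicat_real Q) < \<infinity>"
proof -
  obtain K where K: "ennreal (N (indicat_real Q)) * N' (indicat_real Q) \<le> ennreal K * emeasure lebesgue Q"
    using muckenhoupt_constant Q by metis
  have "N (indicat_real Q) \<noteq> 0"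
  proof
    assume "N (indicat_real Q) = 0"
    then have "AE x in lebesgue_on \<Omega>. indicat_real Q x = 0" using norm_eq_0_iff[OF cube_mem(1)[OF Q]] by simp
    then have "AE x in lebesgue. x \<in> \<Omega> \<longrightarrow> indicat_real Q x = 0" by (simp add: AE_restrict_space_iff)
    then have "AE x in lebesgue. x \<notin> Q"
      using cube_measure(4)[OF Q] by (auto elim!: eventually_mono simp: indicator_def split: if_splits)
    then show False using cube_measure(1,3)[OF Q] by (simp add: AE_iff_null_sets[symmetric] null_sets_def AE_iff_measurable[OF _ refl])
  qed
  then have "0 < N (indicat_real Q)" using norm_nonneg[OF cube_mem(1)[OF Q]] by simp
  moreover have "ennreal K * emeasure lebesgue Q < \<infinity>" using cube_measure(2)[OF Q] by (simp add: ennreal_mult_less_top)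
  then have "ennreal (N (indicat_real Q)) * N' (indicat_real Q) < \<infinity>" using K by (rule le_less_trans[rotated])
  ultimately show ?thesis by (auto simp: ennreal_mult_less_top)
qed

end

lemma norm_diff_cube_le:
  fixes x y :: "real^'n::finite" and l :: real
  assumes "x \<in> cbox a (a + vec l)" "y \<in> cbox a (a + vec l)"
  shows "norm (x - y) \<le> CARD('n) * l"
proof -
  have "norm (x - y) \<le> (\<Sum>i\<in>UNIV. \<bar>(x - y) $ i\<bar>)" by (rule norm_le_l1_cart)
  also have "\<dots> \<le> (\<Sum>i\<in>(UNIV::'n set). l)"
  proof (rule sum_mono)
    fix i
    have "a $ i \<le> x $ i" "x $ i \<le> a $ i + l" "a $ i \<le> y $ i" "y $ i \<le> a $ i + l"
      using assms by (auto simp: mem_box_cart)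
    then show "\<bar>(x - y) $ i\<bar> \<le> l" by simp
  qed
  finally show ?thesis by simp
qed

text \<open>The Muckenhoupt condition speaks of cubes; through finite covers its consequences reach
  compact sets. The interiors of the cubes serve as the open cover.\<close>

lemma compact_cover_cubes:
  fixes K :: "(real^'n::finite) set"
  assumes "compact K" "open \<Omega>" "K \<subseteq> \<Omega>"
  obtains \<Q> where "finite \<Q>" "\<Q> \<subseteq> cubes_in \<Omega>" "K \<subseteq> \<Union>\<Q>"
proof -
  have "\<exists>Q\<in>cubes_in \<Omega>. x \<in> interior Q" if "x \<in> K" for x
  proof -
    obtain e where e: "e > 0" "ball x e \<subseteq> \<Omega>" using openE[OF assms(2)] assms(3) \<open>x \<in> K\<close> by blast
    \<comment> \<open>A cube of side l has diameter at most n l, which is then e/2.\<close>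
    define l where "l = e / (2 * CARD('n))"
    have l: "l > 0" "CARD('n) * l < e" using e by (auto simp: l_def)
    define Q where "Q = cbox (x - vec (l/2)) (x - vec (l/2) + vec l)"
    have xQ: "x \<in> box (x - vec (l/2)) (x - vec (l/2) + vec l)" using l by (auto simp: mem_box_cart)
    have "Q \<subseteq> \<Omega>"
    proof
      fix y assume "y \<in> Q"
      then have "norm (x - y) \<le> CARD('n) * l"
        using xQ box_subset_cbox unfolding Q_def by (intro norm_diff_cube_le) auto
      then show "y \<in> \<Omega>" using l e by (auto simp: dist_norm)
    qed
    then have "Q \<in> cubes_in \<Omega>" using l by (auto simp: cubes_in_def Q_def)
    moreover have "x \<in> interior Q" using xQ by (simp add: Q_def)
    ultimately show ?thesis by blast
  qed
  then obtain q where q: "\<And>x. x \<in> K \<Longrightarrow> q x \<in> cubes_in \<Omega>" "\<And>x. x \<in> K \<Longrightarrow> x \<in> interior (q x)" by metis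
  obtain D where D: "D \<subseteq> K" "finite D" "K \<subseteq> (\<Union>x\<in>D. interior (q x))"
    by (rule compactE_image[OF assms(1), of K "\<lambda>x. interior (q x)"]) (use q in auto)
  show ?thesis
  proof (rule that[of "q ` D"])
    show "K \<subseteq> \<Union> (q ` D)"
    proof
      fix x assume "x \<in> K"
      then obtain d where "d \<in> D" "x \<in> interior (q d)" using D(3) by blast
      then show "x \<in> \<Union> (q ` D)" using interior_subset[of "q d"] by blast
    qed
  qed (use D q in auto)
qed

context mollifiable_space begin

lemma indicator_compact_mem:
  assumes "compact K" "K \<subseteq> \<Omega>" shows "indicat_real K \<in> X"
proof -
  obtain \<Q> where Q: "finite \<Q>" "\<Q> \<subseteq> cubes_in \<Omega>" "K \<subseteq> \<Union>\<Q>"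
    by (rule compact_cover_cubes[OF assms(1) open_\<Omega> assms(2)])
  have "(\<lambda>x. \<Sum>Q\<in>\<Q>. indicat_real Q x) \<in> X" using Q cube_mem(1) by (intro sum_mem) auto
  then show ?thesis
  proof (rule ideal(1))
    show "indicat_real K \<in> borel_measurable (lebesgue_on \<Omega>)"
      using lmeasurable_compact[OF assms(1)] by (intro measurable_restrict_\<Omega> borel_measurable_indicator) auto
    fix x
    show "\<bar>indicat_real K x\<bar> \<le> \<bar>\<Sum>Q\<in>\<Q>. indicat_real Q x\<bar>"
    proof (cases "x \<in> K")
      case True
      then obtain Q where "Q \<in> \<Q>" "x \<in> Q" using Q by blast
      then have "1 \<le> (\<Sum>Q\<in>\<Q>. indicat_real Q x)"
        using Q(1) member_le_sum[of Q \<Q> "\<lambda>Q. indicat_real Q x"] by simp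
      then show ?thesis using True by simp
    qed simp
  qed
qed

text \<open>Hoelder's inequality on each of finitely many covering cubes, whose indicators have
  finite associate norm. With C independent of f this is the continuous embedding into local L1,
  used for integrability and for limits of weak derivatives.\<close>

lemma local_integral_bound:
  assumes "compact K" "K \<subseteq> \<Omega>"
  obtains C where "0 \<le> C" "\<And>f. f \<in> X \<Longrightarrow> (\<integral>\<^sup>+x. ennreal \<bar>indicat_real K x * f x\<bar> \<partial>lebesgue) \<le> ennreal (C * N f)"
proof -
  obtain \<Q> where Q: "finite \<Q>" "\<Q> \<subseteq> cubes_in \<Omega>" "K \<subseteq> \<Union>\<Q>"
    by (rule compact_cover_cubes[OF assms(1) open_\<Omega> assms(2)])
  define C where "C = (\<Sum>Q\<in>\<Q>. enn2real (N' (indicat_real Q)))"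
  have "(\<integral>\<^sup>+x. ennreal \<bar>indicat_real K x * f x\<bar> \<partial>lebesgue) \<le> ennreal (C * N f)" if f: "f \<in> X" for f
  proof -
    note fm = mem_X_measurable[OF f]
    have "(\<integral>\<^sup>+x. ennreal \<bar>indicat_real K x * f x\<bar> \<partial>lebesgue)
      = (\<integral>\<^sup>+x. ennreal \<bar>indicat_real K x * f x\<bar> * indicator \<Omega> x \<partial>lebesgue)"
      using assms(2) by (intro nn_integral_cong) (auto simp: indicator_def)
    also have "\<dots> = (\<integral>\<^sup>+x. ennreal \<bar>indicat_real K x * f x\<bar> \<partial>lebesgue_on \<Omega>)"
      by (simp add: nn_integral_restrict_space)
    also have "\<dots> \<le> (\<integral>\<^sup>+x. (\<Sum>Q\<in>\<Q>. ennreal \<bar>f x * indicat_real Q x\<bar>) \<partial>lebesgue_on \<Omega>)"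
    proof (rule nn_integral_mono)
      fix x
      show "ennreal \<bar>indicat_real K x * f x\<bar> \<le> (\<Sum>Q\<in>\<Q>. ennreal \<bar>f x * indicat_real Q x\<bar>)"
      proof (cases "x \<in> K")
        case True
        then obtain Q where "Q \<in> \<Q>" "x \<in> Q" using Q by blast
        then show ?thesis
          using Q(1) member_le_sum[of Q \<Q> "\<lambda>Q. ennreal \<bar>f x * indicat_real Q x\<bar>"] True by simp
      qed simp
    qed
    also have "\<dots> = (\<Sum>Q\<in>\<Q>. \<integral>\<^sup>+x. ennreal \<bar>f x * indicat_real Q x\<bar> \<partial>lebesgue_on \<Omega>)"
    proof (rule nn_integral_sum)
      fix Q assume "Q \<in> \<Q>"
      then have "indicat_real Q \<in> borel_measurable (lebesgue_on \<Omega>)"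
        using cube_measure(3) Q(2) by (intro measurable_restrict_\<Omega> borel_measurable_indicator) auto
      then show "(\<lambda>x. ennreal \<bar>f x * indicat_real Q x\<bar>) \<in> borel_measurable (lebesgue_on \<Omega>)"
        using fm by measurable
    qed
    also have "\<dots> \<le> (\<Sum>Q\<in>\<Q>. ennreal (N f) * N' (indicat_real Q))"
      using Q(2) cube_measure(3) by (intro sum_mono Hoelder f measurable_restrict_\<Omega> borel_measurable_indicator) auto
    also have "\<dots> = (\<Sum>Q\<in>\<Q>. ennreal (N f * enn2real (N' (indicat_real Q))))"
      using cube_associate_norm_finite Q(2) norm_nonneg[OF f]
      by (intro sum.cong refl) (auto simp: ennreal_mult)
    also have "\<dots> = ennreal (C * N f)"
      using norm_nonneg[OF f] by (simp add: C_def sum_distrib_left mult.commute)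
    finally show ?thesis .
  qed
  then show ?thesis using that[of C] by (auto simp: C_def sum_nonneg)
qed

lemma local_integrable:
  assumes "f \<in> X" "compact K" "K \<subseteq> \<Omega>"
  shows "integrable lebesgue (\<lambda>x. indicat_real K x * f x)"
proof -
  obtain C where C: "(\<integral>\<^sup>+x. ennreal \<bar>indicat_real K x * f x\<bar> \<partial>lebesgue) \<le> ennreal (C * N f)"
    using local_integral_bound[OF assms(2,3)] assms(1) by metis
  have "(\<lambda>x. indicat_real K x * f x) \<in> borel_measurable lebesgue"
    using measurable_extend[OF mem_X_measurable[OF assms(1)] _ assms(3)] lmeasurable_compact[OF assms(2)] by auto
  then show ?thesis using C by (auto simp: integrable_iff_bounded le_less_trans)
qed

lemma X_subset_L1_loc: "f \<in> X \<Longrightarrow> f \<in> L1_loc \<Omega>"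
  using local_integrable subset_L0 by (auto simp: L1_loc_def set_integrable_def)

text \<open>Bounded functions with compact support in \<Omega> are the common ground of X and of
  Lebesgue integration; domination by a multiple of the indicator of S gives both membership and the
  norm bound.\<close>

lemma bounded_compact_support_mem:
  assumes "p \<in> borel_measurable lebesgue" "\<And>x. \<bar>p x\<bar> \<le> M" "\<And>x. x \<notin> S \<Longrightarrow> p x = 0" "compact S" "S \<subseteq> \<Omega>"
  shows "p \<in> X" "N p \<le> M * N (indicat_real S)" "integrable lebesgue p"
proof -
  have M: "M \<ge> 0" using assms(2) abs_ge_zero order_trans by blast
  have S: "indicat_real S \<in> X" using indicator_compact_mem assms by blast
  have le: "\<bar>p x\<bar> \<le> \<bar>M * indicat_real S x\<bar>" for x using assms(2)[of x] assms(3)[of x] M by (cases "x \<in> S") auto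
  show "p \<in> X" by (rule ideal(1)[OF scale_mem[OF S, of M] measurable_restrict_\<Omega>[OF assms(1)] le])
  show "N p \<le> M * N (indicat_real S)"
    using ideal(2)[OF scale_mem[OF S, of M] measurable_restrict_\<Omega>[OF assms(1)] le] norm_scale[OF S, of M] M by simp
  obtain R where "\<And>x. x \<in> S \<Longrightarrow> norm x \<le> R" using compact_imp_bounded[OF assms(4)] by (auto simp: bounded_iff)
  then show "integrable lebesgue p"
    using assms(3) by (intro integrable_bounded_support[OF assms(1,2), of R]) force
qed

end

section \<open>Duality\<close>

context mollifiable_space begin

lemma norm_triangle_diff: "f \<in> X \<Longrightarrow> g \<in> X \<Longrightarrow> N f \<le> N g + N (\<lambda>x. f x - g x)"
  using norm_triangle[of g "\<lambda>x. f x - g x"] diff_mem by simp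

lemma AE_lebesgue_on_\<Omega>: "AE x in lebesgue. P x \<Longrightarrow> AE x in lebesgue_on \<Omega>. P x"
  by (simp add: AE_restrict_space_iff) (auto elim: eventually_mono)

text \<open>The L1 norms of the increments are summable, so the sum of the absolute increments is
  finite almost everywhere, and there the telescoping series converges.\<close>

lemma AE_convergent_subseq:
  fixes p :: "nat \<Rightarrow> real^'n \<Rightarrow> real"
  assumes "\<And>k. integrable lebesgue (\<lambda>x. p (Suc k) x - p k x)"
    and "\<And>k. (LINT x|lebesgue. \<bar>p (Suc k) x - p k x\<bar>) \<le> c * (1/2) ^ k"
  shows "AE x in lebesgue. convergent (\<lambda>k. p k x)"
proof -
  have m: "(\<lambda>x. ennreal \<bar>p (Suc k) x - p k x\<bar>) \<in> borel_measurable lebesgue" for k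
    by (intro measurable_compose[OF _ measurable_ennreal] borel_measurable_abs borel_measurable_integrable assms(1))
  have "0 \<le> (LINT x|lebesgue. \<bar>p (Suc 0) x - p 0 x\<bar>)" by simp
  also have "\<dots> \<le> c" using assms(2)[of 0] by simp
  finally have c: "0 \<le> c" .
  have "(\<integral>\<^sup>+x. (\<Sum>k. ennreal \<bar>p (Suc k) x - p k x\<bar>) \<partial>lebesgue)
      = (\<Sum>k. \<integral>\<^sup>+x. ennreal \<bar>p (Suc k) x - p k x\<bar> \<partial>lebesgue)"
    using m by (intro nn_integral_suminf)
  also have "\<dots> \<le> (\<Sum>k. ennreal (c * (1/2) ^ k))"
  proof (intro suminf_le summableI)
    fix k
    have "(\<integral>\<^sup>+x. ennreal \<bar>p (Suc k) x - p k x\<bar> \<partial>lebesgue) = ennreal (LINT x|lebesgue. \<bar>p (Suc k) x - p k x\<bar>)"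
      using assms(1)[of k] by (intro nn_integral_eq_integral) auto
    then show "(\<integral>\<^sup>+x. ennreal \<bar>p (Suc k) x - p k x\<bar> \<partial>lebesgue) \<le> ennreal (c * (1/2) ^ k)"
      using assms(2)[of k] by (simp add: ennreal_leI)
  qed
  also have "\<dots> = ennreal (\<Sum>k. c * (1/2) ^ k)"
    by (rule suminf_ennreal2) (use c in \<open>auto intro!: summable_mult summable_geometric\<close>)
  also have "\<dots> < \<infinity>" by simp
  finally have "AE x in lebesgue. (\<Sum>k. ennreal \<bar>p (Suc k) x - p k x\<bar>) \<noteq> \<infinity>"
    using m by (intro nn_integral_PInf_AE) (auto intro!: borel_measurable_suminf_order)
  then show ?thesis
  proof eventually_elim
    case (elim x)
    then have "summable (\<lambda>k. \<bar>p (Suc k) x - p k x\<bar>)"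
      by (intro summable_suminf_not_top) auto
    then have "summable (\<lambda>k. p (Suc k) x - p k x)" by (rule summable_rabs_cancel)
    from summable_LIMSEQ[OF this] have "(\<lambda>n. p n x - p 0 x) \<longlonglongrightarrow> (\<Sum>k. p (Suc k) x - p k x)"
      by (simp only: sum_lessThan_telescope[of "\<lambda>k. p k x"])
    then have "(\<lambda>n. (p n x - p 0 x) + p 0 x) \<longlonglongrightarrow> (\<Sum>k. p (Suc k) x - p k x) + p 0 x"
      by (intro tendsto_intros)
    then show ?case by (auto simp: convergent_def)
  qed
qed

end

text \<open>The class in which the Hilbert space argument runs: for compact S inside \<Omega> its
  members lie in X and are square integrable.\<close>

definition bounded_measurable_on :: "(real^'n::finite) set \<Rightarrow> (real^'n \<Rightarrow> real) set" where
  "bounded_measurable_on S =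
     {h \<in> borel_measurable lebesgue. (\<exists>M. \<forall>x. \<bar>h x\<bar> \<le> M) \<and> (\<forall>x. x \<notin> S \<longrightarrow> h x = 0)}"

definition clamp_real :: "real \<Rightarrow> real \<Rightarrow> real" where
  "clamp_real M t = max (- M) (min M t)"

lemma clamp_real:
  assumes "0 \<le> M"
  shows "\<bar>clamp_real M t\<bar> \<le> M" "\<bar>clamp_real M t\<bar> \<le> \<bar>t\<bar>" "\<bar>s\<bar> \<le> M \<Longrightarrow> \<bar>s - clamp_real M t\<bar> \<le> \<bar>s - t\<bar>"
    "clamp_real M 0 = 0" "\<bar>t\<bar> \<le> M \<Longrightarrow> clamp_real M t = t"
  using assms by (auto simp: clamp_real_def)

lemma continuous_clamp_real: "continuous_on UNIV (clamp_real M)"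
  unfolding clamp_real_def[abs_def] by (intro continuous_intros)

lemma measurable_clamp_real [measurable]: "clamp_real M \<in> borel_measurable borel"
  using continuous_clamp_real by (rule borel_measurable_continuous_onI)

lemma real_le_0_of_le_mult:
  fixes a b :: real
  assumes "\<And>t. 0 < t \<Longrightarrow> t \<le> 1 \<Longrightarrow> a \<le> t * b" shows "a \<le> 0"
proof (rule ccontr)
  assume "\<not> a \<le> 0"
  then have a: "a > 0" by simp
  define t where "t = min 1 (a / (2 * (\<bar>b\<bar> + 1)))"
  have t: "0 < t" "t \<le> 1" using a by (auto simp: t_def)
  have "t * b \<le> t * (\<bar>b\<bar> + 1)" using t by (intro mult_left_mono) auto
  also have "\<dots> \<le> a / (2 * (\<bar>b\<bar> + 1)) * (\<bar>b\<bar> + 1)" by (intro mult_right_mono) (auto simp: t_def)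
  also have "\<dots> = a / 2" by (simp add: field_simps)
  finally show False using assms[OF t] a by simp
qed

context mollifiable_space begin

text \<open>
  The Lorentz--Luxemburg duality is obtained without the Hahn--Banach theorem: $F$ is projected in
  $L^2$ onto the ball of radius $C$ of $X$, which is closed under dominated almost everywhere limits,
  and the difference of $F$ and its projection separates $F$ from that ball.
\<close>

lemma nearest_point:
  assumes "F \<in> bounded_measurable_on S" and S: "compact S" "S \<subseteq> \<Omega>" and C: "0 \<le> C"
  shows "\<exists>p\<in>bounded_measurable_on S. N p \<le> C \<and> (\<forall>q\<in>bounded_measurable_on S. N q \<le> C \<longrightarrow>
    (LINT x|lebesgue. (F x - p x)\<^sup>2) \<le> (LINT x|lebesgue. (F x - q x)\<^sup>2))"
proof -
  obtain M where F: "F \<in> borel_measurable lebesgue" "\<And>x. \<bar>F x\<bar> \<le> M" "\<And>x. x \<notin> S \<Longrightarrow> F x = 0"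
    using assms(1) by (auto simp: bounded_measurable_on_def)
  have M: "0 \<le> M" using F(2) abs_ge_zero order_trans by blast
  note bcs = bounded_compact_support_mem[OF _ _ _ S]
  \<comment> \<open>Competitors are first restricted to |q| \<le> M, which supplies the dominating
    function for limits; truncation by \<open>clamp_real M\<close> at the end removes the
    restriction.\<close>
  define B where "B = {q \<in> borel_measurable lebesgue. (\<forall>x. \<bar>q x\<bar> \<le> M) \<and> (\<forall>x. x \<notin> S \<longrightarrow> q x = 0) \<and> N q \<le> C}"
  define J where "J q = (LINT x|lebesgue. (F x - q x)\<^sup>2)" for q
  define d where "d = Inf (J ` B)"
  have BX: "q \<in> X" if "q \<in> B" for q using that bcs(1) unfolding B_def by blast
  have Bm: "q \<in> borel_measurable lebesgue" if "q \<in> B" for q using that by (auto simp: B_def)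
  have zB: "(\<lambda>x. 0) \<in> B" using M C by (auto simp: B_def)
  have J0: "0 \<le> J q" for q by (simp add: J_def)
  then have bdd: "bdd_below (J ` B)" by (intro bdd_belowI[of _ 0]) auto
  have dJ: "d \<le> J q" if "q \<in> B" for q unfolding d_def using bdd that by (intro cInf_lower) auto
  have int: "integrable lebesgue (\<lambda>x. (a x - b x)\<^sup>2)"
    if "a \<in> borel_measurable lebesgue" "b \<in> borel_measurable lebesgue" "\<And>x. \<bar>a x\<bar> \<le> M" "\<And>x. \<bar>b x\<bar> \<le> M"
      "\<And>x. x \<notin> S \<Longrightarrow> a x = 0" "\<And>x. x \<notin> S \<Longrightarrow> b x = 0" for a b
  proof (rule bcs(3))
    show "\<bar>(a x - b x)\<^sup>2\<bar> \<le> (2 * M)\<^sup>2" for x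
    proof -
      have "\<bar>a x - b x\<bar> \<le> 2 * M" using that(3)[of x] that(4)[of x] by linarith
      then show ?thesis using power_mono[of "\<bar>a x - b x\<bar>" "2 * M" 2] by simp
    qed
  qed (use that in auto)
  \<comment> \<open>The rate 4^-k of the minimizing sequence makes consecutive terms close at rate
    2^-k in L1, so the sequence itself converges almost everywhere and no subsequence has to be
    taken.\<close>
  have "\<exists>q\<in>B. J q < d + (1/4) ^ k" for k
  proof -
    have "Inf (J ` B) < d + (1/4) ^ k" unfolding d_def by simp
    then show ?thesis using cInf_lessD[of "J ` B"] zB by blast
  qed
  then obtain p where p: "\<And>k. p k \<in> B" "\<And>k. J (p k) < d + (1/4) ^ k" by metis
  have pB: "p k \<in> borel_measurable lebesgue" "\<bar>p k x\<bar> \<le> M" "x \<notin> S \<Longrightarrow> p k x = 0" "N (p k) \<le> C" for k x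
    using p(1)[of k] by (auto simp: B_def)
  have ip: "integrable lebesgue (p k)" for k by (rule bcs(3)[OF pB(1-3)])
  define V where "V = measure lebesgue S"
  have iS: "integrable lebesgue (indicat_real S)" by (rule integrable_indicator_compact[OF S(1)])
  have l1: "(LINT x|lebesgue. \<bar>p (Suc k) x - p k x\<bar>) \<le> (2 + V) * (1/2) ^ k" for k
  proof -
    define q where "q x = (1/2) * (p (Suc k) x + p k x)" for x
    have qB: "q \<in> B"
    proof -
      have "N q \<le> C"
        using norm_scale[OF add_mem[OF BX[OF p(1)] BX[OF p(1)]], of "1/2" "Suc k" k]
          norm_triangle[OF BX[OF p(1)] BX[OF p(1)], of "Suc k" k] pB(4)[of k] pB(4)[of "Suc k"]
        by (simp add: q_def[abs_def])
      moreover have "\<bar>q x\<bar> \<le> M" for x using pB(2)[of k x] pB(2)[of "Suc k" x] by (simp add: q_def)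
      ultimately show ?thesis using pB by (auto simp: B_def q_def[abs_def])
    qed
    have qm: "q \<in> borel_measurable lebesgue" "\<And>x. \<bar>q x\<bar> \<le> M" "\<And>x. x \<notin> S \<Longrightarrow> q x = 0" using qB by (auto simp: B_def)
    note i = int[OF pB(1) pB(1) pB(2) pB(2) pB(3) pB(3), of "Suc k" k]
      int[OF F(1) pB(1) F(2) pB(2) F(3) pB(3)] int[OF F(1) qm(1) F(2) qm(2) F(3) qm(3)]
    \<comment> \<open>The parallelogram identity with the midpoint q, which stays in the ball by
      convexity and so satisfies J q \<ge> d.\<close>
    have "(p (Suc k) x - p k x)\<^sup>2 = 2 * (F x - p (Suc k) x)\<^sup>2 + 2 * (F x - p k x)\<^sup>2 - 4 * (F x - q x)\<^sup>2" for x
      by (simp add: q_def power2_eq_square algebra_simps)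
    then have "(LINT x|lebesgue. (p (Suc k) x - p k x)\<^sup>2) = 2 * J (p (Suc k)) + 2 * J (p k) - 4 * J q"
      using i by (simp add: J_def)
    also have "\<dots> \<le> 4 * (1/4) ^ k"
    proof -
      have "(1/4::real) ^ Suc k = (1/4) ^ k / 4" "0 \<le> (1/4::real) ^ k" by simp_all
      then show ?thesis using p(2)[of k] p(2)[of "Suc k"] dJ[OF qB] by linarith
    qed
    finally have sq: "(LINT x|lebesgue. (p (Suc k) x - p k x)\<^sup>2) \<le> 4 * (1/4) ^ k" .
    \<comment> \<open>Young's inequality with weight 2^k turns the bound of order 4^-k on the
      integrated squares into an L1 bound of order 2^-k, since S has finite measure.\<close>
    have ptw: "\<bar>p (Suc k) x - p k x\<bar> \<le> (2 ^ k / 2) * (p (Suc k) x - p k x)\<^sup>2 + ((1/2) ^ k / 2) * indicat_real S x" for x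
    proof (cases "x \<in> S")
      case True
      define a where "a = \<bar>p (Suc k) x - p k x\<bar>"
      have "0 \<le> (2 ^ k / 2) * (a - (1/2) ^ k)\<^sup>2" by simp
      also have "\<dots> = (2 ^ k / 2) * a\<^sup>2 - a * (2 ^ k * (1/2)^k) + ((2 ^ k * (1/2)^k) * (1/2) ^ k) / 2"
        by (simp only: power2_eq_square) (simp add: algebra_simps)
      also have "(2::real) ^ k * (1/2) ^ k = 1" by (simp add: power_one_over)
      finally show ?thesis using True by (simp add: a_def)
    qed (use pB(3) in auto)
    have "(LINT x|lebesgue. \<bar>p (Suc k) x - p k x\<bar>)
      \<le> (LINT x|lebesgue. (2 ^ k / 2) * (p (Suc k) x - p k x)\<^sup>2 + ((1/2) ^ k / 2) * indicat_real S x)"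
    proof (rule Bochner_Integration.integral_mono)
      show "integrable lebesgue (\<lambda>x. \<bar>p (Suc k) x - p k x\<bar>)"
        using ip by auto
    qed (use i iS ptw in auto)
    also have "\<dots> = (2 ^ k / 2) * (LINT x|lebesgue. (p (Suc k) x - p k x)\<^sup>2) + ((1/2) ^ k / 2) * V"
      using i iS by (simp add: V_def)
    also have "\<dots> \<le> (2 ^ k / 2) * (4 * (1/4) ^ k) + ((1/2) ^ k / 2) * V"
      using sq by (intro add_right_mono mult_left_mono) auto
    also have "(2 ^ k / 2) * (4 * (1/4) ^ k) = 2 * (1/2::real) ^ k"
      by (simp add: power_one_over field_simps flip: power_mult_distrib)
    also have "2 * (1/2::real) ^ k + ((1/2) ^ k / 2) * V \<le> (2 + V) * (1/2) ^ k"
      by (simp add: V_def algebra_simps)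
    finally show ?thesis .
  qed
  have conv: "AE x in lebesgue. convergent (\<lambda>k. p k x)"
    by (rule AE_convergent_subseq[OF Bochner_Integration.integrable_diff[OF ip ip] l1])
  \<comment> \<open>Clamping and cutting to S make p' bounded with support in S also where the
    sequence diverges and \<open>lim\<close> is unspecified.\<close>
  define p' where "p' x = indicat_real S x * clamp_real M (lim (\<lambda>k. p k x))" for x
  have p'm: "p' \<in> borel_measurable lebesgue"
    unfolding p'_def[abs_def] using pB(1) lmeasurable_compact[OF S(1)]
    by (intro borel_measurable_times borel_measurable_indicator measurable_compose[OF _ measurable_clamp_real]
        borel_measurable_lim_metric) auto
  have p'M: "\<bar>p' x\<bar> \<le> M" for x using clamp_real(1)[OF M] M by (auto simp: p'_def indicator_def)
  have p'S: "x \<notin> S \<Longrightarrow> p' x = 0" for x by (simp add: p'_def)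
  have lim: "AE x in lebesgue. (\<lambda>k. p k x) \<longlonglongrightarrow> p' x"
    using conv
  proof eventually_elim
    case (elim x)
    then have l: "(\<lambda>k. p k x) \<longlonglongrightarrow> lim (\<lambda>k. p k x)" by (simp add: convergent_LIMSEQ_iff)
    show ?case
    proof (cases "x \<in> S")
      case True
      have "\<bar>lim (\<lambda>k. p k x)\<bar> \<le> M"
        using tendsto_rabs[OF l] pB(2) by (intro LIMSEQ_le_const2[of _ _ M]) auto
      then show ?thesis using l True by (simp add: p'_def clamp_real(5)[OF M])
    qed (use pB(3) p'S in simp)
  qed
  note p'X = bcs(1)[OF p'm p'M p'S]
  have Sm: "indicat_real S \<in> X" using indicator_compact_mem S by blast
  \<comment> \<open>Absolute continuity enters here: almost everywhere convergence under a fixed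
    bound becomes convergence in X, so the limit stays in the ball.\<close>
  have "(\<lambda>k. N (\<lambda>x. p' x - p k x)) \<longlonglongrightarrow> 0"
  proof (rule dominated_convergence)
    show "(\<lambda>x. 2 * M * indicat_real S x) \<in> X" using scale_mem[OF Sm, of "2 * M"] by simp
    show "(\<lambda>x. p' x - p k x) \<in> borel_measurable (lebesgue_on \<Omega>)" for k
      using p'm pB(1) by (intro measurable_restrict_\<Omega> borel_measurable_diff)
    have "\<bar>p' x - p k x\<bar> \<le> \<bar>2 * M * indicat_real S x\<bar>" for k x
      using p'M[of x] pB(2)[of k x] p'S[of x] pB(3)[of x k] M by (cases "x \<in> S") auto
    then show "AE x in lebesgue_on \<Omega>. \<bar>p' x - p k x\<bar> \<le> \<bar>2 * M * indicat_real S x\<bar>" for k by simp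
    have "AE x in lebesgue. (\<lambda>k. p' x - p k x) \<longlonglongrightarrow> 0"
      using lim by eventually_elim (auto intro: tendsto_eq_intros)
    then show "AE x in lebesgue_on \<Omega>. (\<lambda>k. p' x - p k x) \<longlonglongrightarrow> 0" by (rule AE_lebesgue_on_\<Omega>)
  qed
  then have "(\<lambda>k. C + N (\<lambda>x. p' x - p k x)) \<longlonglongrightarrow> C + 0" by (intro tendsto_intros)
  moreover have "N p' \<le> C + N (\<lambda>x. p' x - p k x)" for k
    using norm_triangle_diff[OF p'X BX[OF p(1)], of k] pB(4)[of k] by simp
  ultimately have p'C: "N p' \<le> C" using LIMSEQ_le_const by fastforce
  have p'B: "p' \<in> B" using p'm p'M p'S p'C by (auto simp: B_def)
  have "(\<lambda>k. J (p k)) \<longlonglongrightarrow> J p'"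
    unfolding J_def
  proof (rule integral_dominated_convergence)
    show "integrable lebesgue (\<lambda>x. (2 * M)\<^sup>2 * indicat_real S x)" using iS by simp
    show "AE x in lebesgue. (\<lambda>k. (F x - p k x)\<^sup>2) \<longlonglongrightarrow> (F x - p' x)\<^sup>2"
      using lim by eventually_elim (auto intro!: tendsto_intros)
    have "norm ((F x - p k x)\<^sup>2) \<le> (2 * M)\<^sup>2 * indicat_real S x" for k x
    proof (cases "x \<in> S")
      case True
      have "\<bar>F x - p k x\<bar> \<le> 2 * M" using F(2)[of x] pB(2)[of k x] by linarith
      then show ?thesis using power_mono[of "\<bar>F x - p k x\<bar>" "2 * M" 2] True by simp
    qed (use F(3) pB(3) in auto)
    then show "AE x in lebesgue. norm ((F x - p k x)\<^sup>2) \<le> (2 * M)\<^sup>2 * indicat_real S x" for k by simp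
  qed (use F(1) p'm pB(1) in auto)
  moreover have "(\<lambda>k. d + (1/4) ^ k) \<longlonglongrightarrow> d + 0"
    by (intro tendsto_intros LIMSEQ_power_zero) auto
  ultimately have "J p' \<le> d + 0" using p(2) by (intro LIMSEQ_le) (auto intro: less_imp_le)
  then have min: "J p' \<le> J q" if "q \<in> B" for q using dJ[OF that] by simp
  show ?thesis
  proof (intro bexI[of _ p'] conjI ballI impI p'C)
    show "p' \<in> bounded_measurable_on S"
      using p'm p'M p'S by (auto simp: bounded_measurable_on_def)
    fix q assume "q \<in> bounded_measurable_on S" "N q \<le> C"
    then obtain M' where q: "q \<in> borel_measurable lebesgue" "\<And>x. \<bar>q x\<bar> \<le> M'" "\<And>x. x \<notin> S \<Longrightarrow> q x = 0" "N q \<le> C"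
      by (auto simp: bounded_measurable_on_def)
    \<comment> \<open>Truncation at M does not raise the X norm, by the ideal property, and does not
      increase the distance to F, because |F| \<le> M.\<close>
    define q' where "q' x = clamp_real M (q x)" for x
    have q'm: "q' \<in> borel_measurable lebesgue" using q(1) by (auto simp: q'_def[abs_def])
    have qX: "q \<in> X" using bcs(1)[OF q(1-3)] by simp
    have q'B: "q' \<in> B"
      using q'm q(3,4) clamp_real[OF M] ideal(2)[OF qX measurable_restrict_\<Omega>[OF q'm]]
      by (auto simp: B_def q'_def)
    have "J q' \<le> (LINT x|lebesgue. (F x - q x)\<^sup>2)"
      unfolding J_def
    proof (rule Bochner_Integration.integral_mono)
      show "integrable lebesgue (\<lambda>x. (F x - q' x)\<^sup>2)" using int[of F q'] F q'B by (auto simp: B_def)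
      show "integrable lebesgue (\<lambda>x. (F x - q x)\<^sup>2)"
      proof (rule bcs(3))
        show "\<bar>(F x - q x)\<^sup>2\<bar> \<le> (M + M')\<^sup>2" for x
        proof -
          have "\<bar>F x - q x\<bar> \<le> M + M'" using F(2)[of x] q(2)[of x] by linarith
          then show ?thesis using power_mono[of "\<bar>F x - q x\<bar>" "M + M'" 2] by simp
        qed
      qed (use F q in auto)
      show "(F x - q' x)\<^sup>2 \<le> (F x - q x)\<^sup>2" for x
        using clamp_real(3)[OF M F(2)[of x], of "q x"] by (simp add: q'_def abs_le_square_iff)
    qed
    then show "(LINT x|lebesgue. (F x - p' x)\<^sup>2) \<le> (LINT x|lebesgue. (F x - q x)\<^sup>2)"
      using min[OF q'B] by (simp add: J_def)
  qed
qed

text \<open>The projection p satisfies a variational inequality: g = F - p pairs non-positively with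
  h - p for every h in the ball, so b is the pairing of g with p. The gap at F is the integral of
  g^2; it is positive, since F = p almost everywhere would give N F \<le> C.\<close>

lemma separating_function:
  assumes "F \<in> bounded_measurable_on S" and S: "compact S" "S \<subseteq> \<Omega>" and C: "0 \<le> C" "C < N F"
  shows "\<exists>g\<in>bounded_measurable_on S. \<exists>b. (\<forall>h\<in>bounded_measurable_on S. N h \<le> C \<longrightarrow> (LINT x|lebesgue. g x * h x) \<le> b)
    \<and> b < (LINT x|lebesgue. g x * F x)"
proof -
  obtain M0 where F0: "F \<in> borel_measurable lebesgue" "\<And>x. \<bar>F x\<bar> \<le> M0" "\<And>x. x \<notin> S \<Longrightarrow> F x = 0"
    using assms(1) by (auto simp: bounded_measurable_on_def)
  note bcs = bounded_compact_support_mem[OF _ _ _ S]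
  obtain p where pB: "p \<in> bounded_measurable_on S" and pC: "N p \<le> C" and pmin:
    "\<And>q. \<lbrakk>q \<in> bounded_measurable_on S; N q \<le> C\<rbrakk>
      \<Longrightarrow> (LINT x|lebesgue. (F x - p x)\<^sup>2) \<le> (LINT x|lebesgue. (F x - q x)\<^sup>2)"
    using nearest_point[OF assms(1) S C(1)] by blast
  obtain M1 where p1: "p \<in> borel_measurable lebesgue" "\<And>x. \<bar>p x\<bar> \<le> M1" "\<And>x. x \<notin> S \<Longrightarrow> p x = 0"
    using pB by (auto simp: bounded_measurable_on_def)
  define M where "M = max M0 M1"
  have F: "F \<in> borel_measurable lebesgue" "\<And>x. \<bar>F x\<bar> \<le> M" "\<And>x. x \<notin> S \<Longrightarrow> F x = 0"
    using F0 by (auto simp: M_def max.coboundedI1)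
  have p: "p \<in> borel_measurable lebesgue" "\<And>x. \<bar>p x\<bar> \<le> M" "\<And>x. x \<notin> S \<Longrightarrow> p x = 0" "N p \<le> C"
    using p1 pC by (auto simp: M_def max.coboundedI2)
  define g where "g x = F x - p x" for x
  have g: "g \<in> borel_measurable lebesgue" "\<And>x. \<bar>g x\<bar> \<le> 2 * M" "\<And>x. x \<notin> S \<Longrightarrow> g x = 0"
  proof -
    show "g \<in> borel_measurable lebesgue" unfolding g_def[abs_def] using F(1) p(1) by (rule borel_measurable_diff)
    show "\<bar>g x\<bar> \<le> 2 * M" for x using F(2)[of x] p(2)[of x] unfolding g_def by linarith
    show "x \<notin> S \<Longrightarrow> g x = 0" for x using F(3) p(3) by (simp add: g_def)
  qed
  have intm: "integrable lebesgue (\<lambda>x. a x * b x)"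
    if "a \<in> borel_measurable lebesgue" "b \<in> borel_measurable lebesgue" "\<And>x. \<bar>a x\<bar> \<le> A" "\<And>x. \<bar>b x\<bar> \<le> B"
      "\<And>x. x \<notin> S \<Longrightarrow> b x = 0" for a b :: "real^'n \<Rightarrow> real" and A B
  proof (rule bcs(3))
    show "(\<lambda>x. a x * b x) \<in> borel_measurable lebesgue" using that(1,2) by (rule borel_measurable_times)
    have "0 \<le> A" using that(3) abs_ge_zero order_trans by blast
    then show "\<bar>a x * b x\<bar> \<le> A * B" for x
      unfolding abs_mult using that(3)[of x] that(4)[of x] by (intro mult_mono) auto
  qed (use that(5) in simp)
  have pX: "p \<in> X" using bcs(1)[OF p(1-3)] .
  have FX: "F \<in> X" using bcs(1)[OF F] .
  define b where "b = (LINT x|lebesgue. g x * p x)"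
  have var: "(LINT x|lebesgue. g x * h x) \<le> b"
    if hB: "h \<in> bounded_measurable_on S" "N h \<le> C" for h
  proof -
    obtain M' where h: "h \<in> borel_measurable lebesgue" "\<And>x. \<bar>h x\<bar> \<le> M'" "\<And>x. x \<notin> S \<Longrightarrow> h x = 0" "N h \<le> C"
      using hB by (auto simp: bounded_measurable_on_def)
    have hX: "h \<in> X" using bcs(1)[OF h(1-3)] .
    define k where "k x = h x - p x" for x
    have k: "k \<in> borel_measurable lebesgue" "\<And>x. \<bar>k x\<bar> \<le> M' + M" "\<And>x. x \<notin> S \<Longrightarrow> k x = 0"
    proof -
      show "k \<in> borel_measurable lebesgue" unfolding k_def[abs_def] using h(1) p(1) by (rule borel_measurable_diff)
      show "\<bar>k x\<bar> \<le> M' + M" for x using h(2)[of x] p(2)[of x] unfolding k_def by linarith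
      show "x \<notin> S \<Longrightarrow> k x = 0" for x using h(3) p(3) by (simp add: k_def)
    qed
    note i = intm[OF g(1) g(1) g(2) g(2) g(3)] intm[OF g(1) k(1) g(2) k(2) k(3)] intm[OF k(1) k(1) k(2) k(2) k(3)]
    \<comment> \<open>Compare p with the point at fraction t on the segment from p to h: expanding
      the square and dividing by t bounds the first-order term by t times a constant.\<close>
    have "2 * (LINT x|lebesgue. g x * k x) \<le> t * (LINT x|lebesgue. k x * k x)" if t: "0 < t" "t \<le> 1" for t
    proof -
      define q where "q x = (1 - t) * p x + t * h x" for x
      have q: "q \<in> borel_measurable lebesgue" "\<And>x. \<bar>q x\<bar> \<le> M + M'" "\<And>x. x \<notin> S \<Longrightarrow> q x = 0" "N q \<le> C"
      proof -
        show "q \<in> borel_measurable lebesgue"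
          unfolding q_def[abs_def] using h(1) p(1) by (intro borel_measurable_add borel_measurable_times) auto
        show "\<bar>q x\<bar> \<le> M + M'" for x
        proof -
          have "\<bar>q x\<bar> \<le> (1 - t) * \<bar>p x\<bar> + t * \<bar>h x\<bar>"
            unfolding q_def using t abs_triangle_ineq[of "(1 - t) * p x" "t * h x"] by (simp add: abs_mult)
          also have "\<dots> \<le> 1 * \<bar>p x\<bar> + 1 * \<bar>h x\<bar>" using t by (intro add_mono mult_right_mono) auto
          finally show ?thesis using p(2)[of x] h(2)[of x] by linarith
        qed
        show "x \<notin> S \<Longrightarrow> q x = 0" for x using h(3) p(3) by (simp add: q_def)
        have "N q \<le> (1 - t) * N p + t * N h"
          unfolding q_def[abs_def]
          using norm_triangle[OF scale_mem[OF pX, of "1 - t"] scale_mem[OF hX, of t]]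
            norm_scale[OF pX, of "1 - t"] norm_scale[OF hX, of t] t by simp
        also have "\<dots> \<le> (1 - t) * C + t * C" using t p(4) h(4) by (intro add_mono mult_left_mono) auto
        finally show "N q \<le> C" by (simp add: algebra_simps)
      qed
      have "(LINT x|lebesgue. g x * g x) \<le> (LINT x|lebesgue. (F x - q x)\<^sup>2)"
      proof -
        have "q \<in> bounded_measurable_on S" using q by (auto simp: bounded_measurable_on_def)
        then show ?thesis using pmin[OF _ q(4)] by (simp add: g_def power2_eq_square)
      qed
      also have "(\<lambda>x. (F x - q x)\<^sup>2) = (\<lambda>x. g x * g x - 2 * t * (g x * k x) + t\<^sup>2 * (k x * k x))"
        by (simp add: g_def q_def k_def power2_eq_square algebra_simps fun_eq_iff)
      also have "(LINT x|lebesgue. g x * g x - 2 * t * (g x * k x) + t\<^sup>2 * (k x * k x))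
        = (LINT x|lebesgue. g x * g x) - 2 * t * (LINT x|lebesgue. g x * k x) + t\<^sup>2 * (LINT x|lebesgue. k x * k x)"
        using i by simp
      finally have "t * (2 * (LINT x|lebesgue. g x * k x)) \<le> t * (t * (LINT x|lebesgue. k x * k x))"
        by (simp add: power2_eq_square algebra_simps)
      then show ?thesis using t by simp
    qed
    then have "2 * (LINT x|lebesgue. g x * k x) \<le> 0" by (rule real_le_0_of_le_mult)
    moreover have "(LINT x|lebesgue. g x * k x) = (LINT x|lebesgue. g x * h x) - b"
      unfolding b_def k_def right_diff_distrib
      using intm[OF g(1) h(1) g(2) h(2) h(3)] intm[OF g(1) p(1) g(2) p(2) p(3)] by simp
    ultimately show ?thesis by simp
  qed
  have "(LINT x|lebesgue. g x * F x) = (LINT x|lebesgue. g x * g x + g x * p x)"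
    by (simp add: g_def algebra_simps)
  also have "\<dots> = (LINT x|lebesgue. g x * g x) + b"
    unfolding b_def using intm[OF g(1) g(1) g(2) g(2) g(3)] intm[OF g(1) p(1) g(2) p(2) p(3)] by simp
  finally have Fg: "(LINT x|lebesgue. g x * F x) = (LINT x|lebesgue. g x * g x) + b" .
  have "(LINT x|lebesgue. g x * g x) \<noteq> 0"
  proof
    assume "(LINT x|lebesgue. g x * g x) = 0"
    then have "AE x in lebesgue. g x * g x = 0"
      using integral_nonneg_eq_0_iff_AE[OF intm[OF g(1) g(1) g(2) g(2) g(3)]] by simp
    then have "AE x in lebesgue. F x = p x" by eventually_elim (simp add: g_def)
    then have "N F = N p"
      by (intro norm_cong_AE(2)[OF pX measurable_restrict_\<Omega>[OF F(1)]] AE_lebesgue_on_\<Omega>)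
    then show False using p(4) C by simp
  qed
  moreover have "0 \<le> (LINT x|lebesgue. g x * g x)" by (intro integral_nonneg_AE) auto
  ultimately have "0 < (LINT x|lebesgue. g x * g x)" by linarith
  moreover have "g \<in> bounded_measurable_on S" using g by (auto simp: bounded_measurable_on_def)
  ultimately show ?thesis using var Fg by (intro bexI[of _ g] exI[of _ b]) auto
qed

lemma nn_integral_lebesgue_on_\<Omega>:
  fixes f :: "real^'n \<Rightarrow> real"
  assumes "\<And>x. x \<notin> \<Omega> \<Longrightarrow> f x = 0"
  shows "(\<integral>\<^sup>+x. ennreal \<bar>f x\<bar> \<partial>lebesgue_on \<Omega>) = (\<integral>\<^sup>+x. ennreal \<bar>f x\<bar> \<partial>lebesgue)"
  using assms by (auto simp: nn_integral_restrict_space indicator_def intro!: nn_integral_cong)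

text \<open>A one-sided bound on pairings with bounded functions controls absolute values against
  all of X: an arbitrary u is truncated, cut to S and given the sign of g, and monotone convergence
  removes the truncation.\<close>

lemma associate_norm_le:
  assumes "g \<in> bounded_measurable_on S" and S: "compact S" "S \<subseteq> \<Omega>" and C: "0 < C"
    and le: "\<And>h. \<lbrakk>h \<in> bounded_measurable_on S; N h \<le> C\<rbrakk> \<Longrightarrow> (LINT x|lebesgue. g x * h x) \<le> b"
  shows "g \<in> X'" "N' g \<le> ennreal (b / C)"
proof -
  obtain B where g: "g \<in> borel_measurable lebesgue" "\<And>x. \<bar>g x\<bar> \<le> B" "\<And>x. x \<notin> S \<Longrightarrow> g x = 0"
    using assms(1) by (auto simp: bounded_measurable_on_def)
  note bcs = bounded_compact_support_mem[OF _ _ _ S]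
  have S': "S \<in> sets lebesgue" using lmeasurable_compact[OF S(1)] by auto
  have *: "(\<integral>\<^sup>+x. ennreal \<bar>u x * g x\<bar> \<partial>lebesgue_on \<Omega>) \<le> ennreal (b / C)" if u: "u \<in> X" "N u = 1" for u
  proof -
    define v where "v x = \<bar>indicat_real S x * u x\<bar>" for x
    have vm: "v \<in> borel_measurable lebesgue"
      unfolding v_def[abs_def] using measurable_extend[OF mem_X_measurable[OF u(1)] S' S(2)] by (rule borel_measurable_abs)
    have bound: "(\<integral>\<^sup>+x. ennreal (min (v x) (real m) * \<bar>g x\<bar>) \<partial>lebesgue) \<le> ennreal (b / C)" for m
    proof -
      \<comment> \<open>Since N u = 1, the factor C scales u to the ball of radius C; dividing it
        out again gives the b / C of the claim.\<close>
      define h where "h x = C * (min (v x) (real m) * sgn (g x))" for x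
      have h: "h \<in> borel_measurable lebesgue" "\<And>x. \<bar>h x\<bar> \<le> C * m" "\<And>x. x \<notin> S \<Longrightarrow> h x = 0"
      proof -
        show "h \<in> borel_measurable lebesgue" unfolding h_def[abs_def] using vm g(1) by measurable
        show "\<bar>h x\<bar> \<le> C * m" for x
          using C mult_mono[of "min (v x) (real m)" "real m" "\<bar>sgn (g x)\<bar>" 1]
          by (auto simp: h_def abs_mult v_def abs_sgn_eq)
        show "x \<notin> S \<Longrightarrow> h x = 0" for x by (simp add: h_def v_def)
      qed
      have "N h \<le> N (\<lambda>x. C * u x)"
      proof (rule ideal(2)[OF scale_mem[OF u(1)] measurable_restrict_\<Omega>[OF h(1)]])
        fix x
        have "min (v x) (real m) * \<bar>sgn (g x)\<bar> \<le> \<bar>u x\<bar>"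
          by (auto simp: v_def abs_sgn_eq indicator_def)
        moreover have "\<bar>h x\<bar> = C * (min (v x) (real m) * \<bar>sgn (g x)\<bar>)"
          using C by (simp add: h_def abs_mult v_def)
        ultimately show "\<bar>h x\<bar> \<le> \<bar>C * u x\<bar>" using C by (simp add: abs_mult)
      qed
      also have "\<dots> = C" using norm_scale[OF u(1), of C] u(2) C by simp
      finally have Nh: "N h \<le> C" .
      have eq: "g x * h x = C * (min (v x) (real m) * \<bar>g x\<bar>)" for x
        by (simp add: h_def sgn_real_def)
      have int: "integrable lebesgue (\<lambda>x. min (v x) (real m) * \<bar>g x\<bar>)"
      proof (rule bcs(3))
        show "(\<lambda>x. min (v x) (real m) * \<bar>g x\<bar>) \<in> borel_measurable lebesgue" using vm g(1) by measurable
        show "\<bar>min (v x) (real m) * \<bar>g x\<bar>\<bar> \<le> real m * B" for x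
          unfolding abs_mult using g(2)[of x] by (intro mult_mono) (auto simp: v_def)
      qed (use g(3) in simp)
      have "C * (LINT x|lebesgue. min (v x) (real m) * \<bar>g x\<bar>) \<le> b"
        using le[OF _ Nh] h by (simp add: eq bounded_measurable_on_def) blast
      then have "(LINT x|lebesgue. min (v x) (real m) * \<bar>g x\<bar>) \<le> b / C" using C by (simp add: field_simps)
      then show ?thesis
        using nn_integral_eq_integral[OF int] by (simp add: v_def ennreal_leI)
    qed
    have "(\<integral>\<^sup>+x. ennreal \<bar>u x * g x\<bar> \<partial>lebesgue_on \<Omega>) = (\<integral>\<^sup>+x. ennreal \<bar>u x * g x\<bar> \<partial>lebesgue)"
      using g(3) S(2) by (intro nn_integral_lebesgue_on_\<Omega>) auto
    also have "\<dots> = (\<integral>\<^sup>+x. (SUP m. ennreal (min (v x) (real m) * \<bar>g x\<bar>)) \<partial>lebesgue)"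
    proof (rule nn_integral_cong)
      fix x
      obtain m where m: "v x \<le> real m" using real_arch_simple by blast
      have "(SUP m. ennreal (min (v x) (real m) * \<bar>g x\<bar>)) = ennreal (v x * \<bar>g x\<bar>)"
      proof (rule antisym)
        show "(SUP m. ennreal (min (v x) (real m) * \<bar>g x\<bar>)) \<le> ennreal (v x * \<bar>g x\<bar>)"
          by (intro SUP_least ennreal_leI mult_right_mono) auto
        have "min (v x) (real m) = v x" using m by simp
        then show "ennreal (v x * \<bar>g x\<bar>) \<le> (SUP m. ennreal (min (v x) (real m) * \<bar>g x\<bar>))"
          by (intro SUP_upper2[of m]) auto
      qed
      also have "v x * \<bar>g x\<bar> = \<bar>u x * g x\<bar>" using g(3)[of x] by (cases "x \<in> S") (auto simp: v_def abs_mult)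
      finally show "ennreal \<bar>u x * g x\<bar> = (SUP m. ennreal (min (v x) (real m) * \<bar>g x\<bar>))" by simp
    qed
    also have "\<dots> = (SUP m. \<integral>\<^sup>+x. ennreal (min (v x) (real m) * \<bar>g x\<bar>) \<partial>lebesgue)"
    proof (rule nn_integral_monotone_convergence_SUP)
      show "incseq (\<lambda>m x. ennreal (min (v x) (real m) * \<bar>g x\<bar>))"
        by (intro monoI le_funI ennreal_leI mult_right_mono) auto
      show "(\<lambda>x. ennreal (min (v x) (real m) * \<bar>g x\<bar>)) \<in> borel_measurable lebesgue" for m
        using vm g(1) by measurable
    qed
    also have "\<dots> \<le> ennreal (b / C)" by (intro SUP_least bound)
    finally show ?thesis .
  qed
  then show "N' g \<le> ennreal (b / C)"
    unfolding associate_norm_def by (intro SUP_least) auto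
  show "g \<in> X'"
    unfolding associate_space_def L0_def
  proof (intro CollectI conjI ballI)
    show gm: "g \<in> borel_measurable (lebesgue_on \<Omega>)" using measurable_restrict_\<Omega>[OF g(1)] .
    fix f assume f: "f \<in> X"
    have "(\<integral>\<^sup>+x. ennreal \<bar>f x * g x\<bar> \<partial>lebesgue_on \<Omega>) \<le> ennreal (N f) * N' g"
      by (rule Hoelder[OF f gm])
    also have "\<dots> \<le> ennreal (N f) * ennreal (b / C)"
      using \<open>N' g \<le> ennreal (b / C)\<close> by (rule mult_left_mono) simp
    also have "\<dots> < \<infinity>" by (simp add: ennreal_mult_less_top)
    finally have "(\<integral>\<^sup>+x. ennreal \<bar>f x * g x\<bar> \<partial>lebesgue_on \<Omega>) < \<infinity>" .
    moreover have "(\<lambda>x. f x * g x) \<in> borel_measurable (lebesgue_on \<Omega>)"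
      using mem_X_measurable[OF f] gm by (rule borel_measurable_times)
    ultimately show "integrable (lebesgue_on \<Omega>) (\<lambda>x. f x * g x)"
      by (simp add: integrable_iff_bounded)
  qed
qed

text \<open>If N F exceeded C, the separating g would have \<open>N' g\<close> at most b / C, and
  the assumed bound would make its pairing with F at most b, against the strict separation.\<close>

lemma dual_norm_bound:
  assumes FB: "F \<in> bounded_measurable_on S" and S: "compact S" "S \<subseteq> \<Omega>" and C: "0 < C"
    and bound: "\<And>g. g \<in> X' \<Longrightarrow>
      (\<integral>\<^sup>+x. ennreal \<bar>F x * g x\<bar> \<partial>lebesgue_on \<Omega>) \<le> ennreal C * N' g"
  shows "N F \<le> C"
proof (rule ccontr)
  assume "\<not> N F \<le> C"
  then have CF: "C < N F" by simp
  obtain g b where gB: "g \<in> bounded_measurable_on S"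
    and le: "\<And>h. \<lbrakk>h \<in> bounded_measurable_on S; N h \<le> C\<rbrakk> \<Longrightarrow> (LINT x|lebesgue. g x * h x) \<le> b"
    and gt: "b < (LINT x|lebesgue. g x * F x)"
    using separating_function[OF FB S less_imp_le[OF C] CF] by blast
  then have g: "g \<in> borel_measurable lebesgue" "\<And>x. x \<notin> S \<Longrightarrow> g x = 0"
    by (auto simp: bounded_measurable_on_def)
  note a = associate_norm_le[OF gB S C le]
  have "ennreal (LINT x|lebesgue. g x * F x) \<le> (\<integral>\<^sup>+x. ennreal \<bar>F x * g x\<bar> \<partial>lebesgue)"
  proof (cases "integrable lebesgue (\<lambda>x. g x * F x)")
    case True
    have "ennreal (LINT x|lebesgue. g x * F x) \<le> ennreal (norm (LINT x|lebesgue. g x * F x))"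
      by (intro ennreal_leI) simp
    also have "\<dots> \<le> (\<integral>\<^sup>+x. norm (g x * F x) \<partial>lebesgue)" using True by (rule integral_norm_bound_ennreal)
    finally show ?thesis by (simp add: mult.commute)
  qed (simp add: not_integrable_integral_eq)
  also have "\<dots> = (\<integral>\<^sup>+x. ennreal \<bar>F x * g x\<bar> \<partial>lebesgue_on \<Omega>)"
    using g(2) S(2) by (intro nn_integral_lebesgue_on_\<Omega>[symmetric]) auto
  also have "\<dots> \<le> ennreal C * ennreal (b / C)"
    by (rule order_trans[OF bound[OF a(1)] mult_left_mono[OF a(2)]]) auto
  also have "\<dots> = ennreal b" using C by (simp flip: ennreal_mult')
  finally have "ennreal (LINT x|lebesgue. g x * F x) \<le> ennreal b" .
  \<comment> \<open>\<open>ennreal\<close> sends negative reals to 0, so the inequality can be read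
    in the reals only with b \<ge> 0; testing with h = 0 provides this.\<close>
  moreover have "0 \<le> b" using le[of "\<lambda>x. 0"] C by (auto simp: bounded_measurable_on_def)
  ultimately show False using gt by (simp add: ennreal_le_iff)
qed

end

section \<open>Uniform boundedness of mollification\<close>

definition grid_index :: "real \<Rightarrow> real^'n::finite \<Rightarrow> 'n \<Rightarrow> int" where
  "grid_index s x i = \<lfloor>x $ i / s\<rfloor>"

text \<open>The grid cell with index z enlarged by s on every side. It contains the ball of radius s
  about each point of the cell, hence everything that a kernel of scale s sees from there.\<close>

definition grid_cube :: "real \<Rightarrow> ('n::finite \<Rightarrow> int) \<Rightarrow> (real^'n) set" where
  "grid_cube s z = cbox (\<chi> i. s * z i - s) ((\<chi> i. s * z i - s) + vec (3 * s))"

lemma mem_grid_cube: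
  "x \<in> grid_cube s z \<longleftrightarrow> (\<forall>i. s * z i - s \<le> x $ i \<and> x $ i \<le> s * z i + 2 * s)"
  by (auto simp: grid_cube_def mem_box_cart algebra_simps)

lemma grid_index_bounds:
  assumes "0 < s" shows "s * grid_index s x i \<le> x $ i" "x $ i < s * grid_index s x i + s"
proof -
  have "real_of_int (grid_index s x i) \<le> x $ i / s" "x $ i / s < grid_index s x i + 1"
    unfolding grid_index_def by linarith+
  then show "s * grid_index s x i \<le> x $ i" "x $ i < s * grid_index s x i + s"
    using assms by (simp_all add: field_simps)
qed

lemma near_mem_grid_cube:
  assumes "0 < s" "norm (x - y) \<le> s" shows "y \<in> grid_cube s (grid_index s x)"
  unfolding mem_grid_cube
proof
  fix i
  have "\<bar>x $ i - y $ i\<bar> \<le> s" using component_le_norm_cart[of "x - y" i] assms(2) by simp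
  then show "s * grid_index s x i - s \<le> y $ i \<and> y $ i \<le> s * grid_index s x i + 2 * s"
    using grid_index_bounds[OF assms(1), of x i] by linarith
qed

text \<open>
  The closed cubes of side $3s$ around grid cells at distance $3s$ still touch, hence residues
  modulo 4 instead of 3.
\<close>

lemma grid_cube_disjoint:
  fixes z z' :: "'n::finite \<Rightarrow> int"
  assumes "0 < s" "z \<noteq> z'" "\<And>i. z i mod 4 = z' i mod 4"
  shows "grid_cube s z \<inter> grid_cube s z' = {}"
proof -
  have *: "False" if "x \<in> grid_cube s z" "x \<in> grid_cube s z'" "z i < z' i" "\<And>i. z i mod 4 = z' i mod 4" for x i and z z' :: "'n \<Rightarrow> int"
  proof -
    have "4 dvd z' i - z i" using that(4)[of i, symmetric] by (simp add: mod_eq_dvd_iff)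
    then have "z i + 4 \<le> z' i" using that(3) zdvd_imp_le[of 4 "z' i - z i"] by simp
    then have "real_of_int (z i) + 4 \<le> real_of_int (z' i)" by linarith
    then have "s * (z i + 4) \<le> s * z' i" using assms(1) by (intro mult_left_mono) auto
    moreover have "x $ i \<le> s * z i + 2 * s" "s * z' i - s \<le> x $ i" using that(1,2) by (auto simp: mem_grid_cube)
    ultimately show False using assms(1) by (simp add: algebra_simps)
  qed
  obtain i where "z i < z' i \<or> z' i < z i" using assms(2) by (meson ext linorder_neqE)
  then show ?thesis using *[of _ z z' i] *[of _ z' z i] assms(3) by auto
qed

lemma grid_cube_nonempty: "0 < s \<Longrightarrow> grid_cube s z \<noteq> {}"
proof -
  assume "0 < s"
  then have "(\<chi> i. s * z i) \<in> grid_cube s z" by (simp add: mem_grid_cube)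
  then show ?thesis by blast
qed

lemma finite_grid_cubes_meeting:
  fixes K :: "(real^'n::finite) set"
  assumes "0 < s" "bounded K" shows "finite {z. grid_cube s z \<inter> K \<noteq> {}}"
proof -
  obtain R where R: "\<And>x. x \<in> K \<Longrightarrow> norm x \<le> R" using assms(2) by (auto simp: bounded_iff)
  define m where "m = \<lceil>R / s\<rceil> + 2"
  have "{z. grid_cube s z \<inter> K \<noteq> {}} \<subseteq> PiE UNIV (\<lambda>_::'n. {-m..m})"
  proof
    fix z :: "'n \<Rightarrow> int" assume "z \<in> {z. grid_cube s z \<inter> K \<noteq> {}}"
    then obtain x where x: "x \<in> grid_cube s z" "x \<in> K" by blast
    have "z i \<in> {-m..m}" for i
    proof -
      have "\<bar>x $ i\<bar> \<le> R" using R[OF x(2)] component_le_norm_cart[of x i] by linarith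
      moreover have "s * z i - s \<le> x $ i" "x $ i \<le> s * z i + 2 * s" using x(1) by (auto simp: mem_grid_cube)
      ultimately have "s * z i \<le> R + s" "- R - 2 * s \<le> s * z i" by linarith+
      then have "real_of_int (z i) \<le> R / s + 1" "- (R / s) - 2 \<le> real_of_int (z i)"
        using assms(1) by (simp_all add: field_simps)
      moreover have "R / s \<le> real_of_int \<lceil>R / s\<rceil>" by simp
      moreover have "real_of_int m = real_of_int \<lceil>R / s\<rceil> + 2" "real_of_int (- m) = - real_of_int m"
        by (simp_all add: m_def)
      ultimately have "real_of_int (z i) \<le> real_of_int m" "real_of_int (- m) \<le> real_of_int (z i)"
        by linarith+
      then show ?thesis by (simp only: of_int_le_iff atLeastAtMost_iff)
    qed
    then show "z \<in> PiE UNIV (\<lambda>_::'n. {-m..m})" by auto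
  qed
  moreover have "finite (PiE UNIV (\<lambda>_::'n. {-m..m}))" by (intro finite_PiE) auto
  ultimately show ?thesis by (rule finite_subset)
qed

section \<open>Pairing a mollification with the associate space\<close>

context mollifiable_space begin

text \<open>The radius is n times the side 3s, a bound for the diameter of the cube, so a grid cube
  that meets K cannot leave \<Omega>.\<close>

lemma grid_cube_in:
  fixes s :: real
  assumes "0 < s" "\<And>x. x \<in> K \<Longrightarrow> cball x (CARD('n) * (3 * s)) \<subseteq> \<Omega>" "grid_cube s z \<inter> K \<noteq> {}"
  shows "grid_cube s z \<in> cubes_in \<Omega>"
proof -
  obtain x where x: "x \<in> grid_cube s z" "x \<in> K" using assms(3) by blast
  have "grid_cube s z \<subseteq> \<Omega>"
  proof
    fix y assume "y \<in> grid_cube s z"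
    then have "norm (x - y) \<le> CARD('n) * (3 * s)"
      using x(1) unfolding grid_cube_def by (intro norm_diff_cube_le)
    then show "y \<in> \<Omega>" using assms(2)[OF x(2)] by (auto simp: dist_norm)
  qed
  then show ?thesis using assms(1) unfolding cubes_in_def grid_cube_def by (auto intro!: exI[of _ "3 * s"])
qed

lemma mult_indicator_mem:
  assumes "f \<in> X" "Q \<in> sets lebesgue" shows "(\<lambda>x. indicat_real Q x * f x) \<in> X"
  using assms by (intro mult_bounded_mem[where B=1] measurable_restrict_\<Omega>) (auto simp: indicator_def)

text \<open>In each integral the indicator of Q is inserted a second time as the other Hoelder
  factor: one integral yields \<open>N' (indicat_real Q)\<close>, the other
  \<open>N (indicat_real Q)\<close>, and their product is the Muckenhoupt quantity.\<close>

lemma cube_product_bound: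
  assumes Q: "Q \<in> cubes_in \<Omega>" and f: "f \<in> X" and g: "g \<in> X'"
    and K: "\<And>Q. Q \<in> cubes_in \<Omega> \<Longrightarrow>
      ennreal (N (indicat_real Q)) * N' (indicat_real Q) \<le> ennreal K * emeasure lebesgue Q"
  shows "(\<integral>\<^sup>+x. ennreal \<bar>indicat_real Q x * f x\<bar> \<partial>lebesgue_on \<Omega>) * (\<integral>\<^sup>+x. ennreal \<bar>indicat_real Q x * g x\<bar> \<partial>lebesgue_on \<Omega>)
    \<le> ennreal K * emeasure lebesgue Q * (ennreal (N (\<lambda>x. indicat_real Q x * f x)) * N' (\<lambda>x. indicat_real Q x * g x))"
proof -
  have Qs: "Q \<in> sets lebesgue" using cube_measure(3)[OF Q] .
  have Qm: "indicat_real Q \<in> borel_measurable (lebesgue_on \<Omega>)"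
    using Qs by (intro measurable_restrict_\<Omega> borel_measurable_indicator)
  have gm: "(\<lambda>x. indicat_real Q x * g x) \<in> borel_measurable (lebesgue_on \<Omega>)"
    using g Qm by (intro borel_measurable_times) (auto simp: associate_space_def L0_def)
  have "(\<integral>\<^sup>+x. ennreal \<bar>indicat_real Q x * f x\<bar> \<partial>lebesgue_on \<Omega>) = (\<integral>\<^sup>+x. ennreal \<bar>(indicat_real Q x * f x) * indicat_real Q x\<bar> \<partial>lebesgue_on \<Omega>)"
    by (intro nn_integral_cong) (auto simp: indicator_def)
  also have "\<dots> \<le> ennreal (N (\<lambda>x. indicat_real Q x * f x)) * N' (indicat_real Q)"
    by (rule Hoelder[OF mult_indicator_mem[OF f Qs] Qm])
  finally have 1: "(\<integral>\<^sup>+x. ennreal \<bar>indicat_real Q x * f x\<bar> \<partial>lebesgue_on \<Omega>) \<le> \<dots>" .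
  have "(\<integral>\<^sup>+x. ennreal \<bar>indicat_real Q x * g x\<bar> \<partial>lebesgue_on \<Omega>) = (\<integral>\<^sup>+x. ennreal \<bar>indicat_real Q x * (indicat_real Q x * g x)\<bar> \<partial>lebesgue_on \<Omega>)"
    by (intro nn_integral_cong) (auto simp: indicator_def)
  also have "\<dots> \<le> ennreal (N (indicat_real Q)) * N' (\<lambda>x. indicat_real Q x * g x)"
    by (rule Hoelder[OF cube_mem(1)[OF Q] gm])
  finally have 2: "(\<integral>\<^sup>+x. ennreal \<bar>indicat_real Q x * g x\<bar> \<partial>lebesgue_on \<Omega>) \<le> \<dots>" .
  have "(\<integral>\<^sup>+x. ennreal \<bar>indicat_real Q x * f x\<bar> \<partial>lebesgue_on \<Omega>) * (\<integral>\<^sup>+x. ennreal \<bar>indicat_real Q x * g x\<bar> \<partial>lebesgue_on \<Omega>)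
    \<le> (ennreal (N (\<lambda>x. indicat_real Q x * f x)) * N' (indicat_real Q)) *
      (ennreal (N (indicat_real Q)) * N' (\<lambda>x. indicat_real Q x * g x))"
    using 1 2 by (rule mult_mono) auto
  also have "\<dots> = (ennreal (N (indicat_real Q)) * N' (indicat_real Q)) *
      (ennreal (N (\<lambda>x. indicat_real Q x * f x)) * N' (\<lambda>x. indicat_real Q x * g x))"
    by (simp only: ac_simps)
  also have "\<dots> \<le> (ennreal K * emeasure lebesgue Q) *
      (ennreal (N (\<lambda>x. indicat_real Q x * f x)) * N' (\<lambda>x. indicat_real Q x * g x))"
    by (rule mult_right_mono[OF K[OF Q]]) simp
  finally show ?thesis .
qed

text \<open>The enlarged cubes overlap, so they are sorted by the residues of their indices modulo
  4. There are 4^n residue vectors, and the cubes of one class are disjoint.\<close>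

lemma grid_sum_bound:
  assumes s: "0 < s" and Z: "finite Z" "\<And>z. z \<in> Z \<Longrightarrow> grid_cube s z \<in> cubes_in \<Omega>"
    and f: "f \<in> X" and g: "g \<in> X'"
    and G: "\<And>\<Q>. \<Q> \<subseteq> cubes_in \<Omega> \<and> disjoint \<Q> \<Longrightarrow>
      (\<Sum>\<^sub>\<infinity>Q\<in>\<Q>. ennreal (N (\<lambda>x. indicat_real Q x * f x)) * N' (\<lambda>x. indicat_real Q x * g x))
        \<le> ennreal G * ennreal (N f) * N' g"
  shows "(\<Sum>z\<in>Z. ennreal (N (\<lambda>x. indicat_real (grid_cube s z) x * f x)) * N' (\<lambda>x. indicat_real (grid_cube s z) x * g x))
    \<le> of_nat (4 ^ CARD('n)) * (ennreal G * ennreal (N f) * N' g)"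
proof -
  define T where "T Q = ennreal (N (\<lambda>x. indicat_real Q x * f x)) * N' (\<lambda>x. indicat_real Q x * g x)" for Q
  define res where "res z = (\<lambda>i. z i mod 4)" for z :: "'n \<Rightarrow> int"
  define R where "R = PiE (UNIV :: 'n set) (\<lambda>_. {0..3::int})"
  have R: "finite R" "card R = 4 ^ CARD('n)" by (auto simp: R_def card_PiE intro!: finite_PiE)
  have resR: "res ` Z \<subseteq> R"
  proof -
    have "0 \<le> k mod 4 \<and> k mod 4 \<le> 3" for k :: int by presburger
    then show ?thesis by (auto simp: res_def R_def)
  qed
  have "(\<Sum>z\<in>Z. T (grid_cube s z)) = (\<Sum>r\<in>R. \<Sum>z\<in>{z\<in>Z. res z = r}. T (grid_cube s z))"
    by (rule sum.group[OF Z(1) R(1) resR, symmetric])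
  also have "\<dots> \<le> (\<Sum>r\<in>R. ennreal G * ennreal (N f) * N' g)"
  proof (rule sum_mono)
    fix r assume "r \<in> R"
    define Z' where "Z' = {z\<in>Z. res z = r}"
    have dis: "grid_cube s z \<inter> grid_cube s z' = {}" if "z \<in> Z'" "z' \<in> Z'" "z \<noteq> z'" for z z'
      using that by (intro grid_cube_disjoint s) (auto simp: Z'_def res_def fun_eq_iff)
    \<comment> \<open>Non-empty disjoint cubes are distinct, so the sum over indices equals the sum
      over the set of cubes, which is what property G bounds.\<close>
    have inj: "inj_on (grid_cube s) Z'"
      using dis grid_cube_nonempty[OF s] by (metis inf.idem inj_onI)
    have fin: "finite Z'" using Z(1) by (simp add: Z'_def)
    have "(\<Sum>z\<in>Z'. T (grid_cube s z)) = (\<Sum>Q\<in>grid_cube s ` Z'. T Q)"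
      using inj by (simp add: sum.reindex)
    also have "\<dots> = (\<Sum>\<^sub>\<infinity>Q\<in>grid_cube s ` Z'. T Q)" using fin by simp
    also have "\<dots> \<le> ennreal G * ennreal (N f) * N' g"
      unfolding T_def
    proof (rule G, intro conjI)
      show "grid_cube s ` Z' \<subseteq> cubes_in \<Omega>" using Z(2) by (auto simp: Z'_def)
      show "disjoint (grid_cube s ` Z')" using dis by (auto simp: disjoint_def)
    qed
    finally show "(\<Sum>z\<in>{z\<in>Z. res z = r}. T (grid_cube s z)) \<le> ennreal G * ennreal (N f) * N' g"
      by (simp add: Z'_def)
  qed
  also have "\<dots> = of_nat (4 ^ CARD('n)) * (ennreal G * ennreal (N f) * N' g)"
    by (simp only: sum_constant R(2))
  finally show ?thesis by (simp add: T_def)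
qed

text \<open>On a cell the mollification is at most A / s^n times the integral of |h| over the
  enlarged cube. Against the measure (3s)^n of that cube this leaves A 3^n, so s cancels; B is the
  Muckenhoupt constant and 4^n G comes from the residue classes.\<close>

lemma convolution_pairing_bound:
  fixes s :: real
  assumes s: "0 < s" and m: "mollifier A s \<phi>" and h: "h \<in> X" "integrable lebesgue h" "\<And>x. x \<notin> K \<Longrightarrow> h x = 0"
    and K: "compact K" "\<And>x. x \<in> K \<Longrightarrow> cball x (CARD('n) * (3 * s)) \<subseteq> \<Omega>" and A: "0 < A"
    and g: "g \<in> X'"
    and B: "0 \<le> B" "\<And>Q. Q \<in> cubes_in \<Omega> \<Longrightarrow>
      ennreal (N (indicat_real Q)) * N' (indicat_real Q) \<le> ennreal B * emeasure lebesgue Q"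
    and G: "0 \<le> G" "\<And>\<Q>. \<Q> \<subseteq> cubes_in \<Omega> \<and> disjoint \<Q> \<Longrightarrow>
      (\<Sum>\<^sub>\<infinity>Q\<in>\<Q>. ennreal (N (\<lambda>x. indicat_real Q x * h x)) * N' (\<lambda>x. indicat_real Q x * g x))
        \<le> ennreal G * ennreal (N h) * N' g"
  shows "(\<integral>\<^sup>+x. ennreal \<bar>convolution \<phi> h x * g x\<bar> \<partial>lebesgue_on \<Omega>)
    \<le> ennreal (A * B * 3 ^ CARD('n) * 4 ^ CARD('n) * G * N h) * N' g"
proof -
  let ?T = "\<lambda>z. ennreal (N (\<lambda>x. indicat_real (grid_cube s z) x * h x)) * N' (\<lambda>x. indicat_real (grid_cube s z) x * g x)"
  define n where "n = CARD('n)"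
  \<comment> \<open>The other cubes miss the set K that carries h, and compactness leaves finitely
    many.\<close>
  define Z where "Z = {z. grid_cube s z \<inter> K \<noteq> {}}"
  have Z: "finite Z" unfolding Z_def using s compact_imp_bounded[OF K(1)] by (rule finite_grid_cubes_meeting)
  have ZQ: "grid_cube s z \<in> cubes_in \<Omega>" if "z \<in> Z" for z
    using that K(2) s by (intro grid_cube_in) (auto simp: Z_def)
  have Qs: "grid_cube s z \<in> sets lebesgue" for z :: "'n \<Rightarrow> int" by (simp add: grid_cube_def)
  have gm: "g \<in> borel_measurable (lebesgue_on \<Omega>)" using g by (simp add: associate_space_def L0_def)
  define I where "I f z = (\<integral>\<^sup>+x. ennreal \<bar>indicat_real (grid_cube s z) x * f x\<bar> \<partial>lebesgue_on \<Omega>)" for f :: "real^'n \<Rightarrow> real" and z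
  have K\<Omega>: "K \<subseteq> \<Omega>" using K(2) s by fastforce
  have Fb: "ennreal \<bar>convolution \<phi> h x\<bar> \<le> ennreal (A / s ^ n) * I h (grid_index s x)" for x
  proof -
    have "ennreal \<bar>convolution \<phi> h x\<bar> \<le> (\<integral>\<^sup>+y. norm (\<phi> (x - y) * h y) \<partial>lebesgue)"
      unfolding convolution_def real_norm_def[symmetric] using m h(2)
      by (intro integral_norm_bound_ennreal integrable_convolution[where \<Omega>=UNIV]) (auto simp: mollifier_def)
    also have "\<dots> \<le> (\<integral>\<^sup>+y. ennreal (A / s ^ n) * ennreal \<bar>indicat_real (grid_cube s (grid_index s x)) y * h y\<bar> \<partial>lebesgue)"
    proof (rule nn_integral_mono)
      fix y
      have "norm (\<phi> (x - y) * h y) \<le> (A / s ^ n) * \<bar>indicat_real (grid_cube s (grid_index s x)) y * h y\<bar>"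
      proof (cases "s \<le> norm (x - y)")
        case True
        then have "\<phi> (x - y) = 0" using m by (simp add: mollifier_def)
        then show ?thesis using A s by simp
      next
        case False
        then have "y \<in> grid_cube s (grid_index s x)" using near_mem_grid_cube[OF s, of x y] by simp
        moreover have "\<bar>\<phi> (x - y)\<bar> * \<bar>h y\<bar> \<le> A / s ^ n * \<bar>h y\<bar>"
          using m unfolding mollifier_def n_def by (intro mult_right_mono) auto
        ultimately show ?thesis by (simp add: abs_mult)
      qed
      then show "ennreal (norm (\<phi> (x - y) * h y)) \<le> ennreal (A / s ^ n) * ennreal \<bar>indicat_real (grid_cube s (grid_index s x)) y * h y\<bar>"
        using A s by (simp add: ennreal_leI flip: ennreal_mult)
    qed
    also have "\<dots> = ennreal (A / s ^ n) * (\<integral>\<^sup>+y. ennreal \<bar>indicat_real (grid_cube s (grid_index s x)) y * h y\<bar> \<partial>lebesgue)"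
      by (intro nn_integral_cmult measurable_compose[OF _ measurable_ennreal] borel_measurable_abs
          borel_measurable_times borel_measurable_indicator Qs borel_measurable_integrable h)
    also have "(\<integral>\<^sup>+y. ennreal \<bar>indicat_real (grid_cube s (grid_index s x)) y * h y\<bar> \<partial>lebesgue) = I h (grid_index s x)"
      unfolding I_def using h(3) K\<Omega> by (intro nn_integral_lebesgue_on_\<Omega>[symmetric]) auto
    finally show ?thesis .
  qed
  have Fz: "convolution \<phi> h x = 0" if "grid_index s x \<notin> Z" for x
  proof (rule convolution_eq_0)
    fix y assume "dist x y < s"
    then have "y \<in> grid_cube s (grid_index s x)" using near_mem_grid_cube[OF s, of x y] by (simp add: dist_norm)
    then show "h y = 0" using that h(3) by (auto simp: Z_def)
  qed (use m in \<open>auto simp: mollifier_def\<close>)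
  have "(\<integral>\<^sup>+x. ennreal \<bar>convolution \<phi> h x * g x\<bar> \<partial>lebesgue_on \<Omega>)
    \<le> (\<integral>\<^sup>+x. (\<Sum>z\<in>Z. (ennreal (A / s ^ n) * I h z) * ennreal \<bar>indicat_real (grid_cube s z) x * g x\<bar>) \<partial>lebesgue_on \<Omega>)"
  proof (rule nn_integral_mono)
    fix x
    show "ennreal \<bar>convolution \<phi> h x * g x\<bar> \<le> (\<Sum>z\<in>Z. (ennreal (A / s ^ n) * I h z) * ennreal \<bar>indicat_real (grid_cube s z) x * g x\<bar>)"
    proof (cases "grid_index s x \<in> Z")
      case True
      \<comment> \<open>x lies in a single cell, and the term of that cell alone dominates the
        integrand; the remaining terms are non-negative.\<close>
      have "ennreal \<bar>convolution \<phi> h x * g x\<bar> = ennreal \<bar>convolution \<phi> h x\<bar> * ennreal \<bar>g x\<bar>"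
        by (simp add: abs_mult ennreal_mult)
      also have "\<dots> \<le> (ennreal (A / s ^ n) * I h (grid_index s x)) * ennreal \<bar>indicat_real (grid_cube s (grid_index s x)) x * g x\<bar>"
        using near_mem_grid_cube[OF s, of x x] s by (intro mult_mono Fb) auto
      also have "\<dots> \<le> (\<Sum>z\<in>Z. (ennreal (A / s ^ n) * I h z) * ennreal \<bar>indicat_real (grid_cube s z) x * g x\<bar>)"
        by (rule member_le_sum[OF True _ Z]) simp
      finally show ?thesis .
    qed (simp add: Fz)
  qed
  also have "\<dots> = (\<Sum>z\<in>Z. \<integral>\<^sup>+x. (ennreal (A / s ^ n) * I h z) * ennreal \<bar>indicat_real (grid_cube s z) x * g x\<bar> \<partial>lebesgue_on \<Omega>)"
    by (intro nn_integral_sum borel_measurable_times_ennreal borel_measurable_const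
        measurable_compose[OF _ measurable_ennreal] borel_measurable_abs borel_measurable_times gm
        measurable_restrict_\<Omega>[OF borel_measurable_indicator[OF Qs]])
  also have "\<dots> = (\<Sum>z\<in>Z. (ennreal (A / s ^ n) * I h z) * I g z)"
    unfolding I_def
    by (intro sum.cong refl nn_integral_cmult measurable_compose[OF _ measurable_ennreal] borel_measurable_abs
        borel_measurable_times gm measurable_restrict_\<Omega>[OF borel_measurable_indicator[OF Qs]])
  also have "\<dots> = ennreal (A / s ^ n) * (\<Sum>z\<in>Z. I h z * I g z)"
    by (simp add: sum_distrib_left mult.assoc)
  also have "\<dots> \<le> ennreal (A / s ^ n) * (\<Sum>z\<in>Z. ennreal B * emeasure lebesgue (grid_cube s z) *
     ?T z)"
    unfolding I_def by (intro mult_left_mono sum_mono cube_product_bound ZQ h g B) auto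
  also have "(\<lambda>z::'n \<Rightarrow> int. ennreal B * emeasure lebesgue (grid_cube s z)) = (\<lambda>z. ennreal (B * (3 * s) ^ n))"
  proof
    fix z :: "'n \<Rightarrow> int"
    have "emeasure lebesgue (grid_cube s z) = ennreal ((3 * s) ^ n)"
      unfolding grid_cube_def n_def using s by (intro emeasure_cube) simp
    then show "ennreal B * emeasure lebesgue (grid_cube s z) = ennreal (B * (3 * s) ^ n)"
      using s B(1) by (simp add: ennreal_mult)
  qed
  also have "ennreal (A / s ^ n) * (\<Sum>z\<in>Z. ennreal (B * (3 * s) ^ n) *
     ?T z)
    = ennreal (A / s ^ n) * ennreal (B * (3 * s) ^ n) * (\<Sum>z\<in>Z.
     ?T z)"
    by (simp only: sum_distrib_left[symmetric] mult.assoc)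
  also have "\<dots> \<le> ennreal (A / s ^ n) * ennreal (B * (3 * s) ^ n) * (of_nat (4 ^ n) * (ennreal G * ennreal (N h) * N' g))"
    unfolding n_def by (intro mult_left_mono grid_sum_bound[OF s Z ZQ h(1) g G(2)]) auto
  also have "ennreal (A / s ^ n) * ennreal (B * (3 * s) ^ n) = ennreal (A * B * 3 ^ n)"
    using A B s by (simp add: power_mult_distrib flip: ennreal_mult)
  also have "ennreal (A * B * 3 ^ n) * (of_nat (4 ^ n) * (ennreal G * ennreal (N h) * N' g))
    = ennreal (A * B * 3 ^ n * 4 ^ n * G * N h) * N' g"
  proof -
    have "(of_nat (4 ^ n) :: ennreal) = ennreal (real (4 ^ n))" by (rule ennreal_of_nat_eq_real_of_nat)
    also have "real (4 ^ n) = 4 ^ n" by simp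
    finally have e: "(of_nat (4 ^ n) :: ennreal) = ennreal (4 ^ n)" .
    have "ennreal (A * B * 3 ^ n * 4 ^ n * G * N h) = ennreal (A * B * 3 ^ n) * (ennreal (4 ^ n) * (ennreal G * ennreal (N h)))"
      using A B(1) G(1) norm_nonneg[OF h(1)] by (simp add: mult.assoc flip: ennreal_mult)
    then show ?thesis unfolding e by (simp only: mult.assoc)
  qed
  finally show ?thesis by (simp add: n_def)
qed

end

lemma convolution_near:
  fixes g :: "real^'n::finite \<Rightarrow> real"
  assumes m: "mollifier A s \<phi>" and g: "integrable lebesgue g"
    and d: "\<And>y. dist x y < s \<Longrightarrow> \<bar>g y - g x\<bar> \<le> d"
  shows "\<bar>convolution \<phi> g x - g x\<bar> \<le> d"
proof -
  have tf: "\<phi> \<in> test_functions UNIV" using m by (simp add: mollifier_def)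
  note i = integral_mollifier_translate[OF m, of x] integrable_convolution[OF tf g, of x]
  have "convolution \<phi> g x - g x = (LINT y|lebesgue. \<phi> (x - y) * g y - \<phi> (x - y) * g x)"
    unfolding convolution_def using i by simp
  also have "norm \<dots> \<le> (LINT y|lebesgue. d * \<phi> (x - y))"
  proof (rule Bochner_Integration.integral_norm_bound_integral)
    show "integrable lebesgue (\<lambda>y. \<phi> (x - y) * g y - \<phi> (x - y) * g x)" using i by auto
    show "integrable lebesgue (\<lambda>y. d * \<phi> (x - y))" using i by auto
    fix y
    show "norm (\<phi> (x - y) * g y - \<phi> (x - y) * g x) \<le> d * \<phi> (x - y)"
    proof (cases "dist x y < s")
      case True
      have "norm (\<phi> (x - y) * g y - \<phi> (x - y) * g x) = \<phi> (x - y) * \<bar>g y - g x\<bar>"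
        using m by (simp add: mollifier_def abs_mult flip: right_diff_distrib)
      also have "\<dots> \<le> \<phi> (x - y) * d" using m d[OF True] by (intro mult_left_mono) (auto simp: mollifier_def)
      finally show ?thesis by (simp add: mult.commute)
    next
      case False
      then have "\<phi> (x - y) = 0" using m by (simp add: mollifier_def dist_norm)
      then show ?thesis by simp
    qed
  qed
  also have "\<dots> = d" using i by simp
  finally show ?thesis by simp
qed

lemma convolution_diff:
  assumes "\<phi> \<in> test_functions UNIV" "integrable lebesgue f" "integrable lebesgue g"
  shows "convolution \<phi> (\<lambda>x. f x - g x) x = convolution \<phi> f x - convolution \<phi> g x"
  using integrable_convolution[OF assms(1,2)] integrable_convolution[OF assms(1,3)]
  by (simp add: convolution_def right_diff_distrib)

section \<open>Convergence of mollifications in the norm of X\<close>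

context mollifiable_space begin

lemma compact_support_integrable:
  assumes "f \<in> X" "compact K" "K \<subseteq> \<Omega>" "\<And>x. x \<notin> K \<Longrightarrow> f x = 0"
  shows "integrable lebesgue f"
proof -
  have "(\<lambda>x. indicat_real K x * f x) = f" using assms(4) by (auto simp: indicator_def fun_eq_iff)
  then show ?thesis using local_integrable[OF assms(1-3)] by simp
qed

lemma convolution_outside:
  assumes "mollifier A s \<phi>" "\<And>x. x \<notin> K \<Longrightarrow> h x = 0" "x \<notin> {y. \<exists>x\<in>K. dist x y \<le> s}"
  shows "convolution \<phi> h x = 0"
proof (rule convolution_eq_0)
  show "s \<le> norm x \<Longrightarrow> \<phi> x = 0" for x using assms(1) by (simp add: mollifier_def)
  fix y assume "dist x y < s"
  then show "h y = 0" using assms(2,3) by (force simp: dist_commute)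
qed

lemma convolution_bounded_measurable_on:
  assumes m: "mollifier A s \<phi>" and h: "integrable lebesgue h" "\<And>x. x \<notin> K \<Longrightarrow> h x = 0"
  shows "convolution \<phi> h \<in> bounded_measurable_on {y. \<exists>x\<in>K. dist x y \<le> s}"
proof -
  have tf: "\<phi> \<in> test_functions UNIV" using m by (simp add: mollifier_def)
  obtain B where B: "\<And>x. \<bar>\<phi> x\<bar> \<le> B" using test_functions_bounded[OF tf] by blast
  have "\<bar>convolution \<phi> h x\<bar> \<le> B * (LINT y|lebesgue. \<bar>h y\<bar>)" for x
  proof -
    have "norm (convolution \<phi> h x) \<le> (LINT y|lebesgue. B * \<bar>h y\<bar>)"
      unfolding convolution_def using h(1) B
      by (intro Bochner_Integration.integral_norm_bound_integral integrable_convolution[OF tf])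
         (auto simp: abs_mult intro!: mult_right_mono)
    then show ?thesis by simp
  qed
  moreover have "convolution \<phi> h \<in> borel_measurable lebesgue"
    using C_k_imp_continuous[OF C_k_convolution[OF tf h(1)]] by (rule continuous_imp_lebesgue_measurable)
  moreover have "\<forall>x. x \<notin> {y. \<exists>x\<in>K. dist x y \<le> s} \<longrightarrow> convolution \<phi> h x = 0"
    by (intro allI impI) (rule convolution_outside[OF m h(2)])
  ultimately show ?thesis unfolding bounded_measurable_on_def by blast
qed

lemma bounded_measurable_on_mem:
  "p \<in> bounded_measurable_on S \<Longrightarrow> compact S \<Longrightarrow> S \<subseteq> \<Omega> \<Longrightarrow> p \<in> X"
  unfolding bounded_measurable_on_def using bounded_compact_support_mem(1) by blast

text \<open>C is fixed before the scale, the kernel, the function and its support. The condition on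
  K keeps every grid cube that meets K inside \<Omega>, where the hypotheses on cubes apply.\<close>

lemma mollification_bound:
  assumes A: "0 < A"
  shows "\<exists>C\<ge>0. \<forall>(s::real) \<phi> h K. 0 < s \<longrightarrow> mollifier A s \<phi> \<longrightarrow> h \<in> X \<longrightarrow> compact K \<longrightarrow> (\<forall>x. x \<notin> K \<longrightarrow> h x = 0) \<longrightarrow>
    (\<forall>x\<in>K. cball x (CARD('n) * (3 * s)) \<subseteq> \<Omega>) \<longrightarrow> convolution \<phi> h \<in> X \<and> N (convolution \<phi> h) \<le> C * N h"
proof -
  obtain B where B: "0 \<le> B" "\<And>Q. Q \<in> cubes_in \<Omega> \<Longrightarrow>
      ennreal (N (indicat_real Q)) * N' (indicat_real Q) \<le> ennreal B * emeasure lebesgue Q"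
    using muckenhoupt_constant by blast
  obtain G where G: "0 \<le> G" "\<forall>f\<in>X. \<forall>g\<in>X'. \<forall>\<Q>. \<Q> \<subseteq> cubes_in \<Omega> \<and> disjoint \<Q> \<longrightarrow>
      (\<Sum>\<^sub>\<infinity>Q\<in>\<Q>. ennreal (N (\<lambda>x. indicat_real Q x * f x)) * N' (\<lambda>x. indicat_real Q x * g x))
        \<le> ennreal G * ennreal (N f) * N' g"
    using prop_G unfolding property_G_def by blast
  define C where "C = A * B * 3 ^ CARD('n) * 4 ^ CARD('n) * G"
  have C: "0 \<le> C" using A B G by (simp add: C_def)
  have main: "convolution \<phi> h \<in> X \<and> N (convolution \<phi> h) \<le> C * N h"
    if s: "0 < s" and m: "mollifier A s \<phi>" and h: "h \<in> X" and K: "compact K" and z: "\<And>x. x \<notin> K \<Longrightarrow> h x = 0"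
      and cb: "\<And>x. x \<in> K \<Longrightarrow> cball x (CARD('n) * (3 * s)) \<subseteq> \<Omega>" for s :: real and \<phi> h K
  proof -
    define S where "S = {y. \<exists>x\<in>K. dist x y \<le> s}"
    have "0 < CARD('n)" by simp
    then have "1 * s \<le> CARD('n) * (3 * s)" using s by (intro mult_mono) auto
    then have S: "compact S" "S \<subseteq> \<Omega>"
      unfolding S_def using compact_Minkowski_ball[OF K] cb by fastforce+
    have "K \<subseteq> \<Omega>" using cb s by fastforce
    then have hi: "integrable lebesgue h" using compact_support_integrable h K z by blast
    have bm: "convolution \<phi> h \<in> bounded_measurable_on S"
      unfolding S_def by (rule convolution_bounded_measurable_on[OF m hi z])
    \<comment> \<open>\<open>dual_norm_bound\<close> asks for a positive constant, and C * N h may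
      be 0; the extra e is sent to 0 afterwards.\<close>
    have "N (convolution \<phi> h) \<le> C * N h + e" if e: "0 < e" for e
    proof (rule dual_norm_bound[OF bm S])
      show "0 < C * N h + e" using C norm_nonneg[OF h] e by (simp add: add_nonneg_pos)
      fix g assume g: "g \<in> X'"
      have "(\<integral>\<^sup>+x. ennreal \<bar>convolution \<phi> h x * g x\<bar> \<partial>lebesgue_on \<Omega>)
        \<le> ennreal (A * B * 3 ^ CARD('n) * 4 ^ CARD('n) * G * N h) * N' g"
        using G(2) h g by (intro convolution_pairing_bound[OF s m h hi z K cb A g B G(1)]) blast+
      also have "\<dots> \<le> ennreal (C * N h + e) * N' g"
        using e by (intro mult_right_mono ennreal_leI) (auto simp: C_def)
      finally show "(\<integral>\<^sup>+x. ennreal \<bar>convolution \<phi> h x * g x\<bar> \<partial>lebesgue_on \<Omega>) \<le> ennreal (C * N h + e) * N' g" .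
    qed
    then have "N (convolution \<phi> h) \<le> C * N h" by (rule field_le_epsilon)
    then show ?thesis using bounded_measurable_on_mem[OF bm S] by simp
  qed
  show ?thesis
  proof (rule exI[of _ C], rule conjI[OF C], intro allI impI)
    fix s :: real and \<phi> h :: "real^'n \<Rightarrow> real" and K
    assume a: "0 < s" "mollifier A s \<phi>" "h \<in> X" "compact K"
      and b: "\<forall>x. x \<notin> K \<longrightarrow> h x = 0" "\<forall>x\<in>K. cball x (CARD('n) * (3 * s)) \<subseteq> \<Omega>"
    show "convolution \<phi> h \<in> X \<and> N (convolution \<phi> h) \<le> C * N h"
      by (rule main[OF a b(1)[rule_format] b(2)[rule_format]])
  qed
qed

text \<open>h is first truncated; the bounded function is an almost everywhere limit of continuous
  ones, which are clamped and multiplied by a cutoff. Both passages converge in X by dominated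
  convergence. The set S is chosen before e.\<close>

lemma continuous_approximation:
  assumes h: "h \<in> X" and K: "compact K" "K \<subseteq> \<Omega>" "\<And>x. x \<notin> K \<Longrightarrow> h x = 0"
  shows "\<exists>S. compact S \<and> K \<subseteq> S \<and> S \<subseteq> \<Omega> \<and> (\<forall>e>0. \<exists>g. continuous_on UNIV g \<and> (\<forall>x. x \<notin> S \<longrightarrow> g x = 0) \<and> N (\<lambda>x. h x - g x) < e)"
proof -
  obtain \<eta> where \<eta>: "\<eta> \<in> test_functions \<Omega>" "\<And>x. 0 \<le> \<eta> x" "\<And>x. \<eta> x \<le> 1" "\<And>x. x \<in> K \<Longrightarrow> \<eta> x = 1"
    using smooth_cutoff[OF K(1) open_\<Omega> K(2)] by metis
  define S where "S = closure {x. \<eta> x \<noteq> 0}"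
  have S: "compact S" "S \<subseteq> \<Omega>" using \<eta>(1) by (auto simp: test_functions_def S_def)
  have \<eta>S: "\<eta> x = 0" if "x \<notin> S" for x using that closure_subset[of "{x. \<eta> x \<noteq> 0}"] by (auto simp: S_def)
  have KS: "K \<subseteq> S" using \<eta>(4) \<eta>S by force
  have Ks: "K \<in> sets lebesgue" using lmeasurable_compact[OF K(1)] by auto
  have hm: "h \<in> borel_measurable lebesgue"
    by (rule measurable_extend_0[OF mem_X_measurable[OF h] Ks K(2) K(3)])
  have "\<exists>g. continuous_on UNIV g \<and> (\<forall>x. x \<notin> S \<longrightarrow> g x = 0) \<and> N (\<lambda>x. h x - g x) < e" if e: "0 < e" for e
  proof -
    have hk: "(\<lambda>x. clamp_real (real k) (h x)) \<in> borel_measurable lebesgue" for k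
      using measurable_compose[OF hm measurable_clamp_real] .
    have "(\<lambda>k. N (\<lambda>x. h x - clamp_real (real k) (h x))) \<longlonglongrightarrow> 0"
    proof (rule dominated_convergence[OF _ h])
      show "(\<lambda>x. h x - clamp_real (real k) (h x)) \<in> borel_measurable (lebesgue_on \<Omega>)" for k
        by (intro measurable_restrict_\<Omega> borel_measurable_diff hm hk)
      show "AE x in lebesgue_on \<Omega>. \<bar>h x - clamp_real (real k) (h x)\<bar> \<le> \<bar>h x\<bar>" for k
        by (intro AE_I2) (auto simp: clamp_real_def)
      show "AE x in lebesgue_on \<Omega>. (\<lambda>k. h x - clamp_real (real k) (h x)) \<longlonglongrightarrow> 0"
      proof (intro AE_I2)
        fix x
        obtain k0 where "\<bar>h x\<bar> \<le> real k0" using real_arch_simple by blast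
        then have "eventually (\<lambda>k. h x - clamp_real (real k) (h x) = 0) sequentially"
          by (intro eventually_sequentiallyI[of k0]) (simp add: clamp_real(5))
        then show "(\<lambda>k. h x - clamp_real (real k) (h x)) \<longlonglongrightarrow> 0" by (rule tendsto_eventually)
      qed
    qed
    then obtain k where k: "norm (N (\<lambda>x. h x - clamp_real (real k) (h x)) - 0) < e / 2"
      using LIMSEQ_D e half_gt_zero by blast
    define f where "f x = clamp_real (real k) (h x)" for x
    have f: "f \<in> borel_measurable lebesgue" "\<And>x. \<bar>f x\<bar> \<le> k" "\<And>x. x \<notin> K \<Longrightarrow> f x = 0"
      using hk K(3) by (auto simp: f_def[abs_def] clamp_real(1,4))
    have "f measurable_on UNIV" by (rule lebesgue_measurable_imp_measurable_on[OF f(1)]) simp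
    then obtain Z G where Z: "negligible Z" and G: "\<And>n. continuous_on UNIV (G n)" "\<And>x. x \<notin> Z \<Longrightarrow> (\<lambda>n. G n x) \<longlonglongrightarrow> f x"
      unfolding measurable_on_def by auto
    \<comment> \<open>Clamping supplies the bound and \<eta> the support; neither changes the limit,
      because |f| \<le> k and \<eta> = 1 wherever f is nonzero.\<close>
    define g where "g n x = clamp_real (real k) (G n x) * \<eta> x" for n x
    have gc: "continuous_on UNIV (g n)" for n
      unfolding g_def[abs_def]
      by (intro continuous_on_mult test_functions_continuous[OF \<eta>(1)]
          continuous_on_compose2[OF continuous_clamp_real G(1)]) auto
    have gb: "\<bar>g n x\<bar> \<le> real k" for n x
      unfolding g_def abs_mult using \<eta>(2,3)[of x] clamp_real(1)[of "real k" "G n x"]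
        mult_mono[of "\<bar>clamp_real (real k) (G n x)\<bar>" "real k" "\<bar>\<eta> x\<bar>" 1] by simp
    have "(\<lambda>n. N (\<lambda>x. f x - g n x)) \<longlonglongrightarrow> 0"
    proof (rule dominated_convergence)
      show "(\<lambda>x. 2 * real k * indicat_real S x) \<in> X"
        using scale_mem[OF indicator_compact_mem[OF S], of "2 * real k"] by simp
      show "(\<lambda>x. f x - g n x) \<in> borel_measurable (lebesgue_on \<Omega>)" for n
        by (intro measurable_restrict_\<Omega> borel_measurable_diff f continuous_imp_lebesgue_measurable gc)
      have "\<bar>f x - g n x\<bar> \<le> \<bar>2 * real k * indicat_real S x\<bar>" for n x
        using f(2)[of x] gb[of n x] f(3)[of x] \<eta>S[of x] KS by (cases "x \<in> S") (auto simp: g_def)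
      then show "AE x in lebesgue_on \<Omega>. \<bar>f x - g n x\<bar> \<le> \<bar>2 * real k * indicat_real S x\<bar>" for n by simp
      have "AE x in lebesgue. x \<notin> Z" using Z by (simp add: AE_not_in negligible_iff_null_sets)
      then have "AE x in lebesgue. (\<lambda>n. f x - g n x) \<longlonglongrightarrow> 0"
      proof eventually_elim
        case (elim x)
        have "isCont (clamp_real (real k)) (f x)"
          using continuous_clamp_real by (simp add: continuous_on_eq_continuous_at)
        then have "(\<lambda>n. clamp_real (real k) (G n x)) \<longlonglongrightarrow> clamp_real (real k) (f x)"
          using G(2)[OF elim] by (rule isCont_tendsto_compose)
        then have "(\<lambda>n. f x - g n x) \<longlonglongrightarrow> f x - f x * \<eta> x"
          unfolding g_def using f(2)[of x] by (intro tendsto_intros) (simp add: clamp_real(5))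
        also have "f x - f x * \<eta> x = 0" using f(3)[of x] \<eta>(4)[of x] by (cases "x \<in> K") auto
        finally show ?case .
      qed
      then show "AE x in lebesgue_on \<Omega>. (\<lambda>n. f x - g n x) \<longlonglongrightarrow> 0" by (rule AE_lebesgue_on_\<Omega>)
    qed
    then obtain n where n: "norm (N (\<lambda>x. f x - g n x) - 0) < e / 2"
      using LIMSEQ_D e half_gt_zero by blast
    have fX: "f \<in> X" by (rule bounded_compact_support_mem(1)[OF f K(1,2)])
    have gS: "g n x = 0" if "x \<notin> S" for x using \<eta>S[OF that] by (simp add: g_def)
    have gX: "g n \<in> X"
      by (rule bounded_compact_support_mem(1)[OF continuous_imp_lebesgue_measurable[OF gc] gb gS S])
    have "N (\<lambda>x. h x - g n x) \<le> N (\<lambda>x. h x - f x) + N (\<lambda>x. f x - g n x)"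
      using norm_triangle[OF diff_mem[OF h fX] diff_mem[OF fX gX]] by simp
    also have "\<dots> < e" using n k by (simp add: f_def)
    finally show ?thesis using gc gS by blast
  qed
  then show ?thesis using S KS by blast
qed

text \<open>Uniform boundedness plus density: for a continuous g near h the error splits into the
  mollification of h - g, the function h - g itself, and the error for g, which is uniformly small
  and supported in the fixed compact set S3.\<close>

lemma mollification_tendsto:
  assumes A: "0 < A" and h: "h \<in> X" and K: "compact K" "K \<subseteq> \<Omega>" "\<And>x. x \<notin> K \<Longrightarrow> h x = 0" and e: "0 < e"
  shows "\<exists>s0>0. \<forall>s \<phi>. 0 < s \<longrightarrow> s < s0 \<longrightarrow> mollifier A s \<phi> \<longrightarrow>
    convolution \<phi> h \<in> X \<and> N (\<lambda>x. convolution \<phi> h x - h x) \<le> e"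
proof -
  obtain C where C: "0 \<le> C" "\<And>(s::real) \<phi> h K. \<lbrakk>0 < s; mollifier A s \<phi>; h \<in> X; compact K; \<forall>x. x \<notin> K \<longrightarrow> h x = 0;
    \<forall>x\<in>K. cball x (CARD('n) * (3 * s)) \<subseteq> \<Omega>\<rbrakk> \<Longrightarrow> convolution \<phi> h \<in> X \<and> N (convolution \<phi> h) \<le> C * N h"
    using mollification_bound[OF A] by blast
  obtain S where S: "compact S" "K \<subseteq> S" "S \<subseteq> \<Omega>" and
    ap: "\<And>e. e > 0 \<Longrightarrow> \<exists>g. continuous_on UNIV g \<and> (\<forall>x. x \<notin> S \<longrightarrow> g x = 0) \<and> N (\<lambda>x. h x - g x) < e"
    using continuous_approximation[OF h K] by blast
  have hS: "x \<notin> S \<Longrightarrow> h x = 0" for x using K(3) S(2) by blast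
  \<comment> \<open>The two terms with h - g cost (C + 1) N(h - g), at most e/2 with this choice; d
    below makes the third term at most e/2 as well.\<close>
  have "0 < e / (2 * (C + 1))" using e C by simp
  then obtain g where g: "continuous_on UNIV g" "\<And>x. x \<notin> S \<Longrightarrow> g x = 0" "N (\<lambda>x. h x - g x) < e / (2 * (C + 1))"
    using ap by blast
  obtain r where r: "0 < r" "(\<Union>x\<in>S. ball x r) \<subseteq> \<Omega>"
    by (rule compact_subset_open_imp_ball_epsilon_subset[OF S(1) open_\<Omega> S(3)])
  define S3 where "S3 = {y. \<exists>x\<in>S. dist x y \<le> r / 2}"
  have S3: "compact S3" unfolding S3_def by (rule compact_Minkowski_ball[OF S(1)])
  have S3\<Omega>: "S3 \<subseteq> \<Omega>"
  proof
    fix y assume "y \<in> S3"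
    then obtain x where "x \<in> S" "dist x y \<le> r / 2" by (auto simp: S3_def)
    then have "y \<in> ball x r" using r(1) by simp
    then show "y \<in> \<Omega>" using r(2) \<open>x \<in> S\<close> by blast
  qed
  define d where "d = e / (2 * (N (indicat_real S3) + 1))"
  have NS3: "0 \<le> N (indicat_real S3)" by (rule norm_nonneg[OF indicator_compact_mem[OF S3 S3\<Omega>]])
  have d: "0 < d" using NS3 e by (simp add: d_def)
  obtain R where R: "\<And>x. x \<in> S \<Longrightarrow> norm x \<le> R" using compact_imp_bounded[OF S(1)] by (auto simp: bounded_iff)
  have gR: "g x = 0" if "R < norm x" for x using g(2)[of x] R[of x] that by force
  obtain t where t: "0 < t" "\<And>x y. dist x y < t \<Longrightarrow> \<bar>g x - g y\<bar> < d"
    using compact_support_uniformly_continuous[OF g(1) gR d] by blast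
  obtain Mg where Mg: "\<And>x. \<bar>g x\<bar> \<le> Mg"
  proof -
    have "compact (g ` S)" using S(1) continuous_on_subset[OF g(1)] by (intro compact_continuous_image) auto
    then have "bounded (g ` S)" by (rule compact_imp_bounded)
    then obtain M where M: "0 < M" "\<And>y. y \<in> g ` S \<Longrightarrow> norm y \<le> M"
      unfolding bounded_pos by blast
    have "\<bar>g x\<bar> \<le> M" for x using M(1) M(2)[of "g x"] g(2)[of x] by (cases "x \<in> S") auto
    then show ?thesis using that by blast
  qed
  have gX: "g \<in> X" and gi: "integrable lebesgue g"
    using bounded_compact_support_mem[OF continuous_imp_lebesgue_measurable[OF g(1)] Mg g(2) S(1,3)] by blast+
  have hi: "integrable lebesgue h" by (rule compact_support_integrable[OF h S(1,3) hS])
  \<comment> \<open>Below t for the uniform continuity of g, below r/2 to keep the mollification of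
    g supported in S3, and below r/(4n) so that the balls of radius 3ns in the uniform bound stay in
    \<Omega>.\<close>
  define s0 where "s0 = min t (min (r / 2) (r / (4 * CARD('n))))"
  have "0 < s0" using t r by (simp add: s0_def)
  moreover have "convolution \<phi> h \<in> X \<and> N (\<lambda>x. convolution \<phi> h x - h x) \<le> e"
    if s: "0 < s" "s < s0" and m: "mollifier A s \<phi>" for s \<phi>
  proof -
    have tf: "\<phi> \<in> test_functions UNIV" using m by (simp add: mollifier_def)
    have sl: "s < t" "s < r / 2" "s < r / (4 * CARD('n))" using s(2) by (simp_all add: s0_def)
    have "CARD('n) * (4 * s) < r" using sl(3) by (simp add: field_simps)
    moreover have "CARD('n) * (3 * s) \<le> CARD('n) * (4 * s)" using s(1) by (intro mult_left_mono) auto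
    ultimately have "CARD('n) * (3 * s) < r" by linarith
    then have cb: "\<forall>x\<in>S. cball x (CARD('n) * (3 * s)) \<subseteq> \<Omega>" using r(2) by fastforce
    have hg: "(\<lambda>x. h x - g x) \<in> X" by (rule diff_mem[OF h gX])
    have 1: "convolution \<phi> h \<in> X" using C(2)[OF s(1) m h S(1) _ cb] hS by blast
    have 2: "convolution \<phi> (\<lambda>x. h x - g x) \<in> X" "N (convolution \<phi> (\<lambda>x. h x - g x)) \<le> C * N (\<lambda>x. h x - g x)"
      using C(2)[OF s(1) m hg S(1) _ cb] hS g(2) by auto
    define w where "w x = convolution \<phi> g x - g x" for x
    have w: "w \<in> X" "N w \<le> d * N (indicat_real S3)"
    proof -
      have wm: "w \<in> borel_measurable lebesgue"
        unfolding w_def[abs_def]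
        by (intro borel_measurable_diff continuous_imp_lebesgue_measurable g C_k_imp_continuous[OF C_k_convolution[OF tf gi]])
      have wd: "\<bar>w x\<bar> \<le> d" for x
        unfolding w_def
      proof (rule convolution_near[OF m gi])
        fix y assume "dist x y < s"
        then show "\<bar>g y - g x\<bar> \<le> d" using t(2)[of y x] sl(1) by (simp add: dist_commute less_imp_le)
      qed
      have wz: "w x = 0" if "x \<notin> S3" for x
      proof -
        have "x \<notin> {y. \<exists>x\<in>S. dist x y \<le> s}" using that sl(2) by (auto simp: S3_def)
        then have "convolution \<phi> g x = 0" by (intro convolution_outside[OF m, of S] g(2))
        moreover have "g x = 0" using that g(2)[of x] r(1) by (force simp: S3_def)
        ultimately show ?thesis by (simp add: w_def)
      qed
      show "w \<in> X" "N w \<le> d * N (indicat_real S3)"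
        using bounded_compact_support_mem[OF wm wd wz S3 S3\<Omega>] by blast+
    qed
    have eq: "(\<lambda>x. convolution \<phi> h x - h x) = (\<lambda>x. (convolution \<phi> (\<lambda>x. h x - g x) x - (h x - g x)) + w x)"
      using convolution_diff[OF tf hi gi] by (simp add: w_def fun_eq_iff)
    have "N (\<lambda>x. convolution \<phi> h x - h x) \<le> N (\<lambda>x. convolution \<phi> (\<lambda>x. h x - g x) x - (h x - g x)) + N w"
      unfolding eq by (rule norm_triangle[OF diff_mem[OF 2(1) hg] w(1)])
    also have "\<dots> \<le> (N (convolution \<phi> (\<lambda>x. h x - g x)) + N (\<lambda>x. h x - g x)) + N w"
      using norm_diff_triangle[OF 2(1) hg] by simp
    also have "\<dots> \<le> (C + 1) * N (\<lambda>x. h x - g x) + d * N (indicat_real S3)"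
      using 2(2) w(2) by (simp add: algebra_simps)
    also have "\<dots> \<le> e / 2 + e / 2"
    proof (rule add_mono)
      have "(C + 1) * N (\<lambda>x. h x - g x) \<le> (C + 1) * (e / (2 * (C + 1)))"
        using g(3) C(1) by (intro mult_left_mono) auto
      also have "\<dots> = e / 2" using C(1) by (simp add: field_simps)
      finally show "(C + 1) * N (\<lambda>x. h x - g x) \<le> e / 2" .
      have "d * N (indicat_real S3) \<le> d * (N (indicat_real S3) + 1)" using d by (intro mult_left_mono) auto
      also have "\<dots> = e / 2" using NS3 by (simp add: d_def field_simps)
      finally show "d * N (indicat_real S3) \<le> e / 2" .
    qed
    finally show ?thesis using 1 by simp
  qed
  ultimately show ?thesis by blast
qed

end

section \<open>Weak derivatives and partitions of unity\<close>

lemma partial_deriv_eq_0_of_locally_const: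
  assumes "open S" "x \<in> S" "\<And>y. y \<in> S \<Longrightarrow> f y = c"
  shows "partial_deriv j f x = 0"
proof -
  have "(f has_derivative (\<lambda>t. 0)) (at x)"
    by (rule has_derivative_transform_within_open[OF has_derivative_const assms(1,2)]) (simp add: assms(3))
  then show ?thesis by (rule partial_deriv_eq)
qed

lemma partial_deriv_diff:
  assumes "C_k (Suc k) f" "C_k (Suc k) g"
  shows "partial_deriv j (\<lambda>x. f x - g x) x = partial_deriv j f x - partial_deriv j g x"
  using partial_deriv_eq[OF has_derivative_diff[OF C_k_has_derivative[OF assms(1)] C_k_has_derivative[OF assms(2)]]]
  by (simp add: sum_axis_mult)

lemma test_functions_mult:
  assumes \<psi>: "\<psi> \<in> test_functions \<Omega>" and \<tau>: "\<And>k. C_k k \<tau>"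
  shows "(\<lambda>x. \<psi> x * \<tau> x) \<in> test_functions \<Omega>"
proof (rule test_functionsI)
  show "C_k k (\<lambda>x. \<psi> x * \<tau> x)" for k using C_k_mult[OF test_functions_C_k[OF \<psi>] \<tau>] .
  show "compact (closure {x. \<psi> x \<noteq> 0})" "closure {x. \<psi> x \<noteq> 0} \<subseteq> \<Omega>" using \<psi> by (auto simp: test_functions_def)
  show "\<psi> x * \<tau> x = 0" if "x \<notin> closure {x. \<psi> x \<noteq> 0}" for x
    using that closure_subset[of "{x. \<psi> x \<noteq> 0}"] by auto
qed

lemma test_functions_eq_0_outside:
  assumes "\<psi> \<in> test_functions \<Omega>" "x \<notin> \<Omega>" shows "\<psi> x = 0" "partial_deriv j \<psi> x = 0"
proof -
  have x: "x \<notin> closure {x. \<psi> x \<noteq> 0}" using assms by (auto simp: test_functions_def)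
  then show "\<psi> x = 0" using closure_subset[of "{x. \<psi> x \<noteq> 0}"] by auto
  show "partial_deriv j \<psi> x = 0" by (rule partial_deriv_outside_support[OF x])
qed

lemma integrable_mult_test_function:
  fixes h :: "real^'n::finite \<Rightarrow> real"
  assumes h: "integrable lebesgue h" and \<tau>: "\<tau> \<in> test_functions \<Omega>"
  shows "integrable lebesgue (\<lambda>x. h x * \<tau> x)"
proof -
  obtain B where B: "0 < B" "\<And>x. \<bar>\<tau> x\<bar> \<le> B" using test_functions_bounded[OF \<tau>] by blast
  show ?thesis
  proof (rule Bochner_Integration.integrable_bound[OF integrable_mult_right[OF h, of B]])
    show "(\<lambda>x. h x * \<tau> x) \<in> borel_measurable lebesgue"
      using continuous_imp_lebesgue_measurable[OF test_functions_continuous[OF \<tau>]] borel_measurable_integrable[OF h]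
      by (intro borel_measurable_times)
    have "norm (h x * \<tau> x) \<le> norm (B * h x)" for x
      using mult_right_mono[OF B(2)[of x], of "\<bar>h x\<bar>"] B(1) by (simp add: abs_mult mult.commute)
    then show "AE x in lebesgue. norm (h x * \<tau> x) \<le> norm (B * h x)" by simp
  qed
qed

section \<open>Localized pieces of a Sobolev function and their mollification\<close>

context mollifiable_space begin

text \<open>
  The index \<open>None\<close> gives $\psi f$ and \<open>Some j\<close> its weak $j$-th partial derivative; treating them
  uniformly lets one mollification radius serve for all of them.
\<close>

definition localized ::
    "(real^'n \<Rightarrow> real) \<Rightarrow> (real^'n \<Rightarrow> real^'n) \<Rightarrow> (real^'n \<Rightarrow> real) \<Rightarrow> 'n option \<Rightarrow> real^'n \<Rightarrow> real" where
  "localized f g \<psi> l x = (case l of None \<Rightarrow> \<psi> x * f x | Some j \<Rightarrow> \<psi> x * g x $ j + partial_deriv j \<psi> x * f x)"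

lemma localized_outside:
  assumes "x \<notin> closure {x. \<psi> x \<noteq> 0}" shows "localized f g \<psi> l x = 0"
  using assms closure_subset[of "{x. \<psi> x \<noteq> 0}"] partial_deriv_outside_support[OF assms]
  by (auto simp: localized_def split: option.split)

lemma localized_mem:
  assumes \<psi>: "\<psi> \<in> test_functions \<Omega>'" and f: "f \<in> X" and g: "\<And>j. (\<lambda>x. g x $ j) \<in> X"
  shows "localized f g \<psi> l \<in> X"
proof (cases l)
  case None
  then show ?thesis using test_function_mult_mem[OF \<psi> f] by (simp add: localized_def[abs_def])
next
  case (Some j)
  then show ?thesis
    using add_mem[OF test_function_mult_mem[OF \<psi> g[of j]] test_function_mult_mem[OF test_functions_partial_deriv[OF \<psi>] f]]
    by (simp add: localized_def[abs_def])
qed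

lemma localized_integrable:
  assumes \<psi>: "\<psi> \<in> test_functions \<Omega>" and f: "f \<in> X" and g: "\<And>j. (\<lambda>x. g x $ j) \<in> X"
  shows "integrable lebesgue (localized f g \<psi> l)"
  using \<psi> by (intro compact_support_integrable[OF localized_mem[OF \<psi> f g], of "closure {x. \<psi> x \<noteq> 0}"] localized_outside)
    (auto simp: test_functions_def)

text \<open>The product \<psi> \<tau> is a test function on \<Omega> even though \<tau> need not
  vanish near the boundary. Testing f with it produces, by the product rule, the term with the
  derivative of \<psi> that the index \<open>Some j\<close> carries. The zero extension of the piece
  thus has a weak derivative on the whole space, where it can be mollified.\<close>

lemma localized_weak_deriv:
  assumes \<psi>: "\<psi> \<in> test_functions \<Omega>" and f: "f \<in> X" and g: "\<And>j. (\<lambda>x. g x $ j) \<in> X"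
    and weak: "weak_partial_deriv \<Omega> j f (\<lambda>x. g x $ j)" and \<tau>: "\<tau> \<in> test_functions UNIV"
  shows "(LINT x|lebesgue. localized f g \<psi> None x * partial_deriv j \<tau> x) = - (LINT x|lebesgue. localized f g \<psi> (Some j) x * \<tau> x)"
proof -
  define \<theta> where "\<theta> x = \<psi> x * \<tau> x" for x
  have \<theta>: "\<theta> \<in> test_functions \<Omega>"
    unfolding \<theta>_def[abs_def] by (rule test_functions_mult[OF \<psi> test_functions_C_k[OF \<tau>]])
  have d\<theta>: "partial_deriv j \<theta> x = \<psi> x * partial_deriv j \<tau> x + partial_deriv j \<psi> x * \<tau> x" for x
    unfolding \<theta>_def[abs_def] by (rule partial_deriv_mult[OF test_functions_C_k[OF \<psi>] test_functions_C_k[OF \<tau>]])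
  define k where "k x = partial_deriv j \<psi> x * f x" for x
  have k: "integrable lebesgue k"
    unfolding k_def[abs_def] using test_function_mult_mem[OF test_functions_partial_deriv[OF \<psi>] f] \<psi>
    by (intro compact_support_integrable[of _ "closure {x. \<psi> x \<noteq> 0}"])
       (auto simp: partial_deriv_outside_support test_functions_def)
  note i = integrable_mult_test_function[OF localized_integrable[OF \<psi> f g, where l=None] test_functions_partial_deriv[OF \<tau>, of j]]
    integrable_mult_test_function[OF k \<tau>] integrable_mult_test_function[OF localized_integrable[OF \<psi> f g, where l="Some j"] \<tau>]
  have "(LINT x|lebesgue. localized f g \<psi> None x * partial_deriv j \<tau> x) + (LINT x|lebesgue. k x * \<tau> x)
    = (LINT x|lebesgue. localized f g \<psi> None x * partial_deriv j \<tau> x + k x * \<tau> x)"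
    using i by simp
  also have "\<dots> = (LINT x:\<Omega>|lebesgue. f x * partial_deriv j \<theta> x)"
    unfolding set_lebesgue_integral_def using test_functions_eq_0_outside[OF \<psi>]
    by (intro Bochner_Integration.integral_cong refl) (auto simp: d\<theta> k_def localized_def indicator_def algebra_simps)
  also have "\<dots> = - (LINT x:\<Omega>|lebesgue. g x $ j * \<theta> x)"
    using weak \<theta> by (simp add: weak_partial_deriv_def)
  also have "(LINT x:\<Omega>|lebesgue. g x $ j * \<theta> x) = (LINT x|lebesgue. localized f g \<psi> (Some j) x * \<tau> x - k x * \<tau> x)"
    unfolding set_lebesgue_integral_def using test_functions_eq_0_outside[OF \<psi>]
    by (intro Bochner_Integration.integral_cong refl) (auto simp: \<theta>_def k_def localized_def indicator_def algebra_simps)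
  also have "\<dots> = (LINT x|lebesgue. localized f g \<psi> (Some j) x * \<tau> x) - (LINT x|lebesgue. k x * \<tau> x)"
    using i by simp
  finally show ?thesis by simp
qed

text \<open>The partial sums of |d_i| increase to T, with norms at most e because the weights
  (1/2)^(i+1) sum to 1. The Fatou property puts T into X with N T \<le> e, and T dominates w. At
  each point only finitely many terms are nonzero, so T is finite.\<close>

lemma norm_series:
  assumes d: "\<And>i. d i \<in> X" "\<And>i. N (d i) \<le> e * (1/2) ^ Suc i" and e: "0 \<le> e"
    and fin: "\<And>x. x \<in> \<Omega> \<Longrightarrow> \<exists>m. \<forall>i\<ge>m. d i x = 0"
    and w: "w \<in> borel_measurable (lebesgue_on \<Omega>)"
    and le: "\<And>x m. x \<in> \<Omega> \<Longrightarrow> \<forall>i\<ge>m. d i x = 0 \<Longrightarrow> \<bar>w x\<bar> \<le> (\<Sum>i<m. \<bar>d i x\<bar>)"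
  shows "w \<in> X" "N w \<le> e"
proof -
  define S where "S k x = (\<Sum>i<k. \<bar>d i x\<bar>)" for k x
  define T where "T x = (\<Sum>i. \<bar>d i x\<bar>)" for x
  have SX: "S k \<in> X" for k
    unfolding S_def[abs_def] using abs_mem(1)[OF d(1)] by (intro sum_mem)
  have SN: "N (S k) \<le> e" for k
  proof -
    have "N (S k) \<le> (\<Sum>i<k. N (\<lambda>x. \<bar>d i x\<bar>))"
      unfolding S_def[abs_def] using abs_mem(1)[OF d(1)] by (intro norm_sum)
    also have "\<dots> \<le> (\<Sum>i<k. e * (1/2) ^ Suc i)" using abs_mem(2)[OF d(1)] d(2) by (intro sum_mono) simp
    also have "\<dots> = e * (1 - (1/2) ^ k)"
      by (induction k) (simp_all add: algebra_simps)
    also have "\<dots> \<le> e * 1" using e by (intro mult_left_mono) auto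
    finally show ?thesis by simp
  qed
  have S_eq: "S k x = (\<Sum>i<m. \<bar>d i x\<bar>)" if "\<forall>i\<ge>m. d i x = 0" "m \<le> k" for k m x
    unfolding S_def using that by (intro sum.mono_neutral_right) auto
  have T_eq: "T x = (\<Sum>i<m. \<bar>d i x\<bar>)" if "\<forall>i\<ge>m. d i x = 0" for m x
    unfolding T_def using that by (intro suminf_finite) auto
  have "AE x in lebesgue_on \<Omega>. (\<forall>k. 0 \<le> S k x \<and> S k x \<le> S (Suc k) x) \<and> (\<lambda>k. S k x) \<longlonglongrightarrow> T x"
  proof (intro AE_I2 conjI allI)
    fix x assume "x \<in> space (lebesgue_on \<Omega>)"
    then obtain m where m: "\<forall>i\<ge>m. d i x = 0" using fin by auto
    have "S k x = T x" if "m \<le> k" for k using S_eq[OF m that] T_eq[OF m] by simp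
    then show "(\<lambda>k. S k x) \<longlonglongrightarrow> T x"
      by (intro tendsto_eventually eventually_sequentiallyI)
  qed (auto simp: S_def intro: sum_nonneg)
  moreover have "bdd_above (range (\<lambda>k. N (S k)))" using SN by (intro bdd_aboveI) auto
  ultimately have T: "T \<in> X" "(\<lambda>k. N (S k)) \<longlonglongrightarrow> N T"
    using fatou SX unfolding fatou_property_def by blast+
  have TN: "N T \<le> e" using T(2) SN by (intro LIMSEQ_le_const2) auto
  have "\<bar>w x\<bar> \<le> \<bar>T x\<bar>" if "x \<in> \<Omega>" for x
  proof -
    obtain m where m: "\<forall>i\<ge>m. d i x = 0" using fin \<open>x \<in> \<Omega>\<close> by blast
    show ?thesis using le[OF \<open>x \<in> \<Omega>\<close> m] T_eq[OF m] by simp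
  qed
  then show "w \<in> X" "N w \<le> e" using ideal[OF T(1) w] TN by auto
qed

lemma convolution_test_function:
  assumes m: "mollifier A s \<phi>" and h: "integrable lebesgue h" "\<And>x. x \<notin> K \<Longrightarrow> h x = 0" and K: "compact K"
  shows "convolution \<phi> h \<in> test_functions UNIV"
proof (rule test_functionsI)
  have tf: "\<phi> \<in> test_functions UNIV" using m by (simp add: mollifier_def)
  show "C_k k (convolution \<phi> h)" for k by (rule C_k_convolution[OF tf h(1)])
  show "compact {y. \<exists>x\<in>K. dist x y \<le> s}" by (rule compact_Minkowski_ball[OF K])
  show "convolution \<phi> h x = 0" if "x \<notin> {y. \<exists>x\<in>K. dist x y \<le> s}" for x
    using that by (intro convolution_outside[OF m, of K] h(2))
qed simp

lemma test_functions_sum_UNIV: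
  "(\<And>i. i < (n::nat) \<Longrightarrow> w i \<in> test_functions UNIV) \<Longrightarrow> (\<lambda>x. \<Sum>i<n. w i x) \<in> test_functions UNIV"
proof (induction n)
  case 0
  then show ?case by (intro test_functionsI[of _ "{}"]) (auto intro: C_k_const)
next
  case (Suc n)
  have "(\<lambda>x. (\<Sum>i<n. w i x) + w n x) \<in> test_functions UNIV"
    unfolding test_functions_UNIV_iff
  proof (intro conjI allI)
    have a: "(\<lambda>x. \<Sum>i<n. w i x) \<in> test_functions UNIV" "w n \<in> test_functions UNIV" using Suc by auto
    show "C_k k (\<lambda>x. (\<Sum>i<n. w i x) + w n x)" for k
      by (rule C_k_add[OF test_functions_C_k[OF a(1)] test_functions_C_k[OF a(2)]])
    have "bounded ({x. (\<Sum>i<n. w i x) \<noteq> 0} \<union> {x. w n x \<noteq> 0})" using a by (simp add: test_functions_UNIV_iff)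
    then show "bounded {x. (\<Sum>i<n. w i x) + w n x \<noteq> 0}" by (rule bounded_subset) auto
  qed
  then show ?case by simp
qed

text \<open>Mollification must preserve local finiteness: the piece still vanishes outside U, and it
  vanishes on K because \<psi> is 0 on the neighbourhood V of K.\<close>

lemma local_mollification:
  assumes A: "0 < A" and mol: "\<And>s. 0 < s \<Longrightarrow> \<exists>\<phi> :: real^'n \<Rightarrow> real. mollifier A s \<phi>"
    and \<psi>: "\<psi> \<in> test_functions U" and U: "open U" "U \<subseteq> \<Omega>" and f: "f \<in> X" and g: "\<And>j. (\<lambda>x. g x $ j) \<in> X"
    and K: "compact K" "open V" "K \<subseteq> V" "\<And>x. x \<in> V \<Longrightarrow> \<psi> x = 0" and e: "0 < e"
  shows "\<exists>s \<phi>. 0 < s \<and> mollifier A s \<phi> \<and> (\<forall>l. convolution \<phi> (localized f g \<psi> l) \<in> X \<and>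
      N (\<lambda>x. convolution \<phi> (localized f g \<psi> l) x - localized f g \<psi> l x) \<le> e \<and>
      (\<forall>x. x \<notin> U \<or> x \<in> K \<longrightarrow> convolution \<phi> (localized f g \<psi> l) x = 0))"
proof -
  define S where "S = closure {x. \<psi> x \<noteq> 0}"
  have S: "compact S" "S \<subseteq> U" using \<psi> by (auto simp: test_functions_def S_def)
  have out: "x \<notin> S \<Longrightarrow> localized f g \<psi> l x = 0" for x l unfolding S_def by (rule localized_outside)
  have "\<exists>s0>0. \<forall>s \<phi>. 0 < s \<longrightarrow> s < s0 \<longrightarrow> mollifier A s \<phi> \<longrightarrow> convolution \<phi> (localized f g \<psi> l) \<in> X \<and>
      N (\<lambda>x. convolution \<phi> (localized f g \<psi> l) x - localized f g \<psi> l x) \<le> e" for l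
    using S U(2) by (intro mollification_tendsto[OF A localized_mem[OF \<psi> f g] S(1) _ out e]) auto
  then obtain s0 where s0: "\<And>l. 0 < s0 l" "\<And>l s \<phi>. \<lbrakk>0 < s; s < s0 l; mollifier A s \<phi>\<rbrakk> \<Longrightarrow>
      convolution \<phi> (localized f g \<psi> l) \<in> X \<and>
      N (\<lambda>x. convolution \<phi> (localized f g \<psi> l) x - localized f g \<psi> l x) \<le> e"
    by metis
  obtain r where r: "0 < r" "(\<Union>x\<in>S. ball x r) \<subseteq> U"
    by (rule compact_subset_open_imp_ball_epsilon_subset[OF S(1) U(1) S(2)])
  obtain t where t: "0 < t" "(\<Union>x\<in>K. ball x t) \<subseteq> V"
    by (rule compact_subset_open_imp_ball_epsilon_subset[OF K(1,2,3)])
  define M where "M = Min (range s0)"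
  \<comment> \<open>Halving puts s strictly below the margin r around the support, the margin t
    around K, and every threshold \<open>s0 l\<close>; M is positive because the index type is
    finite.\<close>
  define s where "s = min (min r t) M / 2"
  have "0 < M" using s0(1) by (simp add: M_def)
  then have s: "0 < s" "s < r" "s < t" "s < M" using r(1) t(1) by (auto simp: s_def min_def)
  have sl: "s < s0 l" for l
  proof -
    have "M \<le> s0 l" unfolding M_def by (rule Min_le) auto
    then show ?thesis using s(4) by linarith
  qed
  obtain \<phi> :: "real^'n \<Rightarrow> real" where \<phi>: "mollifier A s \<phi>" using mol[OF s(1)] by blast
  have SV: "y \<notin> S" if "y \<in> V" for y
  proof -
    have "S \<subseteq> - V" unfolding S_def using K(2,4) by (intro closure_minimal) auto
    then show ?thesis using that by blast
  qed
  have zero: "convolution \<phi> (localized f g \<psi> l) x = 0" if x: "x \<notin> U \<or> x \<in> K" for l x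
  proof (rule convolution_eq_0)
    show "s \<le> norm x \<Longrightarrow> \<phi> x = 0" for x using \<phi> by (simp add: mollifier_def)
    fix y assume y: "dist x y < s"
    have "y \<notin> S"
    proof
      assume "y \<in> S"
      have "x \<in> ball y r" using y s(2) by (simp add: dist_commute)
      then have "x \<in> U" using r(2) \<open>y \<in> S\<close> by blast
      then have "x \<in> K" using x by blast
      have "y \<in> ball x t" using y s(3) by simp
      then have "y \<in> V" using t(2) \<open>x \<in> K\<close> by blast
      then show False using SV \<open>y \<in> S\<close> by blast
    qed
    then show "localized f g \<psi> l y = 0" by (rule out)
  qed
  show ?thesis
    using s0(2)[OF s(1) sl \<phi>] zero s(1) \<phi> by (intro exI[of _ s] exI[of _ \<phi>]) blast
qed

text \<open>Linearity in the cutoff lets the pieces telescope together with their derivative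
  terms.\<close>

lemma localized_diff:
  assumes "\<psi> \<in> test_functions U" "\<zeta> \<in> test_functions V"
  shows "localized f g (\<lambda>x. \<psi> x - \<zeta> x) l x = localized f g \<psi> l x - localized f g \<zeta> l x"
  by (auto simp: localized_def left_diff_distrib
      partial_deriv_diff[OF test_functions_C_k[OF assms(1)] test_functions_C_k[OF assms(2)]]
      split: option.split)

text \<open>
  $\psi_i = \eta_i - \eta_{i-1}$ for cutoff functions $\eta_i$ of a compact exhaustion, so that the partial
  sums telescope.
\<close>

lemma smooth_partition:
  obtains C :: "nat \<Rightarrow> (real^'n) set" and \<psi> :: "nat \<Rightarrow> real^'n \<Rightarrow> real" where
    "\<And>m. compact (C m)" "\<And>m. C m \<subseteq> interior (C (Suc m))" "\<And>m. C m \<subseteq> \<Omega>" "(\<Union>m. C m) = \<Omega>"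
    "\<And>K. \<lbrakk>compact K; K \<subseteq> \<Omega>\<rbrakk> \<Longrightarrow> \<exists>m. K \<subseteq> C m"
    "\<And>i. \<psi> i \<in> test_functions (interior (C (Suc i)))"
    "\<And>i m x. \<lbrakk>m < i; x \<in> C m\<rbrakk> \<Longrightarrow> \<psi> i x = 0"
    "\<And>m x f g l. x \<in> C m \<Longrightarrow>
      (\<Sum>i<m + 2. localized f g (\<psi> i) l x) = (case l of None \<Rightarrow> f x | Some j \<Rightarrow> g x $ j)"
proof -
  obtain C where C: "\<And>m. compact (C m)" "\<And>m. C m \<subseteq> \<Omega>" "\<And>m. C m \<subseteq> interior (C (Suc m))" "\<Union> (range C) = \<Omega>"
    and Cex: "\<And>K. \<lbrakk>compact K; K \<subseteq> \<Omega>\<rbrakk> \<Longrightarrow> \<exists>N. \<forall>n\<ge>N. K \<subseteq> C n"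
    using open_Union_compact_subsets[OF open_\<Omega>] by metis
  have Cmono: "C m \<subseteq> C i" if "m \<le> i" for m i
    using lift_Suc_mono_le[of C m i] C(3) interior_subset that by (metis order_trans)
  have "\<exists>\<eta>. \<eta> \<in> test_functions (interior (C (Suc i))) \<and> (\<forall>x\<in>C i. \<eta> x = 1)" for i
    using smooth_cutoff[OF C(1) open_interior C(3), of i] by metis
  then obtain \<eta> where \<eta>: "\<And>i. \<eta> i \<in> test_functions (interior (C (Suc i)))" "\<And>i x. x \<in> C i \<Longrightarrow> \<eta> i x = 1" by metis
  define \<psi> where "\<psi> i = (case i of 0 \<Rightarrow> \<eta> 0 | Suc k \<Rightarrow> (\<lambda>x. \<eta> (Suc k) x - \<eta> k x))" for i
  have \<psi>tf: "\<psi> i \<in> test_functions (interior (C (Suc i)))" for i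
  proof (cases i)
    case (Suc k)
    let ?S = "closure {x. \<eta> (Suc k) x \<noteq> 0} \<union> closure {x. \<eta> k x \<noteq> 0}"
    have "\<psi> i = (\<lambda>x. \<eta> (Suc k) x - \<eta> k x)" using Suc by (simp add: \<psi>_def)
    moreover have "(\<lambda>x. \<eta> (Suc k) x - \<eta> k x) \<in> test_functions (interior (C (Suc (Suc k))))"
    proof (rule test_functionsI)
      show "C_k n (\<lambda>x. \<eta> (Suc k) x - \<eta> k x)" for n
        by (rule C_k_diff[OF test_functions_C_k[OF \<eta>(1)] test_functions_C_k[OF \<eta>(1)]])
      show "compact ?S" using \<eta>(1)[of k] \<eta>(1)[of "Suc k"] by (auto simp: test_functions_def)
      have "interior (C (Suc k)) \<subseteq> interior (C (Suc (Suc k)))" by (intro interior_mono Cmono) simp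
      then show "?S \<subseteq> interior (C (Suc (Suc k)))"
        using \<eta>(1)[of k] \<eta>(1)[of "Suc k"] by (auto simp: test_functions_def)
      show "\<eta> (Suc k) x - \<eta> k x = 0" if "x \<notin> ?S" for x
      proof -
        have "x \<notin> {x. \<eta> (Suc k) x \<noteq> 0}" "x \<notin> {x. \<eta> k x \<noteq> 0}"
          using that closure_subset[of "{x. \<eta> (Suc k) x \<noteq> 0}"] closure_subset[of "{x. \<eta> k x \<noteq> 0}"] by blast+
        then show ?thesis by simp
      qed
    qed
    ultimately show ?thesis using Suc by simp
  qed (use \<eta>(1)[of 0] in \<open>simp add: \<psi>_def\<close>)
  have \<psi>0: "\<psi> i x = 0" if mi: "m < i" "x \<in> C m" for i m x
  proof -
    obtain k where k: "i = Suc k" "m \<le> k" using mi(1) by (cases i) auto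
    \<comment> \<open>Both cutoffs that form \<psi>_i equal 1 at x, so their difference is
      0.\<close>
    then have "x \<in> C k" "x \<in> C (Suc k)" using Cmono[of m k] Cmono[of m "Suc k"] that(2) by auto
    then show ?thesis using \<eta>(2) k(1) by (simp add: \<psi>_def)
  qed
  have tele: "(\<Sum>i<Suc k. localized f g (\<psi> i) l x) = localized f g (\<eta> k) l x" for k f g l x
  proof (induction k)
    case (Suc k)
    have "localized f g (\<psi> (Suc k)) l x = localized f g (\<eta> (Suc k)) l x - localized f g (\<eta> k) l x"
      using localized_diff[OF \<eta>(1) \<eta>(1), of f g "Suc k" k] by (simp add: \<psi>_def)
    then show ?case using Suc by simp
  qed (simp add: \<psi>_def)
  have sum: "(\<Sum>i<m + 2. localized f g (\<psi> i) l x) = (case l of None \<Rightarrow> f x | Some j \<Rightarrow> g x $ j)"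
    if "x \<in> C m" for m x f g l
  proof -
    \<comment> \<open>The derivative terms have to cancel too, so the telescoped cutoff must equal 1
      in a neighbourhood of x and not just at x. The cutoff with index m + 1 does, hence m + 2 terms
      rather than m + 1.\<close>
    have x: "x \<in> interior (C (Suc m))" using C(3) that by blast
    have "partial_deriv j (\<eta> (Suc m)) x = 0" for j
      by (rule partial_deriv_eq_0_of_locally_const[OF open_interior x, of _ 1]) (use \<eta>(2) interior_subset in blast)
    moreover have "\<eta> (Suc m) x = 1" using \<eta>(2) x interior_subset by blast
    ultimately show ?thesis using tele[of f g l x "Suc m"] by (auto simp: localized_def split: option.split)
  qed
  have ex: "\<exists>m. K \<subseteq> C m" if "compact K" "K \<subseteq> \<Omega>" for K using Cex[OF that] by blast
  show ?thesis by (rule that[OF C(1,3,2,4) ex \<psi>tf \<psi>0 sum])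
qed

text \<open>Piece i is mollified with error at most e (1/2)^(i+1), so the total error is at most e.
  The index l lets one argument bound the error of the function and of each gradient
  component.\<close>

lemma smooth_approximation:
  assumes fg: "(f, g) \<in> W1_X \<Omega> X" and e: "0 < e"
  obtains u v where "u \<in> Lip \<Omega>" "(u, v) \<in> W1_X \<Omega> X"
    "(\<lambda>x. u x - f x) \<in> X" "N (\<lambda>x. u x - f x) \<le> e"
    "\<And>j. (\<lambda>x. v x $ j - g x $ j) \<in> X" "\<And>j. N (\<lambda>x. v x $ j - g x $ j) \<le> e"
proof -
  have f: "f \<in> X" and g: "\<And>j. (\<lambda>x. g x $ j) \<in> X" and weak: "\<And>j. weak_partial_deriv \<Omega> j f (\<lambda>x. g x $ j)"
    using fg by (auto simp: W1_X_def W11_loc_def)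
  obtain A where A: "0 < A" and mol: "\<And>s. 0 < s \<Longrightarrow> \<exists>\<phi> :: real^'n \<Rightarrow> real. mollifier A s \<phi>"
    using mollifier_exists by blast
  obtain C :: "nat \<Rightarrow> (real^'n) set" and \<psi> where C: "\<And>m. compact (C m)" "\<And>m. C m \<subseteq> interior (C (Suc m))"
      "\<And>m. C m \<subseteq> \<Omega>" "(\<Union>m. C m) = \<Omega>" "\<And>K. \<lbrakk>compact K; K \<subseteq> \<Omega>\<rbrakk> \<Longrightarrow> \<exists>m. K \<subseteq> C m"
    and \<psi>: "\<And>i. \<psi> i \<in> test_functions (interior (C (Suc i)))" "\<And>i m x. \<lbrakk>m < i; x \<in> C m\<rbrakk> \<Longrightarrow> \<psi> i x = 0"
    and sum: "\<And>m x f g l. x \<in> C m \<Longrightarrow>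
      (\<Sum>i<m + 2. localized f g (\<psi> i) l x) = (case l of None \<Rightarrow> f x | Some j \<Rightarrow> g x $ j)"
    by (rule smooth_partition) blast
  have Cmono: "C m \<subseteq> C i" if "m \<le> i" for m i
    using lift_Suc_mono_le[of C m i] C(2) interior_subset that by (metis order_trans)
  have I\<Omega>: "interior (C m) \<subseteq> \<Omega>" for m using C(3) interior_subset by blast
  have \<psi>\<Omega>: "\<psi> i \<in> test_functions \<Omega>" for i
    using \<psi>(1)[of i] I\<Omega>[of "Suc i"] by (auto simp: test_functions_def)
  define H where "H i l = localized f g (\<psi> i) l" for i l
  \<comment> \<open>\<psi>_i vanishes on C (i - 1), hence on a neighbourhood of C (i - 2), where the
    mollified piece can be made to vanish. For i < 2 natural subtraction would give C 0, on which
    the mollified piece need not vanish; hence the empty set.\<close>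
  define good where "good i s \<phi> \<longleftrightarrow> 0 < s \<and> mollifier A s \<phi> \<and> (\<forall>l. convolution \<phi> (H i l) \<in> X \<and>
      N (\<lambda>x. convolution \<phi> (H i l) x - H i l x) \<le> e * (1/2) ^ Suc i \<and>
      (\<forall>x. x \<notin> interior (C (Suc i)) \<or> x \<in> (if i < 2 then {} else C (i - 2)) \<longrightarrow> convolution \<phi> (H i l) x = 0))" for i s \<phi>
  have "\<exists>s \<phi>. good i s \<phi>" for i
    unfolding good_def H_def
  proof (rule local_mollification[OF A mol \<psi>(1) open_interior I\<Omega> f g])
    show "compact (if i < 2 then {} else C (i - 2))" using C(1) by simp
    show "open (if i < 2 then {} else interior (C (i - 1)))" by simp
    show "(if i < 2 then {} else C (i - 2)) \<subseteq> (if i < 2 then {} else interior (C (i - 1)))"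
      using C(2)[of "i - 2"] by (auto simp: Suc_diff_Suc numeral_2_eq_2)
    show "\<psi> i x = 0" if "x \<in> (if i < 2 then {} else interior (C (i - 1)))" for x
      using that \<psi>(2)[of "i - 1" i x] interior_subset[of "C (i - 1)"] by (auto split: if_splits)
    show "0 < e * (1/2) ^ Suc i" using e by simp
  qed
  then obtain s \<phi> where "\<And>i. good i (s i) (\<phi> i)" by metis
  then have \<phi>: "\<And>i. mollifier A (s i) (\<phi> i)"
    and cX: "\<And>i l. convolution (\<phi> i) (H i l) \<in> X"
    and cN: "\<And>i l. N (\<lambda>x. convolution (\<phi> i) (H i l) x - H i l x) \<le> e * (1/2) ^ Suc i"
    and c0: "\<And>i l x. x \<notin> interior (C (Suc i)) \<or> x \<in> (if i < 2 then {} else C (i - 2)) \<Longrightarrow> convolution (\<phi> i) (H i l) x = 0"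
    unfolding good_def by blast+
  define w where "w i l = convolution (\<phi> i) (H i l)" for i l
  have HX: "H i l \<in> X" for i l unfolding H_def by (rule localized_mem[OF \<psi>\<Omega> f g])
  have Hi: "integrable lebesgue (H i l)" for i l unfolding H_def by (rule localized_integrable[OF \<psi>\<Omega> f g])
  have wtf: "w i l \<in> test_functions UNIV" for i l
    unfolding w_def using \<psi>(1)[of i]
    by (intro convolution_test_function[OF \<phi> Hi, of "closure {x. \<psi> i x \<noteq> 0}"])
       (auto simp: H_def localized_outside test_functions_def)
  have w0: "w i l x = 0" if "x \<in> C m" "m + 2 \<le> i" for i l x m
  proof -
    have "m \<le> i - 2" using that(2) by linarith
    then have "x \<in> C (i - 2)" using Cmono that(1) by blast
    then show ?thesis unfolding w_def using that(2) by (intro c0) auto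
  qed
  have H0: "H i l x = 0" if "x \<in> C m" "m + 2 \<le> i" for i l x m
  proof -
    have x: "x \<in> interior (C (Suc m))" using C(2) that(1) by blast
    have z: "\<psi> i y = 0" if "y \<in> interior (C (Suc m))" for y
      using \<psi>(2)[of "Suc m" i y] interior_subset[of "C (Suc m)"] that \<open>m + 2 \<le> i\<close> by auto
    have "partial_deriv j (\<psi> i) x = 0" for j
      by (rule partial_deriv_eq_0_of_locally_const[OF open_interior x z])
    then show ?thesis using z[OF x] by (auto simp: H_def localized_def split: option.split)
  qed
  \<comment> \<open>The part of the series that is visible on C m: there it agrees with u, and as a
    finite sum of test functions it carries smoothness over to u.\<close>
  define P where "P m l x = (\<Sum>i<m + 2. w i l x)" for m l x
  define u where "u l x = (\<Sum>i. w i l x)" for l x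
  define T where "T l x = (case l of None \<Rightarrow> f x | Some j \<Rightarrow> g x $ j)" for l x
  have uP: "u l x = P m l x" if "x \<in> C m" for l x m
    unfolding u_def P_def using w0[OF that] by (intro suminf_finite) auto
  have Ptf: "P m l \<in> test_functions UNIV" for m l
    unfolding P_def[abs_def] by (intro test_functions_sum_UNIV wtf)
  have TX: "T l \<in> X" for l using f g by (cases l) (auto simp: T_def[abs_def])
  have um: "u l \<in> borel_measurable (lebesgue_on \<Omega>)" for l
    unfolding u_def[abs_def]
    by (intro borel_measurable_suminf measurable_restrict_\<Omega> continuous_imp_lebesgue_measurable test_functions_continuous[OF wtf])
  have diff: "(\<lambda>x. u l x - T l x) \<in> X" "N (\<lambda>x. u l x - T l x) \<le> e" for l
  proof -
    define d where "d i x = w i l x - H i l x" for i x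
    have dX: "d i \<in> X" for i unfolding d_def[abs_def] w_def by (rule diff_mem[OF cX HX])
    have dN: "N (d i) \<le> e * (1/2) ^ Suc i" for i unfolding d_def[abs_def] w_def by (rule cN)
    have eq: "u l x - T l x = (\<Sum>i<m + 2. d i x)" if "x \<in> C m" for x m
      using uP[OF that, of l] sum[OF that, of f g l] by (simp add: P_def d_def T_def H_def sum_subtractf)
    have d0: "d i x = 0" if "x \<in> C m" "m + 2 \<le> i" for i x m
      using w0[OF that] H0[OF that] by (simp add: d_def)
    have fin: "\<exists>m. \<forall>i\<ge>m. d i x = 0" if x: "x \<in> \<Omega>" for x
    proof -
      obtain m where "x \<in> C m" using C(4) x by blast
      then show ?thesis using d0 by (intro exI[of _ "m + 2"]) auto
    qed
    \<comment> \<open>Passing through the series of absolute values, whose sum does not depend on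
      where it is cut, transfers the bound from m + 2 to any k beyond which the terms
      vanish.\<close>
    have le: "\<bar>u l x - T l x\<bar> \<le> (\<Sum>i<k. \<bar>d i x\<bar>)" if x: "x \<in> \<Omega>" and k: "\<forall>i\<ge>k. d i x = 0" for x k
    proof -
      obtain m where m: "x \<in> C m" using C(4) x by blast
      have "\<bar>u l x - T l x\<bar> \<le> (\<Sum>i<m + 2. \<bar>d i x\<bar>)" unfolding eq[OF m] by (rule sum_abs)
      also have "\<dots> = (\<Sum>i. \<bar>d i x\<bar>)" using d0[OF m] by (intro suminf_finite[symmetric]) auto
      also have "\<dots> = (\<Sum>i<k. \<bar>d i x\<bar>)" using k by (intro suminf_finite) auto
      finally show ?thesis .
    qed
    have m: "(\<lambda>x. u l x - T l x) \<in> borel_measurable (lebesgue_on \<Omega>)"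
      using um mem_X_measurable[OF TX] by (rule borel_measurable_diff)
    show "(\<lambda>x. u l x - T l x) \<in> X" "N (\<lambda>x. u l x - T l x) \<le> e"
      using norm_series[OF dX dN less_imp_le[OF e] fin m le] by blast+
  qed
  have uX: "u l \<in> X" for l using add_mem[OF diff(1) TX, of l l] by simp
  define v where "v x = (\<chi> j. u (Some j) x)" for x
  \<comment> \<open>The weak derivative of a localized piece passes through its even kernel, so the
    classical derivative of each piece of u is the corresponding piece of v.\<close>
  have dP: "partial_deriv j (P m None) x = P m (Some j) x" for j m x
  proof -
    have "partial_deriv j (w i None) x = w i (Some j) x" for i
      unfolding w_def
    proof (rule partial_deriv_convolution_weak[OF \<phi> Hi])
      fix \<tau> :: "real^'n \<Rightarrow> real" assume "\<tau> \<in> test_functions UNIV"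
      then show "(LINT y|lebesgue. H i None y * partial_deriv j \<tau> y) = - (LINT y|lebesgue. H i (Some j) y * \<tau> y)"
        unfolding H_def by (rule localized_weak_deriv[OF \<psi>\<Omega> f g weak])
    qed
    then show ?thesis
      unfolding P_def[abs_def] by (subst partial_deriv_sum[OF test_functions_C_k[OF wtf]]) simp
  qed
  have "weak_partial_deriv \<Omega> j (u None) (u (Some j))" for j
    unfolding weak_partial_deriv_def
  proof
    fix \<theta> assume \<theta>: "\<theta> \<in> test_functions \<Omega>"
    then have "compact (closure {x. \<theta> x \<noteq> 0})" "closure {x. \<theta> x \<noteq> 0} \<subseteq> \<Omega>"
      by (auto simp: test_functions_def)
    \<comment> \<open>On the compact support of \<theta>, u coincides with the test function P m, so
      classical integration by parts suffices.\<close>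
    then obtain m where m: "closure {x. \<theta> x \<noteq> 0} \<subseteq> C m" using C(5) by blast
    have z: "\<theta> x = 0" "partial_deriv j \<theta> x = 0" if "x \<notin> C m" for x
      using that m closure_subset[of "{x. \<theta> x \<noteq> 0}"] partial_deriv_outside_support[of x \<theta> j] by auto
    have *: "(LINT x:\<Omega>|lebesgue. u l x * \<zeta> x) = (LINT x|lebesgue. P m l x * \<zeta> x)"
      if "\<And>x. x \<notin> C m \<Longrightarrow> \<zeta> x = 0" for \<zeta> l
      unfolding set_lebesgue_integral_def
    proof (intro Bochner_Integration.integral_cong refl)
      fix x
      show "indicat_real \<Omega> x *\<^sub>R (u l x * \<zeta> x) = P m l x * \<zeta> x"
        using that[of x] uP[of x m l] C(3)[of m] by (cases "x \<in> C m") auto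
    qed
    have "(LINT x|lebesgue. P m None x * partial_deriv j \<theta> x) = - (LINT x|lebesgue. P m (Some j) x * \<theta> x)"
      using integral_by_parts_test_function[OF test_functions_C_k[OF Ptf] test_functions_imp_UNIV[OF \<theta>]]
      by (simp add: dP)
    then show "(LINT x:\<Omega>|lebesgue. u None x * partial_deriv j \<theta> x) = - (LINT x:\<Omega>|lebesgue. u (Some j) x * \<theta> x)"
      using *[OF z(2)] *[OF z(1)] by simp
  qed
  then have uv: "(u None, v) \<in> W1_X \<Omega> X"
    using uX X_subset_L1_loc by (auto simp: W1_X_def W11_loc_def v_def)
  have lip: "u None \<in> Lip \<Omega>"
    unfolding Lip_def
  proof (intro CollectI ballI)
    fix x assume "x \<in> \<Omega>"
    then obtain m where "x \<in> C m" using C(4) by blast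
    then have "x \<in> interior (C (Suc m))" using C(2) by blast
    then obtain r where r: "0 < r" "ball x r \<subseteq> interior (C (Suc m))" using open_interior openE by blast
    obtain L where L: "L-lipschitz_on UNIV (P (Suc m) None)" using test_functions_lipschitz[OF Ptf] by blast
    have "u None y = P (Suc m) None y" if "y \<in> ball x r \<inter> \<Omega>" for y
      using that r(2) interior_subset by (intro uP) blast
    then have "L-lipschitz_on (ball x r \<inter> \<Omega>) (u None)"
      using L by (auto simp: lipschitz_on_def)
    then show "\<exists>r>0. \<exists>L. L-lipschitz_on (ball x r \<inter> \<Omega>) (u None)" using r(1) by blast
  qed
  show ?thesis
    using diff[of None] diff[of "Some _"] by (intro that[OF lip uv]) (simp_all add: T_def v_def)
qed

section \<open>The Sobolev norm and the two inclusions\<close>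

lemma gradient_norm_mem:
  assumes g: "\<And>j. (\<lambda>x. g x $ j :: real) \<in> X"
  shows "(\<lambda>x. norm (g x)) \<in> X" "N (\<lambda>x. norm (g x)) \<le> (\<Sum>j\<in>UNIV. N (\<lambda>x. g x $ j))" "N (\<lambda>x. g x $ j) \<le> N (\<lambda>x. norm (g x))"
proof -
  have gm: "(\<lambda>x. norm (g x)) \<in> borel_measurable (lebesgue_on \<Omega>)"
  proof -
    have [measurable]: "(\<lambda>x. g x $ j) \<in> borel_measurable (lebesgue_on \<Omega>)" for j by (rule mem_X_measurable[OF g])
    show ?thesis unfolding norm_vec_def L2_set_def real_norm_def by measurable
  qed
  have s: "(\<lambda>x. \<Sum>j\<in>UNIV. \<bar>g x $ j\<bar>) \<in> X" using abs_mem(1)[OF g] by (intro sum_mem)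
  have le: "\<bar>norm (g x)\<bar> \<le> \<bar>\<Sum>j\<in>UNIV. \<bar>g x $ j\<bar>\<bar>" for x
    using norm_le_l1_cart[of "g x"] by simp
  show m: "(\<lambda>x. norm (g x)) \<in> X" by (rule ideal(1)[OF s gm le])
  have "N (\<lambda>x. norm (g x)) \<le> N (\<lambda>x. \<Sum>j\<in>UNIV. \<bar>g x $ j\<bar>)" by (rule ideal(2)[OF s gm le])
  also have "\<dots> \<le> (\<Sum>j\<in>UNIV. N (\<lambda>x. \<bar>g x $ j\<bar>))" using abs_mem(1)[OF g] by (intro norm_sum)
  finally show "N (\<lambda>x. norm (g x)) \<le> (\<Sum>j\<in>UNIV. N (\<lambda>x. g x $ j))" by (simp add: abs_mem(2)[OF g])
  show "N (\<lambda>x. g x $ j) \<le> N (\<lambda>x. norm (g x))"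
    using component_le_norm_cart by (intro ideal(2)[OF m mem_X_measurable[OF g]]) auto
qed

text \<open>The pairing of \<theta> with an element h of X is at most the supremum of |\<theta>|
  times the local L1 bound C N h, where C depends only on the support of \<theta>.\<close>

lemma pairing_tendsto:
  assumes w: "\<And>k. w k \<in> X" and f: "f \<in> X" and lim: "(\<lambda>k. N (\<lambda>x. w k x - f x)) \<longlonglongrightarrow> 0"
    and \<theta>: "\<theta> \<in> test_functions \<Omega>"
  shows "(\<lambda>k. LINT x:\<Omega>|lebesgue. w k x * \<theta> x) \<longlonglongrightarrow> (LINT x:\<Omega>|lebesgue. f x * \<theta> x)"
proof -
  define K where "K = closure {x. \<theta> x \<noteq> 0}"
  have K: "compact K" "K \<subseteq> \<Omega>" using \<theta> by (auto simp: test_functions_def K_def)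
  have z: "x \<notin> K \<Longrightarrow> \<theta> x = 0" for x using closure_subset[of "{x. \<theta> x \<noteq> 0}"] by (auto simp: K_def)
  obtain B where B: "0 < B" "\<And>x. \<bar>\<theta> x\<bar> \<le> B" using test_functions_bounded[OF \<theta>] by blast
  obtain C where C: "0 \<le> C" "\<And>f. f \<in> X \<Longrightarrow> (\<integral>\<^sup>+x. ennreal \<bar>indicat_real K x * f x\<bar> \<partial>lebesgue) \<le> ennreal (C * N f)"
    using local_integral_bound[OF K] by blast
  have eq: "(LINT x:\<Omega>|lebesgue. h x * \<theta> x) = (LINT x|lebesgue. (indicat_real K x * h x) * \<theta> x)" for h
    unfolding set_lebesgue_integral_def
  proof (intro Bochner_Integration.integral_cong refl)
    fix x
    show "indicat_real \<Omega> x *\<^sub>R (h x * \<theta> x) = (indicat_real K x * h x) * \<theta> x"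
      using z[of x] K(2) by (cases "x \<in> K") auto
  qed
  have i: "integrable lebesgue (\<lambda>x. (indicat_real K x * h x) * \<theta> x)" if "h \<in> X" for h
    by (rule integrable_mult_test_function[OF local_integrable[OF that K] \<theta>])
  have bd: "\<bar>LINT x|lebesgue. (indicat_real K x * h x) * \<theta> x\<bar> \<le> B * (C * N h)" if h: "h \<in> X" for h
  proof -
    have li: "integrable lebesgue (\<lambda>x. \<bar>indicat_real K x * h x\<bar>)" using local_integrable[OF h K] by simp
    have "norm (LINT x|lebesgue. (indicat_real K x * h x) * \<theta> x) \<le> (LINT x|lebesgue. B * \<bar>indicat_real K x * h x\<bar>)"
    proof (rule Bochner_Integration.integral_norm_bound_integral[OF i[OF h] integrable_mult_right[OF li]])
      show "norm ((indicat_real K x * h x) * \<theta> x) \<le> B * \<bar>indicat_real K x * h x\<bar>" for x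
        using mult_right_mono[OF B(2)[of x], of "\<bar>indicat_real K x * h x\<bar>"] by (simp add: abs_mult mult.commute)
    qed
    also have "\<dots> = B * (LINT x|lebesgue. \<bar>indicat_real K x * h x\<bar>)" by simp
    also have "\<dots> \<le> B * (C * N h)"
    proof (rule mult_left_mono)
      have "ennreal (LINT x|lebesgue. \<bar>indicat_real K x * h x\<bar>) \<le> ennreal (C * N h)"
        using C(2)[OF h] nn_integral_eq_integral[OF li] by simp
      then show "(LINT x|lebesgue. \<bar>indicat_real K x * h x\<bar>) \<le> C * N h"
        using C(1) norm_nonneg[OF h] by (simp add: ennreal_le_iff)
    qed (use B in simp)
    finally show ?thesis by simp
  qed
  have "(\<lambda>k. (LINT x:\<Omega>|lebesgue. w k x * \<theta> x) - (LINT x:\<Omega>|lebesgue. f x * \<theta> x)) \<longlonglongrightarrow> 0"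
  proof (rule Lim_null_comparison)
    have "(LINT x:\<Omega>|lebesgue. w k x * \<theta> x) - (LINT x:\<Omega>|lebesgue. f x * \<theta> x)
      = (LINT x|lebesgue. (indicat_real K x * (w k x - f x)) * \<theta> x)" for k
      unfolding eq using i[OF w[of k]] i[OF f] by (simp add: left_diff_distrib right_diff_distrib)
    then show "\<forall>\<^sub>F k in sequentially. norm ((LINT x:\<Omega>|lebesgue. w k x * \<theta> x) - (LINT x:\<Omega>|lebesgue. f x * \<theta> x))
        \<le> B * (C * N (\<lambda>x. w k x - f x))"
      using bd[OF diff_mem[OF w f]] by (intro always_eventually) simp
    have "(\<lambda>k. B * (C * N (\<lambda>x. w k x - f x))) \<longlonglongrightarrow> B * (C * 0)" by (intro tendsto_intros lim)
    then show "(\<lambda>k. B * (C * N (\<lambda>x. w k x - f x))) \<longlonglongrightarrow> 0" by simp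
  qed
  then show ?thesis by (simp add: LIM_zero_cancel)
qed

lemma W1_norm_nonneg:
  assumes "f \<in> X" "\<And>j. (\<lambda>x. g x $ j) \<in> X" shows "N f \<le> W1_norm N f g" "N (\<lambda>x. g x $ j) \<le> W1_norm N f g" "0 \<le> W1_norm N f g"
  using norm_nonneg[OF assms(1)] norm_nonneg[OF gradient_norm_mem(1)[OF assms(2)]] gradient_norm_mem(3)[OF assms(2), of j]
  by (auto simp: W1_norm_def)

lemma H1_X_subset_W1_X: "H1_X \<Omega> X N \<subseteq> W1_X \<Omega> X"
proof (rule subrelI)
  fix f g assume "(f, g) \<in> H1_X \<Omega> X N"
  then obtain u v where f: "f \<in> X" and g: "\<And>j. (\<lambda>x. g x $ j) \<in> X" and uv: "\<And>k. (u k, v k) \<in> W1_X \<Omega> X"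
    and lim: "(\<lambda>k::nat. W1_norm N (\<lambda>x. u k x - f x) (\<lambda>x. v k x - g x)) \<longlonglongrightarrow> 0"
    unfolding H1_X_def by blast
  have u: "u k \<in> X" "(\<lambda>x. v k x $ j) \<in> X" "weak_partial_deriv \<Omega> j (u k) (\<lambda>x. v k x $ j)" for k j
    using uv[of k] by (auto simp: W1_X_def W11_loc_def)
  have vg: "(\<lambda>x. (v k x - g x) $ j) \<in> X" for k j using diff_mem[OF u(2) g] by simp
  note nn = W1_norm_nonneg[OF diff_mem[OF u(1) f] vg]
  have lu: "(\<lambda>k. N (\<lambda>x. u k x - f x)) \<longlonglongrightarrow> 0"
    using lim nn(1) norm_nonneg[OF diff_mem[OF u(1) f]]
    by (intro tendsto_sandwich[OF _ _ tendsto_const lim]) (auto intro!: always_eventually)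
  have lv: "(\<lambda>k. N (\<lambda>x. v k x $ j - g x $ j)) \<longlonglongrightarrow> 0" for j
    using nn(2) norm_nonneg[OF diff_mem[OF u(2) g]]
    by (intro tendsto_sandwich[OF _ _ tendsto_const lim]) (auto intro!: always_eventually)
  have "weak_partial_deriv \<Omega> j f (\<lambda>x. g x $ j)" for j
    unfolding weak_partial_deriv_def
  proof
    fix \<theta> assume \<theta>: "\<theta> \<in> test_functions \<Omega>"
    have "(\<lambda>k. LINT x:\<Omega>|lebesgue. u k x * partial_deriv j \<theta> x) \<longlonglongrightarrow> (LINT x:\<Omega>|lebesgue. f x * partial_deriv j \<theta> x)"
      by (rule pairing_tendsto[OF u(1) f lu test_functions_partial_deriv[OF \<theta>]])
    moreover have "(LINT x:\<Omega>|lebesgue. u k x * partial_deriv j \<theta> x) = - (LINT x:\<Omega>|lebesgue. v k x $ j * \<theta> x)" for k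
      using u(3) \<theta> by (simp add: weak_partial_deriv_def)
    moreover have "(\<lambda>k. - (LINT x:\<Omega>|lebesgue. v k x $ j * \<theta> x)) \<longlonglongrightarrow> - (LINT x:\<Omega>|lebesgue. g x $ j * \<theta> x)"
      by (intro tendsto_minus pairing_tendsto[OF u(2) g lv \<theta>])
    ultimately show "(LINT x:\<Omega>|lebesgue. f x * partial_deriv j \<theta> x) = - (LINT x:\<Omega>|lebesgue. g x $ j * \<theta> x)"
      using LIMSEQ_unique by simp
  qed
  then show "(f, g) \<in> W1_X \<Omega> X" using f g X_subset_L1_loc by (auto simp: W1_X_def W11_loc_def)
qed

lemma W1_norm_triangle:
  assumes a: "a \<in> X" "\<And>j. (\<lambda>x. a' x $ j) \<in> X" and b: "b \<in> X" "\<And>j. (\<lambda>x. b' x $ j) \<in> X"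
  shows "W1_norm N (\<lambda>x. a x - b x) (\<lambda>x. a' x - b' x) \<le> W1_norm N a a' + W1_norm N b b'"
proof -
  have d: "(\<lambda>x. (a' x - b' x) $ j) \<in> X" for j using diff_mem[OF a(2) b(2)] by simp
  have "N (\<lambda>x. norm (a' x - b' x)) \<le> N (\<lambda>x. norm (a' x) + norm (b' x))"
    using norm_triangle_ineq4
    by (intro ideal(2)[OF add_mem[OF gradient_norm_mem(1)[OF a(2)] gradient_norm_mem(1)[OF b(2)]]]
        mem_X_measurable[OF gradient_norm_mem(1)[OF d]]) auto
  also have "\<dots> \<le> N (\<lambda>x. norm (a' x)) + N (\<lambda>x. norm (b' x))"
    by (rule norm_triangle[OF gradient_norm_mem(1)[OF a(2)] gradient_norm_mem(1)[OF b(2)]])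
  finally show ?thesis using norm_diff_triangle[OF a(1) b(1)] by (simp add: W1_norm_def)
qed

lemma W1_X_subset_H1_X: "W1_X \<Omega> X \<subseteq> H1_X \<Omega> X N"
proof (rule subrelI)
  fix f g assume fg: "(f, g) \<in> W1_X \<Omega> X"
  have f: "f \<in> X" and g: "\<And>j. (\<lambda>x. g x $ j) \<in> X" using fg by (auto simp: W1_X_def)
  define n where "n = real CARD('n)"
  \<comment> \<open>The factor 1 + n counts the function and the n gradient components, each
    approximated up to 1 / (k + 1).\<close>
  define good where "good k u v \<longleftrightarrow> u \<in> Lip \<Omega> \<and> (u, v) \<in> W1_X \<Omega> X \<and>
    W1_norm N (\<lambda>x. u x - f x) (\<lambda>x. v x - g x) \<le> (1 + n) * (1 / Suc k)" for k u v
  have "\<exists>u v. good k u v" for k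
  proof -
    obtain u v where uv: "u \<in> Lip \<Omega>" "(u, v) \<in> W1_X \<Omega> X" "N (\<lambda>x. u x - f x) \<le> 1 / Suc k"
      "\<And>j. (\<lambda>x. v x $ j - g x $ j) \<in> X" "\<And>j. N (\<lambda>x. v x $ j - g x $ j) \<le> 1 / Suc k"
      by (rule smooth_approximation[OF fg, of "1 / Suc k"]) auto
    have "N (\<lambda>x. norm (v x - g x)) \<le> (\<Sum>j\<in>UNIV. N (\<lambda>x. (v x - g x) $ j))"
      using uv(4) by (intro gradient_norm_mem(2)) simp
    also have "\<dots> \<le> (\<Sum>j\<in>(UNIV::'n set). 1 / Suc k)" using uv(5) by (intro sum_mono) simp
    finally have "W1_norm N (\<lambda>x. u x - f x) (\<lambda>x. v x - g x) \<le> (1 + n) * (1 / Suc k)"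
      using uv(3) by (simp add: W1_norm_def n_def add_divide_distrib)
    then show ?thesis using uv(1,2) unfolding good_def by blast
  qed
  then obtain u v where "\<And>k. good k (u k) (v k)" by metis
  then have u: "\<And>k. u k \<in> Lip \<Omega>" and uv: "\<And>k. (u k, v k) \<in> W1_X \<Omega> X"
    and le: "\<And>k. W1_norm N (\<lambda>x. u k x - f x) (\<lambda>x. v k x - g x) \<le> (1 + n) * (1 / Suc k)"
    unfolding good_def by blast+
  have X: "(\<lambda>x. u k x - f x) \<in> X" "(\<lambda>x. (v k x - g x) $ j) \<in> X" for k j
    using uv[of k] diff_mem[OF _ f, of "u k"] diff_mem[OF _ g, of "\<lambda>x. v k x $ j" j] by (auto simp: W1_X_def)
  have "(\<lambda>k. (1 + n) * (1 / Suc k)) \<longlonglongrightarrow> (1 + n) * 0"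
    by (intro tendsto_intros LIMSEQ_Suc[OF lim_1_over_n])
  then have lim0: "(\<lambda>k. (1 + n) * (1 / Suc k)) \<longlonglongrightarrow> 0" by simp
  have lim: "(\<lambda>k. W1_norm N (\<lambda>x. u k x - f x) (\<lambda>x. v k x - g x)) \<longlonglongrightarrow> 0"
    by (rule tendsto_sandwich[OF always_eventually always_eventually tendsto_const lim0])
       (intro allI W1_norm_nonneg(3) X le)+
  have "\<exists>K. \<forall>k\<ge>K. \<forall>l\<ge>K. W1_norm N (\<lambda>x. u k x - u l x) (\<lambda>x. v k x - v l x) < e" if "0 < e" for e
  proof -
    obtain K where K: "\<And>k. k \<ge> K \<Longrightarrow> norm (W1_norm N (\<lambda>x. u k x - f x) (\<lambda>x. v k x - g x) - 0) < e / 2"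
      using LIMSEQ_D[OF lim] \<open>0 < e\<close> half_gt_zero by blast
    have "W1_norm N (\<lambda>x. u k x - u l x) (\<lambda>x. v k x - v l x) < e" if "k \<ge> K" "l \<ge> K" for k l
    proof -
      have "W1_norm N (\<lambda>x. u k x - u l x) (\<lambda>x. v k x - v l x)
        \<le> W1_norm N (\<lambda>x. u k x - f x) (\<lambda>x. v k x - g x) + W1_norm N (\<lambda>x. u l x - f x) (\<lambda>x. v l x - g x)"
        using W1_norm_triangle[OF X(1)[of k] X(2)[of k] X(1)[of l] X(2)[of l]] by simp
      also have "\<dots> < e" using K[OF that(1)] K[OF that(2)] by (simp add: abs_less_iff)
      finally show ?thesis .
    qed
    then show ?thesis by blast
  qed
  then show "(f, g) \<in> H1_X \<Omega> X N"
    unfolding H1_X_def using f g u uv lim by blast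
qed

end

theorem corollary1p3:
  fixes \<Omega> :: "(real^'n::finite) set"
    and X :: "((real^'n) \<Rightarrow> real) set"
    and N :: "((real^'n) \<Rightarrow> real) \<Rightarrow> real"
  assumes "domain_in_space \<Omega>"
    and "banach_function_space \<Omega> X N"
    and "fatou_property \<Omega> X N"
    and "absolutely_continuous_norm \<Omega> X N"
    and "muckenhoupt_condition \<Omega> X N"
    and "property_G \<Omega> X N"
  shows "H1_X \<Omega> X N = W1_X \<Omega> X"
proof -
  interpret mollifiable_space \<Omega> X N
    using assms by (auto simp: domain_in_space_def mollifiable_space_def mollifiable_space_axioms_def)
  show ?thesis using H1_X_subset_W1_X W1_X_subset_H1_X by (rule antisym)
qed

end
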